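(* Let $\mathcal{T}$ be a triangulated category, $\mathcal{S}$ a thick subcategory of $\mathcal{T}$, and $\mathcal{U}=\mathcal{T}/\mathcal{S}$ the Verdier quotient. Assume that $\mathcal{S}=\mathcal{X}\perp\mathcal{Y}$ is a co-t-structure, and that $\mathcal{T}$ has torsion pairs $\mathcal{T}=\mathcal{X}\perp\mathcal{X}^\perp={}^\perp\mathcal{Y}\perp\mathcal{Y}$. Put $\mathcal{Z}:=\mathcal{X}^\perp\cap{}^\perp(\mathcal{Y}[1])$ and $\mathcal{P}:=\mathcal{X}[1]\cap\mathcal{Y}$. Then the following hold. (a) The shift functor and triangles of the triangulated category $\mathcal{Z}/[\mathcal{P}]$ are the following. - For $X\in\mathcal{Z}$, take a triangle $X\xrightarrow{\iota_X}P_X\to X\langle1\rangle\to X[1]$ in $\mathcal{T}$ with a (fixed) left $\mathcal{P}$-approximation $\iota_X$. Then $\langle1\rangle$ gives a well-defined auto-equivalence of $\mathcal{Z}/[\mathcal{P}]$, which is the shift functor of $\mathcal{Z}/[\mathcal{P}]$. - For a triangle $X\xrightarrow{f}Y\xrightarrow{g}Z\xrightarrow{h}X[1]$ in $\mathcal{T}$ with $X,Y,Z\in\mathcal{Z}$, take a commutative diagram of triangles \[\begin{array}{ccccccc}X&\xrightarrow{f}&Y&\xrightarrow{g}&Z&\xrightarrow{h}&X[1]\\ \|&&\downarrow&&\downarrow{\scriptstyle a}&&\|\\ X&\xrightarrow{\iota_X}&P_X&\to&X\langle1\rangle&\to&X[1]\end{array}\] The triangles in $\mathcal{Z}/[\mathcal{P}]$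 are the diagrams which are isomorphic to the image of $X\xrightarrow{f}Y\xrightarrow{g}Z\xrightarrow{a}X\langle1\rangle$ in $\mathcal{Z}/[\mathcal{P}]$ for such data. (b) We have $\mathcal{T}=\mathcal{X}\perp\mathcal{Z}\perp\mathcal{Y}[1]$.
   Context: For full subcategories $\mathcal{X},\mathcal{Y}$ of a triangulated category $\mathcal{T}$ with shift $[1]$, $\mathcal{X}*\mathcal{Y}$ is the full subcategory of objects $T\in\mathcal{T}$ for which there is a triangle $X\to T\to Y\to X[1]$ with $X\in\mathcal{X}$, $Y\in\mathcal{Y}$. When $\mathrm{Hom}_{\mathcal{T}}(\mathcal{X},\mathcal{Y})=0$, one writes $\mathcal{X}\perp\mathcal{Y}$ for $\mathcal{X}*\mathcal{Y}$; $\mathcal{X}_1\perp\cdots\perp\mathcal{X}_n$ is defined inductively. Put $\mathcal{X}^\perp:=\{T\in\mathcal{T}\mid\mathrm{Hom}_{\mathcal{T}}(\mathcal{X},T)=0\}$ and ${}^\perp\mathcal{X}:=\{T\in\mathcal{T}\mid\mathrm{Hom}_{\mathcal{T}}(T,\mathcal{X})=0\}$ (these perpendicular categories, in the claim, are formed in $\mathcal{T}$). A torsion pair $\mathcal{T}=\mathcal{X}\perp\mathcal{Y}$ of a triangulated category $\mathcal{T}$ means that $\mathcal{T}=\mathcal{X}\perp\mathcal{Y}$, $\mathcal{X}={}^\perp\mathcal{Y}$ and $\mathcal{Y}=\mathcal{X}^\perp$ hold, with perpendiculars formed in the category being decomposed (so for $\mathcal{S}=\mathcal{X}\perp\mathcal{Y}$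 they are formed in $\mathcal{S}$). A co-t-structure is a torsion pair with $\mathcal{X}[1]\supset\mathcal{X}$. $\mathcal{Z}/[\mathcal{P}]$ is the additive category with the same objects as $\mathcal{Z}$ and $\mathrm{Hom}_{\mathcal{Z}/[\mathcal{P}]}(X,Y)=\mathrm{Hom}_{\mathcal{T}}(X,Y)/[\mathcal{P}](X,Y)$, where $[\mathcal{P}](X,Y)$ is the subgroup of morphisms factoring through objects of $\mathcal{P}$. Under the given assumptions the composition $\mathcal{Z}\subset\mathcal{T}\to\mathcal{U}$ induces an equivalence of additive categories $\mathcal{Z}/[\mathcal{P}]\simeq\mathcal{U}$, and "the triangulated category $\mathcal{Z}/[\mathcal{P}]$" refers to the triangulated structure transported from $\mathcal{U}$ along this equivalence. A left $\mathcal{P}$-approximation of $X$ is a morphism $\iota:X\to P$ with $P\in\mathcal{P}$ such that $\mathrm{Hom}_{\mathcal{T}}(P,P')\to\mathrm{Hom}_{\mathcal{T}}(X,P')$, $\phi\mapsto\phi\iota$, is surjective for every $P'\in\mathcal{P}$. *)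

theory Defs
  imports "HOL-Algebra.Coset"
begin

section \<open>Additive categories\<close>

text \<open>
  All Hom-sets of a category live in one type of morphisms, and Hom-sets belonging to different
  pairs of objects are required to be disjoint, so that composition and addition need not be
  indexed by objects.  The operations are only meaningful on objects in \<open>Obj\<close> and on
  composable (respectively parallel) morphisms.
\<close>

record ('o, 'm) cat =
  Obj :: "'o set"
  Hom :: "'o \<Rightarrow> 'o \<Rightarrow> 'm set"
  Ident :: "'o \<Rightarrow> 'm"
  Cmp :: "'m \<Rightarrow> 'm \<Rightarrow> 'm" (infixl "\<cdot>\<index>" 70)
  Plus :: "'m \<Rightarrow> 'm \<Rightarrow> 'm"
  Zero :: "'o \<Rightarrow> 'o \<Rightarrow> 'm"

text \<open>\<open>g \<cdot> f\<close> is composition in the usual order: first \<open>f\<close>, then \<open>g\<close>.\<close>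

definition hom_group :: "('o, 'm, 'x) cat_scheme \<Rightarrow> 'o \<Rightarrow> 'o \<Rightarrow> 'm monoid" where
  "hom_group C X Y = \<lparr>carrier = Hom C X Y, mult = Plus C, one = Zero C X Y\<rparr>"

definition neg :: "('o, 'm, 'x) cat_scheme \<Rightarrow> 'o \<Rightarrow> 'o \<Rightarrow> 'm \<Rightarrow> 'm" where
  "neg C X Y f = inv\<^bsub>hom_group C X Y\<^esub> f"

definition is_iso :: "('o, 'm, 'x) cat_scheme \<Rightarrow> 'o \<Rightarrow> 'o \<Rightarrow> 'm \<Rightarrow> bool" where
  "is_iso C X Y f \<longleftrightarrow> f \<in> Hom C X Y \<and>
     (\<exists>g\<in>Hom C Y X. Cmp C g f = Ident C X \<and> Cmp C f g = Ident C Y)"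

definition isomorphic :: "('o, 'm, 'x) cat_scheme \<Rightarrow> 'o \<Rightarrow> 'o \<Rightarrow> bool" where
  "isomorphic C X Y \<longleftrightarrow> (\<exists>f. is_iso C X Y f)"

definition zero_object :: "('o, 'm, 'x) cat_scheme \<Rightarrow> 'o \<Rightarrow> bool" where
  "zero_object C N \<longleftrightarrow> N \<in> Obj C \<and>
     (\<forall>X\<in>Obj C. (\<exists>!f. f \<in> Hom C X N) \<and> (\<exists>!f. f \<in> Hom C N X))"

text \<open>\<open>D\<close> is the direct sum of \<open>A\<close> and \<open>B\<close>, with inclusions \<open>i\<^sub>1, i\<^sub>2\<close> and projections
  \<open>p\<^sub>1, p\<^sub>2\<close>.\<close>

definition biproduct ::
  "('o, 'm, 'x) cat_scheme \<Rightarrow> 'o \<Rightarrow> 'o \<Rightarrow> 'o \<Rightarrow> 'm \<Rightarrow> 'm \<Rightarrow> 'm \<Rightarrow> 'm \<Rightarrow> bool" where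
  "biproduct C A B D i\<^sub>1 i\<^sub>2 p\<^sub>1 p\<^sub>2 \<longleftrightarrow>
     D \<in> Obj C \<and> i\<^sub>1 \<in> Hom C A D \<and> i\<^sub>2 \<in> Hom C B D \<and> p\<^sub>1 \<in> Hom C D A \<and> p\<^sub>2 \<in> Hom C D B \<and>
     Cmp C p\<^sub>1 i\<^sub>1 = Ident C A \<and> Cmp C p\<^sub>2 i\<^sub>2 = Ident C B \<and>
     Cmp C p\<^sub>2 i\<^sub>1 = Zero C A B \<and> Cmp C p\<^sub>1 i\<^sub>2 = Zero C B A \<and>
     Plus C (Cmp C i\<^sub>1 p\<^sub>1) (Cmp C i\<^sub>2 p\<^sub>2) = Ident C D"

locale category =
  fixes C :: "('o, 'm, 'x) cat_scheme" (structure)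
  assumes hom_disjoint:
      "\<lbrakk>X \<in> Obj C; Y \<in> Obj C; X' \<in> Obj C; Y' \<in> Obj C; f \<in> Hom C X Y; f \<in> Hom C X' Y'\<rbrakk>
       \<Longrightarrow> X = X' \<and> Y = Y'"
    and ident_hom: "X \<in> Obj C \<Longrightarrow> Ident C X \<in> Hom C X X"
    and cmp_hom:
      "\<lbrakk>X \<in> Obj C; Y \<in> Obj C; Z \<in> Obj C; f \<in> Hom C X Y; g \<in> Hom C Y Z\<rbrakk> \<Longrightarrow> g \<cdot> f \<in> Hom C X Z"
    and cmp_ident: "\<lbrakk>X \<in> Obj C; Y \<in> Obj C; f \<in> Hom C X Y\<rbrakk> \<Longrightarrow> f \<cdot> Ident C X = f"
    and ident_cmp: "\<lbrakk>X \<in> Obj C; Y \<in> Obj C; f \<in> Hom C X Y\<rbrakk> \<Longrightarrow> Ident C Y \<cdot> f = f"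
    and cmp_assoc:
      "\<lbrakk>W \<in> Obj C; X \<in> Obj C; Y \<in> Obj C; Z \<in> Obj C;
        f \<in> Hom C W X; g \<in> Hom C X Y; h \<in> Hom C Y Z\<rbrakk> \<Longrightarrow> h \<cdot> (g \<cdot> f) = (h \<cdot> g) \<cdot> f"

locale additive_category = category +
  assumes hom_comm_group: "\<lbrakk>X \<in> Obj C; Y \<in> Obj C\<rbrakk> \<Longrightarrow> comm_group (hom_group C X Y)"
    and cmp_plus_left:
      "\<lbrakk>X \<in> Obj C; Y \<in> Obj C; Z \<in> Obj C; f \<in> Hom C X Y; g \<in> Hom C Y Z; g' \<in> Hom C Y Z\<rbrakk>
       \<Longrightarrow> Plus C g g' \<cdot> f = Plus C (g \<cdot> f) (g' \<cdot> f)"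
    and cmp_plus_right:
      "\<lbrakk>X \<in> Obj C; Y \<in> Obj C; Z \<in> Obj C; f \<in> Hom C X Y; f' \<in> Hom C X Y; g \<in> Hom C Y Z\<rbrakk>
       \<Longrightarrow> g \<cdot> Plus C f f' = Plus C (g \<cdot> f) (g \<cdot> f')"
    and ex_zero_object: "\<exists>N. zero_object C N"
    and ex_biproduct:
      "\<lbrakk>A \<in> Obj C; B \<in> Obj C\<rbrakk> \<Longrightarrow> \<exists>D i\<^sub>1 i\<^sub>2 p\<^sub>1 p\<^sub>2. biproduct C A B D i\<^sub>1 i\<^sub>2 p\<^sub>1 p\<^sub>2"


section \<open>Functors and equivalences\<close>

text \<open>A functor is given by its object map \<open>Fo\<close> and its morphism map \<open>Fm\<close>.\<close>

definition is_functor ::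
  "('o, 'm, 'x) cat_scheme \<Rightarrow> ('p, 'n, 'y) cat_scheme \<Rightarrow> ('o \<Rightarrow> 'p) \<Rightarrow> ('m \<Rightarrow> 'n) \<Rightarrow> bool" where
  "is_functor C D Fo Fm \<longleftrightarrow>
     (\<forall>X\<in>Obj C. Fo X \<in> Obj D \<and> Fm (Ident C X) = Ident D (Fo X)) \<and>
     (\<forall>X\<in>Obj C. \<forall>Y\<in>Obj C. \<forall>f\<in>Hom C X Y. Fm f \<in> Hom D (Fo X) (Fo Y)) \<and>
     (\<forall>X\<in>Obj C. \<forall>Y\<in>Obj C. \<forall>Z\<in>Obj C. \<forall>f\<in>Hom C X Y. \<forall>g\<in>Hom C Y Z.
        Fm (Cmp C g f) = Cmp D (Fm g) (Fm f))"

definition natural_iso ::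
  "('o, 'm, 'x) cat_scheme \<Rightarrow> ('p, 'n, 'y) cat_scheme \<Rightarrow>
   ('o \<Rightarrow> 'p) \<Rightarrow> ('m \<Rightarrow> 'n) \<Rightarrow> ('o \<Rightarrow> 'p) \<Rightarrow> ('m \<Rightarrow> 'n) \<Rightarrow> ('o \<Rightarrow> 'n) \<Rightarrow> bool" where
  "natural_iso C D Fo Fm Go Gm \<eta> \<longleftrightarrow>
     (\<forall>X\<in>Obj C. is_iso D (Fo X) (Go X) (\<eta> X)) \<and>
     (\<forall>X\<in>Obj C. \<forall>Y\<in>Obj C. \<forall>f\<in>Hom C X Y. Cmp D (\<eta> Y) (Fm f) = Cmp D (Gm f) (\<eta> X))"

definition is_equivalence ::
  "('o, 'm, 'x) cat_scheme \<Rightarrow> ('p, 'n, 'y) cat_scheme \<Rightarrow> ('o \<Rightarrow> 'p) \<Rightarrow> ('m \<Rightarrow> 'n) \<Rightarrow> bool" where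
  "is_equivalence C D Fo Fm \<longleftrightarrow> is_functor C D Fo Fm \<and>
     (\<exists>Go Gm \<eta> \<epsilon>. is_functor D C Go Gm \<and>
        natural_iso C C id id (Go \<circ> Fo) (Gm \<circ> Fm) \<eta> \<and>
        natural_iso D D (Fo \<circ> Go) (Fm \<circ> Gm) id id \<epsilon>)"

definition additive_equivalence ::
  "('o, 'm, 'x) cat_scheme \<Rightarrow> ('p, 'n, 'y) cat_scheme \<Rightarrow> ('o \<Rightarrow> 'p) \<Rightarrow> ('m \<Rightarrow> 'n) \<Rightarrow> bool" where
  "additive_equivalence C D Fo Fm \<longleftrightarrow> is_equivalence C D Fo Fm \<and>
     (\<forall>X\<in>Obj C. \<forall>Y\<in>Obj C. \<forall>f\<in>Hom C X Y. \<forall>g\<in>Hom C X Y.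
        Fm (Plus C f g) = Plus D (Fm f) (Fm g))"


section \<open>Triangulated categories\<close>

text \<open>The diagram \<open>X \<rightarrow>\<^sub>f Y \<rightarrow>\<^sub>g Z \<rightarrow>\<^sub>h X[1]\<close> is encoded as \<open>(X, Y, Z, f, g, h)\<close>.\<close>

type_synonym ('o, 'm) diagram = "'o \<times> 'o \<times> 'o \<times> 'm \<times> 'm \<times> 'm"

record ('o, 'm) tcat = "('o, 'm) cat" +
  Shift :: "'o \<Rightarrow> 'o"
  ShiftM :: "'m \<Rightarrow> 'm"
  Tri :: "('o, 'm) diagram set"

definition diagrams :: "('o, 'm, 'x) tcat_scheme \<Rightarrow> ('o, 'm) diagram set" where
  "diagrams T = {(X, Y, Z, f, g, h). X \<in> Obj T \<and> Y \<in> Obj T \<and> Z \<in> Obj T \<and>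
     f \<in> Hom T X Y \<and> g \<in> Hom T Y Z \<and> h \<in> Hom T Z (Shift T X)}"

fun tri_hom ::
  "('o, 'm, 'x) tcat_scheme \<Rightarrow> ('o, 'm) diagram \<Rightarrow> ('o, 'm) diagram \<Rightarrow> 'm \<Rightarrow> 'm \<Rightarrow> 'm \<Rightarrow> bool"
where
  "tri_hom T (X, Y, Z, f, g, h) (X', Y', Z', f', g', h') a b c \<longleftrightarrow>
     a \<in> Hom T X X' \<and> b \<in> Hom T Y Y' \<and> c \<in> Hom T Z Z' \<and>
     Cmp T b f = Cmp T f' a \<and> Cmp T c g = Cmp T g' b \<and> Cmp T (ShiftM T a) h = Cmp T h' c"

fun tri_iso ::
  "('o, 'm, 'x) tcat_scheme \<Rightarrow> ('o, 'm) diagram \<Rightarrow> ('o, 'm) diagram \<Rightarrow> bool"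
where
  "tri_iso T (X, Y, Z, f, g, h) (X', Y', Z', f', g', h') \<longleftrightarrow>
     (\<exists>a b c. tri_hom T (X, Y, Z, f, g, h) (X', Y', Z', f', g', h') a b c \<and>
        is_iso T X X' a \<and> is_iso T Y Y' b \<and> is_iso T Z Z' c)"

text \<open>The shift is only required to be an auto-equivalence, not an automorphism.\<close>

locale triangulated_category = additive_category C
  for C :: "('o, 'm, 'x) tcat_scheme" (structure) +
  assumes shift_equivalence: "additive_equivalence C C (Shift C) (ShiftM C)"
    and tri_diagrams: "Tri C \<subseteq> diagrams C"
    and tri_iso_closed: "\<lbrakk>D \<in> Tri C; D' \<in> diagrams C; tri_iso C D D'\<rbrakk> \<Longrightarrow> D' \<in> Tri C"
    and tri_ident:
      "\<lbrakk>X \<in> Obj C; zero_object C N\<rbrakk>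
       \<Longrightarrow> (X, X, N, Ident C X, Zero C X N, Zero C N (Shift C X)) \<in> Tri C"
    and tri_cone:
      "\<lbrakk>X \<in> Obj C; Y \<in> Obj C; f \<in> Hom C X Y\<rbrakk> \<Longrightarrow> \<exists>Z g h. (X, Y, Z, f, g, h) \<in> Tri C"
    and tri_rotate:
      "(X, Y, Z, f, g, h) \<in> diagrams C \<Longrightarrow>
         (X, Y, Z, f, g, h) \<in> Tri C \<longleftrightarrow>
         (Y, Z, Shift C X, g, h, neg C (Shift C X) (Shift C Y) (ShiftM C f)) \<in> Tri C"
    and tri_complete:
      "\<lbrakk>(X, Y, Z, f, g, h) \<in> Tri C; (X', Y', Z', f', g', h') \<in> Tri C;
        a \<in> Hom C X X'; b \<in> Hom C Y Y'; b \<cdot> f = f' \<cdot> a\<rbrakk>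
       \<Longrightarrow> \<exists>c. tri_hom C (X, Y, Z, f, g, h) (X', Y', Z', f', g', h') a b c"
    and tri_octahedral:
      "\<lbrakk>(X, Y, Z', u, j, k) \<in> Tri C; (Y, Z, X', v, l, i) \<in> Tri C;
        (X, Z, Y', v \<cdot> u, m, n) \<in> Tri C\<rbrakk>
       \<Longrightarrow> \<exists>f g. (Z', Y', X', f, g, ShiftM C j \<cdot> i) \<in> Tri C \<and>
             f \<cdot> j = m \<cdot> v \<and> n \<cdot> f = k \<and> g \<cdot> m = l \<and> i \<cdot> g = ShiftM C u \<cdot> n"


section \<open>Subcategories and torsion pairs\<close>

text \<open>Full subcategories are identified with their sets of objects.\<close>

definition thick :: "('o, 'm, 'x) tcat_scheme \<Rightarrow> 'o set \<Rightarrow> bool" where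
  "thick T S \<longleftrightarrow> S \<subseteq> Obj T \<and> S \<noteq> {} \<and>
     (\<forall>A\<in>Obj T. Shift T A \<in> S \<longleftrightarrow> A \<in> S) \<and>
     (\<forall>A B E f g h. (A, B, E, f, g, h) \<in> Tri T \<longrightarrow> A \<in> S \<longrightarrow> B \<in> S \<longrightarrow> E \<in> S) \<and>
     (\<forall>A\<in>Obj T. \<forall>B\<in>Obj T. \<forall>D\<in>S. \<forall>i\<^sub>1 i\<^sub>2 p\<^sub>1 p\<^sub>2. biproduct T A B D i\<^sub>1 i\<^sub>2 p\<^sub>1 p\<^sub>2 \<longrightarrow> A \<in> S)"

text \<open>A triangulated subcategory regarded as a triangulated category in its own right.\<close>

definition full_sub :: "('o, 'm, 'x) tcat_scheme \<Rightarrow> 'o set \<Rightarrow> ('o, 'm, 'x) tcat_scheme" where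
  "full_sub T S = T\<lparr>Obj := S,
     Tri := {(X, Y, Z, f, g, h). (X, Y, Z, f, g, h) \<in> Tri T \<and> X \<in> S \<and> Y \<in> S \<and> Z \<in> S}\<rparr>"

text \<open>\<open>\<X>[1]\<close>, closed under isomorphism because the shift is only an auto-equivalence.\<close>

definition shifted :: "('o, 'm, 'x) tcat_scheme \<Rightarrow> 'o set \<Rightarrow> 'o set" where
  "shifted T XX = {A \<in> Obj T. \<exists>B\<in>XX. isomorphic T (Shift T B) A}"

definition hom_zero :: "('o, 'm, 'x) cat_scheme \<Rightarrow> 'o set \<Rightarrow> 'o set \<Rightarrow> bool" where
  "hom_zero C XX YY \<longleftrightarrow> (\<forall>A\<in>XX. \<forall>B\<in>YY. Hom C A B = {Zero C A B})"

definition right_perp :: "('o, 'm, 'x) cat_scheme \<Rightarrow> 'o set \<Rightarrow> 'o set" where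
  "right_perp C XX = {A \<in> Obj C. hom_zero C XX {A}}"

definition left_perp :: "('o, 'm, 'x) cat_scheme \<Rightarrow> 'o set \<Rightarrow> 'o set" where
  "left_perp C XX = {A \<in> Obj C. hom_zero C {A} XX}"

definition star :: "('o, 'm, 'x) tcat_scheme \<Rightarrow> 'o set \<Rightarrow> 'o set \<Rightarrow> 'o set" where
  "star T XX YY = {A \<in> Obj T. \<exists>X\<in>XX. \<exists>Y\<in>YY. \<exists>f g h. (X, A, Y, f, g, h) \<in> Tri T}"

text \<open>\<open>\<X>\<^sub>1 * (\<X>\<^sub>2 * (\<dots> * \<X>\<^sub>n))\<close>, together with the Hom-vanishing conditions which permit to write
  \<open>\<bottom>\<close> in place of each \<open>*\<close>.\<close>

fun star_list :: "('o, 'm, 'x) tcat_scheme \<Rightarrow> 'o set list \<Rightarrow> 'o set" where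
  "star_list T [] = {A. zero_object T A}"
| "star_list T [XX] = XX"
| "star_list T (XX # YY # ZZs) = star T XX (star_list T (YY # ZZs))"

fun hom_zero_list :: "('o, 'm, 'x) tcat_scheme \<Rightarrow> 'o set list \<Rightarrow> bool" where
  "hom_zero_list T [] \<longleftrightarrow> True"
| "hom_zero_list T [XX] \<longleftrightarrow> True"
| "hom_zero_list T (XX # YY # ZZs) \<longleftrightarrow>
     hom_zero T XX (star_list T (YY # ZZs)) \<and> hom_zero_list T (YY # ZZs)"

text \<open>\<open>\<T> = \<X>\<^sub>1 \<bottom> \<dots> \<bottom> \<X>\<^sub>n\<close>\<close>

definition perp_decomposition :: "('o, 'm, 'x) tcat_scheme \<Rightarrow> 'o set list \<Rightarrow> bool" where
  "perp_decomposition T XXs \<longleftrightarrow> (\<forall>XX\<in>set XXs. XX \<subseteq> Obj T) \<and>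
     hom_zero_list T XXs \<and> Obj T = star_list T XXs"

definition torsion_pair :: "('o, 'm, 'x) tcat_scheme \<Rightarrow> 'o set \<Rightarrow> 'o set \<Rightarrow> bool" where
  "torsion_pair T XX YY \<longleftrightarrow> perp_decomposition T [XX, YY] \<and>
     XX = left_perp T YY \<and> YY = right_perp T XX"

definition co_t_structure :: "('o, 'm, 'x) tcat_scheme \<Rightarrow> 'o set \<Rightarrow> 'o set \<Rightarrow> bool" where
  "co_t_structure T XX YY \<longleftrightarrow> torsion_pair T XX YY \<and> XX \<subseteq> shifted T XX"


section \<open>Verdier quotients\<close>

text \<open>Morphisms \<open>A \<rightarrow> X\<close> whose cone lies in \<open>S\<close>; these become invertible in \<open>T/S\<close>.\<close>

definition denoms :: "('o, 'm, 'x) tcat_scheme \<Rightarrow> 'o set \<Rightarrow> 'o \<Rightarrow> 'o \<Rightarrow> 'm set" where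
  "denoms T S A X = {s \<in> Hom T A X. \<exists>E\<in>S. \<exists>g h. (A, X, E, s, g, h) \<in> Tri T}"

text \<open>The pair \<open>(s, f)\<close> stands for the roof \<open>X \<leftarrow>\<^sub>s A \<rightarrow>\<^sub>f Y\<close>, i.e. for the fraction
  \<open>f s\<^sup>-\<^sup>1\<close>; two roofs are identified if they are dominated by a common third one.\<close>

definition roofs :: "('o, 'm, 'x) tcat_scheme \<Rightarrow> 'o set \<Rightarrow> 'o \<Rightarrow> 'o \<Rightarrow> ('m \<times> 'm) set" where
  "roofs T S X Y = {(s, f). \<exists>A\<in>Obj T. s \<in> denoms T S A X \<and> f \<in> Hom T A Y}"

definition roof_rel ::
  "('o, 'm, 'x) tcat_scheme \<Rightarrow> 'o set \<Rightarrow> 'o \<Rightarrow> 'o \<Rightarrow> (('m \<times> 'm) \<times> ('m \<times> 'm)) set" where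
  "roof_rel T S X Y = {((s, f), (t, g)). \<exists>A\<in>Obj T. \<exists>B\<in>Obj T. \<exists>D\<in>Obj T.
     s \<in> denoms T S A X \<and> f \<in> Hom T A Y \<and> t \<in> denoms T S B X \<and> g \<in> Hom T B Y \<and>
     (\<exists>u\<in>Hom T D A. \<exists>v\<in>Hom T D B. Cmp T s u \<in> denoms T S D X \<and>
        Cmp T s u = Cmp T t v \<and> Cmp T f u = Cmp T g v)}"

definition roof_class ::
  "('o, 'm, 'x) tcat_scheme \<Rightarrow> 'o set \<Rightarrow> 'o \<Rightarrow> 'o \<Rightarrow> 'm \<times> 'm \<Rightarrow> ('m \<times> 'm) set" where
  "roof_class T S X Y r = roof_rel T S X Y `` {r}"

text \<open>The localisation functor \<open>T \<rightarrow> T/S\<close> on morphisms (it is the identity on objects).\<close>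

definition loc_mor :: "('o, 'm, 'x) tcat_scheme \<Rightarrow> 'o set \<Rightarrow> 'm \<Rightarrow> ('m \<times> 'm) set" where
  "loc_mor T S f = {r. \<exists>X\<in>Obj T. \<exists>Y\<in>Obj T. f \<in> Hom T X Y \<and>
     r \<in> roof_class T S X Y (Ident T X, f)}"

text \<open>The operations on classes of roofs are defined by taking all results obtained from
  representatives; sums are formed on representatives with a common denominator.\<close>

definition verdier_cmp ::
  "('o, 'm, 'x) tcat_scheme \<Rightarrow> 'o set \<Rightarrow> ('m \<times> 'm) set \<Rightarrow> ('m \<times> 'm) set \<Rightarrow> ('m \<times> 'm) set" where
  "verdier_cmp T S d c = {r. \<exists>X\<in>Obj T. \<exists>Y\<in>Obj T. \<exists>Z\<in>Obj T. \<exists>A\<in>Obj T. \<exists>B\<in>Obj T. \<exists>D\<in>Obj T.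
     \<exists>s f t g t' f'. (s, f) \<in> c \<and> (t, g) \<in> d \<and>
       s \<in> denoms T S A X \<and> f \<in> Hom T A Y \<and> t \<in> denoms T S B Y \<and> g \<in> Hom T B Z \<and>
       t' \<in> denoms T S D A \<and> f' \<in> Hom T D B \<and> Cmp T f t' = Cmp T t f' \<and>
       r \<in> roof_class T S X Z (Cmp T s t', Cmp T g f')}"

definition verdier_plus ::
  "('o, 'm, 'x) tcat_scheme \<Rightarrow> 'o set \<Rightarrow> ('m \<times> 'm) set \<Rightarrow> ('m \<times> 'm) set \<Rightarrow> ('m \<times> 'm) set" where
  "verdier_plus T S c d = {r. \<exists>X\<in>Obj T. \<exists>Y\<in>Obj T. \<exists>A\<in>Obj T.
     \<exists>s f g. (s, f) \<in> c \<and> (s, g) \<in> d \<and>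
       s \<in> denoms T S A X \<and> f \<in> Hom T A Y \<and> g \<in> Hom T A Y \<and>
       r \<in> roof_class T S X Y (s, Plus T f g)}"

definition verdier_shift ::
  "('o, 'm, 'x) tcat_scheme \<Rightarrow> 'o set \<Rightarrow> ('m \<times> 'm) set \<Rightarrow> ('m \<times> 'm) set" where
  "verdier_shift T S c = {r. \<exists>X\<in>Obj T. \<exists>Y\<in>Obj T. \<exists>s f. (s, f) \<in> c \<and> (s, f) \<in> roofs T S X Y \<and>
     r \<in> roof_class T S (Shift T X) (Shift T Y) (ShiftM T s, ShiftM T f)}"

text \<open>The Verdier quotient before its triangles have been specified; the notion of isomorphism of
  diagrams only depends on this part of the structure.\<close>

definition verdier_pre :: "('o, 'm, 'x) tcat_scheme \<Rightarrow> 'o set \<Rightarrow> ('o, ('m \<times> 'm) set) tcat" where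
  "verdier_pre T S = \<lparr>
     Obj = Obj T,
     Hom = (\<lambda>X Y. roofs T S X Y // roof_rel T S X Y),
     Ident = (\<lambda>X. loc_mor T S (Ident T X)),
     Cmp = verdier_cmp T S,
     Plus = verdier_plus T S,
     Zero = (\<lambda>X Y. loc_mor T S (Zero T X Y)),
     Shift = Shift T,
     ShiftM = verdier_shift T S,
     Tri = {}\<rparr>"

definition verdier :: "('o, 'm, 'x) tcat_scheme \<Rightarrow> 'o set \<Rightarrow> ('o, ('m \<times> 'm) set) tcat" where
  "verdier T S = (verdier_pre T S)\<lparr>
     Tri := {D \<in> diagrams (verdier_pre T S). \<exists>X Y Z f g h. (X, Y, Z, f, g, h) \<in> Tri T \<and>
       tri_iso (verdier_pre T S) (X, Y, Z, loc_mor T S f, loc_mor T S g, loc_mor T S h) D}\<rparr>"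


section \<open>The quotient \<open>\<Z>/[\<P>]\<close>\<close>

definition factoring :: "('o, 'm, 'x) cat_scheme \<Rightarrow> 'o set \<Rightarrow> 'o \<Rightarrow> 'o \<Rightarrow> 'm set" where
  "factoring C PP X Y = {Cmp C g f | g f P. P \<in> PP \<and> f \<in> Hom C X P \<and> g \<in> Hom C P Y}"

definition ideal_class :: "('o, 'm, 'x) cat_scheme \<Rightarrow> 'o set \<Rightarrow> 'o set \<Rightarrow> 'm \<Rightarrow> 'm set" where
  "ideal_class C ZZ PP f = {h. \<exists>X\<in>ZZ. \<exists>Y\<in>ZZ. f \<in> Hom C X Y \<and>
     h \<in> factoring C PP X Y #>\<^bsub>hom_group C X Y\<^esub> f}"

definition ideal_quotient ::
  "('o, 'm, 'x) cat_scheme \<Rightarrow> 'o set \<Rightarrow> 'o set \<Rightarrow> ('o, 'm set) cat" where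
  "ideal_quotient C ZZ PP = \<lparr>
     Obj = ZZ,
     Hom = (\<lambda>X Y. carrier (hom_group C X Y Mod factoring C PP X Y)),
     Ident = (\<lambda>X. ideal_class C ZZ PP (Ident C X)),
     Cmp = (\<lambda>d c. \<Union>g\<in>d. \<Union>f\<in>c. ideal_class C ZZ PP (Cmp C g f)),
     Plus = (\<lambda>c d. {Plus C f g | f g. f \<in> c \<and> g \<in> d}),
     Zero = (\<lambda>X Y. factoring C PP X Y)\<rparr>"

text \<open>The functor \<open>\<Z>/[\<P>] \<rightarrow> T/S\<close> induced by \<open>\<Z> \<subseteq> T \<rightarrow> T/S\<close>, on morphisms.  The union is
  taken over all representatives; it is a morphism of \<open>T/S\<close> only if they all have the same
  image.\<close>

definition induced_mor :: "('o, 'm, 'x) tcat_scheme \<Rightarrow> 'o set \<Rightarrow> 'm set \<Rightarrow> ('m \<times> 'm) set" where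
  "induced_mor T S c = (\<Union>f\<in>c. loc_mor T S f)"

definition left_approx ::
  "('o, 'm, 'x) cat_scheme \<Rightarrow> 'o set \<Rightarrow> 'o \<Rightarrow> 'o \<Rightarrow> 'm \<Rightarrow> bool" where
  "left_approx C PP X P i \<longleftrightarrow> P \<in> PP \<and> i \<in> Hom C X P \<and>
     (\<forall>P'\<in>PP. \<forall>g\<in>Hom C X P'. \<exists>\<phi>\<in>Hom C P P'. g = Cmp C \<phi> i)"

text \<open>
  A choice of triangles is given by a function \<open>\<Delta>\<close> which sends an object \<open>X\<close> to
  \<open>(P, N, i, p, d)\<close>, standing for the triangle \<open>X \<rightarrow>\<^sub>i P \<rightarrow>\<^sub>p N \<rightarrow>\<^sub>d X[1]\<close>; here
  \<open>N\<close> is \<open>X\<langle>1\<rangle>\<close>.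
\<close>

type_synonym ('o, 'm) choice = "'o \<Rightarrow> 'o \<times> 'o \<times> 'm \<times> 'm \<times> 'm"

definition approx_triangle ::
  "('o, 'm, 'x) tcat_scheme \<Rightarrow> 'o set \<Rightarrow> 'o \<Rightarrow> 'o \<times> 'o \<times> 'm \<times> 'm \<times> 'm \<Rightarrow> bool" where
  "approx_triangle T PP X = (\<lambda>(P, N, i, p, d).
     left_approx T PP X P i \<and> (X, P, N, i, p, d) \<in> Tri T)"

definition tri_of :: "('o, 'm) choice \<Rightarrow> 'o \<Rightarrow> ('o, 'm) diagram" where
  "tri_of \<Delta> X = (case \<Delta> X of (P, N, i, p, d) \<Rightarrow> (X, P, N, i, p, d))"

definition ang_obj :: "('o, 'm) choice \<Rightarrow> 'o \<Rightarrow> 'o" where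
  "ang_obj \<Delta> X = (case \<Delta> X of (P, N, i, p, d) \<Rightarrow> N)"

text \<open>The morphisms \<open>X\<langle>1\<rangle> \<rightarrow> Y\<langle>1\<rangle>\<close> of \<open>T\<close> belonging to a morphism of the chosen triangles of the
  form \<open>(f, e, f')\<close>.\<close>

definition ang_lifts ::
  "('o, 'm, 'x) tcat_scheme \<Rightarrow> ('o, 'm) choice \<Rightarrow> 'o \<Rightarrow> 'o \<Rightarrow> 'm \<Rightarrow> 'm set" where
  "ang_lifts T \<Delta> X Y f = {f'. \<exists>e. tri_hom T (tri_of \<Delta> X) (tri_of \<Delta> Y) f e f'}"

definition ang_mor ::
  "('o, 'm, 'x) tcat_scheme \<Rightarrow> 'o set \<Rightarrow> 'o set \<Rightarrow> ('o, 'm) choice \<Rightarrow> 'm set \<Rightarrow> 'm set" where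
  "ang_mor T ZZ PP \<Delta> c = {k. \<exists>X\<in>ZZ. \<exists>Y\<in>ZZ. \<exists>f\<in>c. f \<in> Hom T X Y \<and>
     (\<exists>f'\<in>ang_lifts T \<Delta> X Y f. k \<in> ideal_class T ZZ PP f')}"

text \<open>Data as in the description of the triangles: a triangle of \<open>T\<close> with all terms in \<open>ZZ\<close>,
  together with \<open>a : Z \<rightarrow> X\<langle>1\<rangle>\<close> for which there is a morphism \<open>(1\<^sub>X, b, a)\<close> to the chosen
  triangle of \<open>X\<close>.\<close>

definition ang_data ::
  "('o, 'm, 'x) tcat_scheme \<Rightarrow> 'o set \<Rightarrow> ('o, 'm) choice \<Rightarrow> ('o, 'm) diagram \<Rightarrow> 'm \<Rightarrow> bool" where
  "ang_data T ZZ \<Delta> = (\<lambda>(X, Y, Z, f, g, h) a.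
     X \<in> ZZ \<and> Y \<in> ZZ \<and> Z \<in> ZZ \<and> (X, Y, Z, f, g, h) \<in> Tri T \<and>
     (\<exists>b. tri_hom T (X, Y, Z, f, g, h) (tri_of \<Delta> X) (Ident T X) b a))"

definition ang_pre ::
  "('o, 'm, 'x) tcat_scheme \<Rightarrow> 'o set \<Rightarrow> 'o set \<Rightarrow> ('o, 'm) choice \<Rightarrow> ('o, 'm set) tcat" where
  "ang_pre T ZZ PP \<Delta> = \<lparr>
     Obj = Obj (ideal_quotient T ZZ PP),
     Hom = Hom (ideal_quotient T ZZ PP),
     Ident = Ident (ideal_quotient T ZZ PP),
     Cmp = Cmp (ideal_quotient T ZZ PP),
     Plus = Plus (ideal_quotient T ZZ PP),
     Zero = Zero (ideal_quotient T ZZ PP),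
     Shift = ang_obj \<Delta>,
     ShiftM = ang_mor T ZZ PP \<Delta>,
     Tri = {}\<rparr>"

text \<open>\<open>\<Z>/[\<P>]\<close> with the shift \<open>\<langle>1\<rangle>\<close> and the diagrams isomorphic to the image of
  \<open>X \<rightarrow>\<^sub>f Y \<rightarrow>\<^sub>g Z \<rightarrow>\<^sub>a X\<langle>1\<rangle>\<close> for data as above.\<close>

definition ang ::
  "('o, 'm, 'x) tcat_scheme \<Rightarrow> 'o set \<Rightarrow> 'o set \<Rightarrow> ('o, 'm) choice \<Rightarrow> ('o, 'm set) tcat" where
  "ang T ZZ PP \<Delta> = (ang_pre T ZZ PP \<Delta>)\<lparr>
     Tri := {D \<in> diagrams (ang_pre T ZZ PP \<Delta>).
       \<exists>X Y Z f g h a. ang_data T ZZ \<Delta> (X, Y, Z, f, g, h) a \<and>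
         tri_iso (ang_pre T ZZ PP \<Delta>)
           (X, Y, Z, ideal_class T ZZ PP f, ideal_class T ZZ PP g, ideal_class T ZZ PP a) D}\<rparr>"

text \<open>
  The shift and the triangles of \<open>B\<close> are those transported from \<open>U\<close> along the equivalence
  \<open>F\<close>: the shift of \<open>B\<close> is the one of \<open>U\<close> under \<open>F\<close>, via a natural isomorphism
  \<open>\<phi> : F \<circ> Shift B \<cong> Shift U \<circ> F\<close>, and with this identification the triangles of \<open>B\<close> are
  precisely the diagrams whose image is a triangle of \<open>U\<close>.  For a quasi-inverse \<open>G\<close> of \<open>F\<close>,
  the shift \<open>G \<circ> Shift U \<circ> F\<close> with \<open>\<phi>\<close> given by the counit is an instance.
\<close>

definition transported_structure ::
  "('o, 'm, 'x) tcat_scheme \<Rightarrow> ('p, 'n, 'y) tcat_scheme \<Rightarrow> ('o \<Rightarrow> 'p) \<Rightarrow> ('m \<Rightarrow> 'n) \<Rightarrow> bool" where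
  "transported_structure B U Fo Fm \<longleftrightarrow>
     additive_equivalence B U Fo Fm \<and>
     is_functor B B (Shift B) (ShiftM B) \<and>
     Tri B \<subseteq> diagrams B \<and>
     (\<exists>\<phi>. natural_iso B U (Fo \<circ> Shift B) (Fm \<circ> ShiftM B) (Shift U \<circ> Fo) (ShiftM U \<circ> Fm) \<phi> \<and>
        (\<forall>X Y Z u v w. (X, Y, Z, u, v, w) \<in> diagrams B \<longrightarrow>
           ((X, Y, Z, u, v, w) \<in> Tri B \<longleftrightarrow>
            (Fo X, Fo Y, Fo Z, Fm u, Fm v, Cmp U (\<phi> X) (Fm w)) \<in> Tri U)))"

end

(*
  Every object of T is isomorphic in U = T/S to an object of Z, by truncating with the two torsion
  pairs.  If s : A -> M is a morphism with cone in S and M lies in Z, then M has no nonzero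
  morphisms to Y[1], so s may be refined until its cone lies in X[1].  As an object N of Z receives
  no nonzero morphisms from X, morphisms A -> N then extend along s; hence T -> U is full on Z, and
  a morphism of Z becomes zero in U iff it factors through X[1], equivalently through P.

  The connecting morphism X<1> -> X[1] has cone in S, so it is invertible in U and identifies the
  image of <1> with [1].  As Z/[P] -> U is faithful, all identities about <1> may be checked in U.
  Every triangle of T is isomorphic in U to one with all terms in Z: truncate its first map to a
  map f : M -> M' in Z, and replace f by the map M -> M' + P whose second component is a left
  approximation; the cone of this map lies in Z again.
*)
theory Submission
  imports Defs
begin

section \<open>Categories and equivalences\<close>

text \<open>Two things shape the argument. The shift is only an auto-equivalence, so a desuspension
  exists only up to isomorphism: whenever a triangle is rotated backwards or an object is written as
  E'[1], the chosen isomorphism has to be carried along; \<open>fibre\<close> packages this for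
  cones. And classes of roofs and cosets of an ideal are awkward to compute with. Both are traded
  for images under \<open>loc\<close>: the class of \<open>(s, f)\<close> becomes the only solution
  c of c s = f in the quotient (\<open>roof_loc\<close>, \<open>loc_den_iso\<close>), and the coset
  of f modulo [P] becomes the set of parallel morphisms with the same image in U
  (\<open>ic_eq\<close>). Addition in U is evaluated only on such images, which reaches all
  morphisms between objects of Z because the functor is full there.

  The two halves of P = X[1] \<inter> Y act differently. Since P lies in Y, approximations arise
  from the torsion pair that ends in Y. Since P lies in X[1], Hom(P, M[1]) = 0 for M in Z, which
  makes <1> full and faithful.\<close>

context category
begin

text \<open>\<open>Hom\<close> is unconstrained at indices outside \<open>Obj\<close>, so both
  endpoints are bundled into the typing judgement.\<close>

definition arr :: "'m \<Rightarrow> 'o \<Rightarrow> 'o \<Rightarrow> bool" where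
  "arr f X Y \<longleftrightarrow> X \<in> Obj C \<and> Y \<in> Obj C \<and> f \<in> Hom C X Y"

definition is_arr :: "'m \<Rightarrow> bool" where
  "is_arr f \<longleftrightarrow> (\<exists>X Y. arr f X Y)"

definition src :: "'m \<Rightarrow> 'o" where
  "src f = (THE X. \<exists>Y. arr f X Y)"

definition tgt :: "'m \<Rightarrow> 'o" where
  "tgt f = (THE Y. \<exists>X. arr f X Y)"

lemma arr_unique: "arr f X Y \<Longrightarrow> arr f X' Y' \<Longrightarrow> X = X' \<and> Y = Y'"
  using hom_disjoint unfolding arr_def by blast

lemma arr_src: "arr f X Y \<Longrightarrow> src f = X"
  unfolding src_def using arr_unique by blast

lemma arr_tgt: "arr f X Y \<Longrightarrow> tgt f = Y"
  unfolding tgt_def using arr_unique by blast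

text \<open>Hom-sets are pairwise disjoint, so the endpoints are functions of the morphism. With
  typing judgements rewritten to equations about \<open>src\<close> and \<open>tgt\<close>, the
  simplifier checks composability by itself.\<close>

lemma arr_iff [simp]:
  "arr f X Y \<longleftrightarrow> X \<in> Obj C \<and> Y \<in> Obj C \<and> is_arr f \<and> src f = X \<and> tgt f = Y"
  unfolding is_arr_def using arr_src arr_tgt arr_def by metis

lemma arr_objs: "arr f X Y \<Longrightarrow> X \<in> Obj C \<and> Y \<in> Obj C"
  by simp

lemma hom_arr: "X \<in> Obj C \<Longrightarrow> Y \<in> Obj C \<Longrightarrow> f \<in> Hom C X Y \<longleftrightarrow> arr f X Y"
  using arr_def by blast

lemma arr_hom: "arr f X Y \<Longrightarrow> f \<in> Hom C X Y"
  using arr_def by blast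

lemma is_arr_obj [simp]: "is_arr f \<Longrightarrow> src f \<in> Obj C" "is_arr f \<Longrightarrow> tgt f \<in> Obj C"
  by (metis arr_iff is_arr_def)+

lemma is_arr_arr: "is_arr f \<Longrightarrow> arr f (src f) (tgt f)"
  by simp

lemma ident_arr: "X \<in> Obj C \<Longrightarrow> arr (Ident C X) X X"
  using ident_hom arr_def by blast

lemma ident_typing [simp]:
  "X \<in> Obj C \<Longrightarrow> is_arr (Ident C X)" "X \<in> Obj C \<Longrightarrow> src (Ident C X) = X"
  "X \<in> Obj C \<Longrightarrow> tgt (Ident C X) = X"
  using ident_arr by simp_all

lemma cmp_arr: "arr f X Y \<Longrightarrow> arr g Y Z \<Longrightarrow> arr (g \<cdot> f) X Z"
  using cmp_hom unfolding arr_def by blast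

lemma cmp_typing [simp]:
  assumes "is_arr f" "is_arr g" "tgt f = src g"
  shows "is_arr (g \<cdot> f)" "src (g \<cdot> f) = src f" "tgt (g \<cdot> f) = tgt g"
  using cmp_arr[of f "src f" "tgt f" g "tgt g"] assms by simp_all

lemma cmp_ident_right [simp]: "is_arr f \<Longrightarrow> src f = X \<Longrightarrow> f \<cdot> Ident C X = f"
  using cmp_ident is_arr_arr unfolding arr_def by blast

lemma cmp_ident_left [simp]: "is_arr f \<Longrightarrow> tgt f = X \<Longrightarrow> Ident C X \<cdot> f = f"
  using ident_cmp is_arr_arr unfolding arr_def by blast

lemma cmp_assoc_right [simp]:
  assumes "is_arr f" "is_arr g" "is_arr h" "tgt f = src g" "tgt g = src h"
  shows "(h \<cdot> g) \<cdot> f = h \<cdot> (g \<cdot> f)"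
  using cmp_assoc[of "src f" "tgt f" "tgt g" "tgt h" f g h] assms
    is_arr_arr[of f] is_arr_arr[of g] is_arr_arr[of h] unfolding arr_def by simp

text \<open>Composites are normalised to the right, where an equation for \<open>g \<cdot> f\<close>
  matches only at the end of a chain; this form applies it in front of a remaining factor
  \<open>x\<close>.\<close>

lemma cmp_pre:
  assumes "g \<cdot> f = k" "is_arr f" "is_arr g" "is_arr x" "tgt x = src f" "tgt f = src g"
  shows "g \<cdot> (f \<cdot> x) = k \<cdot> x"
  using assms cmp_assoc_right by metis

lemma is_isoD:
  assumes "is_iso C X Y f" "X \<in> Obj C" "Y \<in> Obj C"
  shows "\<exists>g. arr f X Y \<and> arr g Y X \<and> g \<cdot> f = Ident C X \<and> f \<cdot> g = Ident C Y"
  using assms unfolding is_iso_def by (meson hom_arr)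

lemma is_isoI:
  assumes "arr f X Y" "arr g Y X" "g \<cdot> f = Ident C X" "f \<cdot> g = Ident C Y"
  shows "is_iso C X Y f"
  using assms unfolding is_iso_def by (meson arr_hom)

lemma iso_ident: "X \<in> Obj C \<Longrightarrow> is_iso C X X (Ident C X)"
  using is_isoI[of "Ident C X" X X "Ident C X"] by simp

lemma iso_cmp:
  assumes f: "is_iso C X Y f" and g: "is_iso C Y Z g" and "X \<in> Obj C" "Y \<in> Obj C" "Z \<in> Obj C"
  shows "is_iso C X Z (g \<cdot> f)"
proof -
  obtain f' where f': "arr f X Y" "arr f' Y X" "f' \<cdot> f = Ident C X" "f \<cdot> f' = Ident C Y"
    using is_isoD[OF f] assms(3-5) by blast
  obtain g' where g': "arr g Y Z" "arr g' Z Y" "g' \<cdot> g = Ident C Y" "g \<cdot> g' = Ident C Z"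
    using is_isoD[OF g] assms(3-5) by blast
  show ?thesis
  proof (rule is_isoI[where g = "f' \<cdot> g'"])
    show "arr (g \<cdot> f) X Z" "arr (f' \<cdot> g') Z X" using f' g' by simp_all
    show "(f' \<cdot> g') \<cdot> (g \<cdot> f) = Ident C X" using f' g' by (simp_all add: cmp_pre[OF g'(3)])
    show "(g \<cdot> f) \<cdot> (f' \<cdot> g') = Ident C Z" using f' g' by (simp_all add: cmp_pre[OF f'(4)])
  qed
qed

lemma iso_cancel_left:
  assumes f: "is_iso C Y Z f" "Y \<in> Obj C" "Z \<in> Obj C"
    and "arr a X Y" "arr b X Y" "f \<cdot> a = f \<cdot> b"
  shows "a = b"
proof -
  obtain f' where f': "arr f Y Z" "arr f' Z Y" "f' \<cdot> f = Ident C Y" "f \<cdot> f' = Ident C Z"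
    using is_isoD[OF f] by blast
  have "f' \<cdot> (f \<cdot> a) = a" "f' \<cdot> (f \<cdot> b) = b" using f' assms(4-5) by (simp_all add: cmp_pre[OF f'(3)])
  then show ?thesis using assms(6) by metis
qed

lemma iso_cancel_right:
  assumes "is_iso C X Y f" "X \<in> Obj C" "Y \<in> Obj C"
    and "arr a Y Z" "arr b Y Z" "a \<cdot> f = b \<cdot> f"
  shows "a = b"
proof -
  obtain g where g: "arr f X Y" "arr g Y X" "f \<cdot> g = Ident C Y"
    using is_isoD[OF assms(1-3)] by blast
  have "(a \<cdot> f) \<cdot> g = (b \<cdot> f) \<cdot> g" using assms(6) by simp
  then show ?thesis using g assms(4,5) by simp
qed

lemma iso_inverse:
  assumes "is_iso C X Y f" "X \<in> Obj C" "Y \<in> Obj C"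
  shows "\<exists>g. is_iso C Y X g \<and> g \<cdot> f = Ident C X \<and> f \<cdot> g = Ident C Y"
  using is_isoD[OF assms] is_isoI by metis

end

section \<open>Functors, and equivalences as full, faithful and dense functors\<close>

lemma is_functorI:
  assumes "\<And>X. X \<in> Obj C \<Longrightarrow> Fo X \<in> Obj D"
    and "\<And>X. X \<in> Obj C \<Longrightarrow> Fm (Ident C X) = Ident D (Fo X)"
    and "\<And>X Y f. \<lbrakk>X \<in> Obj C; Y \<in> Obj C; f \<in> Hom C X Y\<rbrakk> \<Longrightarrow> Fm f \<in> Hom D (Fo X) (Fo Y)"
    and "\<And>X Y Z f g. \<lbrakk>X \<in> Obj C; Y \<in> Obj C; Z \<in> Obj C; f \<in> Hom C X Y; g \<in> Hom C Y Z\<rbrakk>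
           \<Longrightarrow> Fm (Cmp C g f) = Cmp D (Fm g) (Fm f)"
  shows "is_functor C D Fo Fm"
  using assms unfolding is_functor_def by blast

locale functor_pair = C: category C + D: category D
  for C :: "('o, 'm, 'x) cat_scheme" and D :: "('p, 'n, 'y) cat_scheme" +
  fixes Fo :: "'o \<Rightarrow> 'p" and Fm :: "'m \<Rightarrow> 'n"
  assumes is_functor: "is_functor C D Fo Fm"
begin

lemma obj_map [simp]: "X \<in> Obj C \<Longrightarrow> Fo X \<in> Obj D"
  using is_functor unfolding is_functor_def by blast

lemma map_ident [simp]: "X \<in> Obj C \<Longrightarrow> Fm (Ident C X) = Ident D (Fo X)"
  using is_functor unfolding is_functor_def by blast

lemma map_arr: "C.arr f X Y \<Longrightarrow> D.arr (Fm f) (Fo X) (Fo Y)"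
  using is_functor unfolding is_functor_def C.arr_def D.arr_def by blast

lemma map_typing [simp]:
  assumes "C.is_arr f"
  shows "D.is_arr (Fm f)" "D.src (Fm f) = Fo (C.src f)" "D.tgt (Fm f) = Fo (C.tgt f)"
  using map_arr[of f] C.is_arr_arr[OF assms] by (metis D.arr_iff)+

lemma map_cmp [simp]:
  assumes "C.is_arr f" "C.is_arr g" "C.tgt f = C.src g"
  shows "Fm (Cmp C g f) = Cmp D (Fm g) (Fm f)"
  using is_functor C.is_arr_arr[of f] C.is_arr_arr[of g] assms
  unfolding is_functor_def C.arr_def by metis

lemma map_iso:
  assumes "is_iso C X Y f" "X \<in> Obj C" "Y \<in> Obj C"
  shows "is_iso D (Fo X) (Fo Y) (Fm f)"
proof -
  obtain g where g: "C.arr f X Y" "C.arr g Y X" "Cmp C g f = Ident C X" "Cmp C f g = Ident C Y"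
    using C.is_isoD assms by blast
  have "Cmp D (Fm g) (Fm f) = Ident D (Fo X)" "Cmp D (Fm f) (Fm g) = Ident D (Fo Y)"
    using g map_cmp[of f g] map_cmp[of g f] by simp_all
  then show ?thesis using D.is_isoI map_arr g by blast
qed

definition faithful :: bool where
  "faithful \<longleftrightarrow> (\<forall>X Y f g. C.arr f X Y \<longrightarrow> C.arr g X Y \<longrightarrow> Fm f = Fm g \<longrightarrow> f = g)"

definition full :: bool where
  "full \<longleftrightarrow> (\<forall>X\<in>Obj C. \<forall>Y\<in>Obj C. \<forall>h. D.arr h (Fo X) (Fo Y) \<longrightarrow> (\<exists>f. C.arr f X Y \<and> Fm f = h))"

definition dense :: bool where
  "dense \<longleftrightarrow> (\<forall>Z\<in>Obj D. \<exists>X\<in>Obj C. \<exists>h. is_iso D (Fo X) Z h)"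

text \<open>Fullness lifts the inverse, and faithfulness lifts the two identities it
  satisfies.\<close>

lemma reflect_iso:
  assumes ff: "faithful" "full" and "C.arr f X Y" "is_iso D (Fo X) (Fo Y) (Fm f)"
  shows "is_iso C X Y f"
proof -
  have XY: "X \<in> Obj C" "Y \<in> Obj C" using assms(3) by simp_all
  obtain h where h: "D.arr h (Fo Y) (Fo X)" "Cmp D h (Fm f) = Ident D (Fo X)"
    "Cmp D (Fm f) h = Ident D (Fo Y)"
    using D.is_isoD[OF assms(4)] XY obj_map by blast
  obtain g where g: "C.arr g Y X" "Fm g = h" using ff(2) h(1) XY unfolding full_def by blast
  have "Fm (Cmp C g f) = Fm (Ident C X)" "Fm (Cmp C f g) = Fm (Ident C Y)"
    using g h assms(3) by simp_all
  moreover have "C.arr (Cmp C g f) X X" "C.arr (Cmp C f g) Y Y" "C.arr (Ident C X) X X"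
    "C.arr (Ident C Y) Y Y"
    using g assms(3) by simp_all
  ultimately have "Cmp C g f = Ident C X" "Cmp C f g = Ident C Y"
    using ff(1) unfolding faithful_def by meson+
  then show ?thesis using C.is_isoI g assms(3) by blast
qed

lemma equivalence_if:
  assumes ff: "faithful" "full" and de: "dense"
  shows "is_equivalence C D Fo Fm"
proof -
  have "\<forall>Z. Z \<in> Obj D \<longrightarrow> (\<exists>X h k. X \<in> Obj C \<and> D.arr h (Fo X) Z \<and> D.arr k Z (Fo X) \<and>
      Cmp D k h = Ident D (Fo X) \<and> Cmp D h k = Ident D Z)"
  proof (intro allI impI)
    fix Z assume Z: "Z \<in> Obj D"
    then obtain X h where X: "X \<in> Obj C" "is_iso D (Fo X) Z h" using de unfolding dense_def by blast
    then show "\<exists>X h k. X \<in> Obj C \<and> D.arr h (Fo X) Z \<and> D.arr k Z (Fo X) \<and>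
      Cmp D k h = Ident D (Fo X) \<and> Cmp D h k = Ident D Z"
      using D.is_isoD[OF X(2) obj_map[OF X(1)] Z] by metis
  qed
  then obtain Go e e' where G: "\<And>Z. Z \<in> Obj D \<Longrightarrow> Go Z \<in> Obj C"
    and "\<And>Z. Z \<in> Obj D \<Longrightarrow> D.arr (e Z) (Fo (Go Z)) Z \<and> D.arr (e' Z) Z (Fo (Go Z)) \<and>
      Cmp D (e' Z) (e Z) = Ident D (Fo (Go Z)) \<and> Cmp D (e Z) (e' Z) = Ident D Z" by metis
  note e = this
  have e_typing [simp]: "D.is_arr (e Z)" "D.src (e Z) = Fo (Go Z)" "D.tgt (e Z) = Z"
    "D.is_arr (e' Z)" "D.src (e' Z) = Z" "D.tgt (e' Z) = Fo (Go Z)" if "Z \<in> Obj D" for Z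
    using e[OF that] by simp_all
  have e_inv: "Cmp D (e' Z) (e Z) = Ident D (Fo (Go Z))" "Cmp D (e Z) (e' Z) = Ident D Z"
    if "Z \<in> Obj D" for Z using e[OF that] by simp_all
  \<comment> \<open>\<open>Gm h\<close> is the lift of \<open>h\<close> conjugated by the
    isomorphisms \<open>e\<close>. A morphism map receives no objects, so the endpoints are read off
    with \<open>src\<close> and \<open>tgt\<close>.\<close>
  define Gm where "Gm h = (SOME f. C.arr f (Go (D.src h)) (Go (D.tgt h)) \<and>
    Fm f = Cmp D (e' (D.tgt h)) (Cmp D h (e (D.src h))))" for h
  have Gm: "C.arr (Gm h) (Go X) (Go Y) \<and> Fm (Gm h) = Cmp D (e' Y) (Cmp D h (e X))"
    if "D.arr h X Y" for h X Y
  proof -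
    have "D.arr (Cmp D (e' Y) (Cmp D h (e X))) (Fo (Go X)) (Fo (Go Y))"
      using that by (simp_all add: G)
    then have "\<exists>f. C.arr f (Go X) (Go Y) \<and> Fm f = Cmp D (e' Y) (Cmp D h (e X))"
      using ff(2) that G unfolding full_def by (metis D.arr_iff)
    moreover have "D.src h = X" "D.tgt h = Y" using that by simp_all
    ultimately show ?thesis unfolding Gm_def by (metis (mono_tags, lifting) someI_ex)
  qed
  have eq: "f = g" if "C.arr f X Y" "C.arr g X Y" "Fm f = Fm g" for f g X Y
    using that ff(1) unfolding faithful_def by blast
  have Gfun: "is_functor D C Go Gm"
  proof (rule is_functorI)
    fix X assume X: "X \<in> Obj D"
    show "Go X \<in> Obj C" using G X .
    show "Gm (Ident D X) = Ident C (Go X)"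
      by (rule eq[where X = "Go X" and Y = "Go X"])
        (use Gm[of "Ident D X" X X] X in \<open>simp_all add: G e_inv\<close>)
  next
    fix X Y f assume "X \<in> Obj D" "Y \<in> Obj D" "f \<in> Hom D X Y"
    then show "Gm f \<in> Hom C (Go X) (Go Y)" using Gm[of f X Y] D.hom_arr C.arr_hom by blast
  next
    fix X Y Z f g
    assume *: "X \<in> Obj D" "Y \<in> Obj D" "Z \<in> Obj D" "f \<in> Hom D X Y" "g \<in> Hom D Y Z"
    then have fg: "D.arr f X Y" "D.arr g Y Z" using D.hom_arr by blast+
    have gf: "D.arr (Cmp D g f) X Z" using fg by simp_all
    show "Gm (Cmp D g f) = Cmp C (Gm g) (Gm f)"
    proof (rule eq)
      show "C.arr (Gm (Cmp D g f)) (Go X) (Go Z)" using Gm[OF gf] by blast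
      show "C.arr (Cmp C (Gm g) (Gm f)) (Go X) (Go Z)" using Gm[OF fg(1)] Gm[OF fg(2)] by simp_all
      show "Fm (Gm (Cmp D g f)) = Fm (Cmp C (Gm g) (Gm f))"
        using Gm[OF fg(1)] Gm[OF fg(2)] Gm[OF gf] fg
        by (simp_all add: G D.cmp_pre[OF e_inv(2)])
    qed
  qed
  \<comment> \<open>The unit is chosen as a preimage of the inverse counit at \<open>Fo X\<close>,
    so that its image under \<open>Fm\<close> is known.\<close>
  have "\<forall>X. X \<in> Obj C \<longrightarrow> (\<exists>k. C.arr k X (Go (Fo X)) \<and> Fm k = e' (Fo X))"
    using ff(2) e G unfolding full_def by simp
  then obtain n where n: "\<And>X. X \<in> Obj C \<Longrightarrow> C.arr (n X) X (Go (Fo X)) \<and> Fm (n X) = e' (Fo X)"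
    by metis
  have n_typing [simp]: "C.is_arr (n X)" "C.src (n X) = X" "C.tgt (n X) = Go (Fo X)"
    "Fm (n X) = e' (Fo X)" if "X \<in> Obj C" for X using n[OF that] by simp_all
  have nat1: "natural_iso C C id id (Go \<circ> Fo) (Gm \<circ> Fm) n"
    unfolding natural_iso_def comp_def id_def
  proof (intro conjI ballI)
    fix X assume X: "X \<in> Obj C"
    have "is_iso D (Fo X) (Fo (Go (Fo X))) (e' (Fo X))"
      using X e by (intro D.is_isoI[where g = "e (Fo X)"]) auto
    then show "is_iso C X (Go (Fo X)) (n X)" using reflect_iso[OF ff] n[OF X] by metis
  next
    fix X Y f assume *: "X \<in> Obj C" "Y \<in> Obj C" "f \<in> Hom C X Y"
    then have f: "C.arr f X Y" using C.hom_arr by blast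
    note Gf = Gm[OF map_arr[OF f]]
    show "Cmp C (n Y) f = Cmp C (Gm (Fm f)) (n X)"
    proof (rule eq)
      show "C.arr (Cmp C (n Y) f) X (Go (Fo Y))" using f by (simp_all add: G)
      show "C.arr (Cmp C (Gm (Fm f)) (n X)) X (Go (Fo Y))" using f Gf by (simp_all add: G)
      show "Fm (Cmp C (n Y) f) = Fm (Cmp C (Gm (Fm f)) (n X))"
        using f Gf by (simp_all add: G D.cmp_pre[OF e_inv(2)] e_inv)
    qed
  qed
  have nat2: "natural_iso D D (Fo \<circ> Go) (Fm \<circ> Gm) id id e"
    unfolding natural_iso_def comp_def id_def
  proof (intro conjI ballI)
    fix X assume X: "X \<in> Obj D"
    show "is_iso D (Fo (Go X)) X (e X)" using e[OF X] by (intro D.is_isoI[where g = "e' X"]) auto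
  next
    fix X Y f assume *: "X \<in> Obj D" "Y \<in> Obj D" "f \<in> Hom D X Y"
    then have f: "D.arr f X Y" using D.hom_arr by blast
    show "Cmp D (e Y) (Fm (Gm f)) = Cmp D f (e X)"
      using Gm[OF f] f by (simp_all add: G D.cmp_pre[OF e_inv(2)] e_inv)
  qed
  show ?thesis unfolding is_equivalence_def using is_functor Gfun nat1 nat2 by blast
qed

lemma equivalenceD:
  assumes "is_equivalence C D Fo Fm"
  shows faithful full dense
proof -
  obtain Go Gm n e where G: "is_functor D C Go Gm"
    and n: "natural_iso C C id id (Go \<circ> Fo) (Gm \<circ> Fm) n"
    and e: "natural_iso D D (Fo \<circ> Go) (Fm \<circ> Gm) id id e"
    using assms unfolding is_equivalence_def by blast
  interpret G: functor_pair D C Go Gm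
    by unfold_locales (rule G)
  have n_iso: "is_iso C X (Go (Fo X)) (n X)" if "X \<in> Obj C" for X
    using n that unfolding natural_iso_def by simp
  have n_nat: "Cmp C (n Y) f = Cmp C (Gm (Fm f)) (n X)" if "C.arr f X Y" for X Y f
    using n that unfolding natural_iso_def C.arr_def by simp
  have e_iso: "is_iso D (Fo (Go X)) X (e X)" if "X \<in> Obj D" for X
    using e that unfolding natural_iso_def by simp
  have e_nat: "Cmp D (e Y) (Fm (Gm f)) = Cmp D f (e X)" if "D.arr f X Y" for X Y f
    using e that unfolding natural_iso_def D.arr_def by simp
  show faith: faithful
    unfolding faithful_def
  proof (intro allI impI)
    fix X Y f g assume f: "C.arr f X Y" and g: "C.arr g X Y" and eq: "Fm f = Fm g"
    have XY: "X \<in> Obj C" "Y \<in> Obj C" using f by simp_all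
    have "Cmp C (n Y) f = Cmp C (n Y) g" using n_nat[OF f] n_nat[OF g] eq by simp
    then show "f = g" using C.iso_cancel_left[OF n_iso[OF XY(2)]] XY f g by simp
  qed
  \<comment> \<open>Faithfulness of the quasi-inverse follows from naturality of the counit;
    fullness of the functor is deduced from it below.\<close>
  have Gfaith: "f = g" if "D.arr f X Y" "D.arr g X Y" "Gm f = Gm g" for X Y f g
  proof -
    have XY: "X \<in> Obj D" "Y \<in> Obj D" using that(1) by simp_all
    obtain k where k: "D.arr (e X) (Fo (Go X)) X" "D.arr k X (Fo (Go X))" "Cmp D (e X) k = Ident D X"
      using D.is_isoD[OF e_iso[OF XY(1)]] XY obj_map G.obj_map by blast
    have "Cmp D f (e X) = Cmp D g (e X)" using e_nat[OF that(1)] e_nat[OF that(2)] that(3) by simp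
    then have "Cmp D (Cmp D f (e X)) k = Cmp D (Cmp D g (e X)) k" by simp
    then show ?thesis using k that(1,2) by simp_all
  qed
  show full
    unfolding full_def
  proof (intro ballI allI impI)
    fix X Y h assume XY: "X \<in> Obj C" "Y \<in> Obj C" and h: "D.arr h (Fo X) (Fo Y)"
    obtain k where k: "C.arr (n Y) Y (Go (Fo Y))" "C.arr k (Go (Fo Y)) Y" "Cmp C k (n Y) = Ident C Y"
       "Cmp C (n Y) k = Ident C (Go (Fo Y))"
      using C.is_isoD[OF n_iso[OF XY(2)]] XY obj_map G.obj_map by blast
    obtain l where l: "C.arr (n X) X (Go (Fo X))" "C.arr l (Go (Fo X)) X" 
       "Cmp C (n X) l = Ident C (Go (Fo X))"
      using C.is_isoD[OF n_iso[OF XY(1)]] XY obj_map G.obj_map by blast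
    \<comment> \<open>The formula is forced: naturality of the unit demands
      \<open>n Y \<cdot> f = Gm (Fm f) \<cdot> n X\<close>, and \<open>Fm f\<close> should be
      \<open>h\<close>.\<close>
    define f where "f = Cmp C k (Cmp C (Gm h) (n X))"
    have f: "C.arr f X Y" unfolding f_def using k l h by simp_all
    have "Cmp C (n Y) f = Cmp C (Gm h) (n X)"
      unfolding f_def using k l h by (simp_all add: C.cmp_pre[OF k(4)])
    then have "Cmp C (Cmp C (Gm (Fm f)) (n X)) l = Cmp C (Cmp C (Gm h) (n X)) l"
      using n_nat[OF f] by simp
    then have "Gm (Fm f) = Gm h" using l f h by simp_all
    then have "Fm f = h" using Gfaith[OF map_arr[OF f] h] by simp
    then show "\<exists>f. C.arr f X Y \<and> Fm f = h" using f by blast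
  qed
  show dense
    unfolding dense_def using e_iso G.obj_map by blast
qed

end

section \<open>Additive categories\<close>

context additive_category
begin

abbreviation "zero \<equiv> Zero C"
abbreviation "add \<equiv> Plus C"

definition "opp f = neg C (src f) (tgt f) f"
definition "dif f g = add f (opp g)"

lemma neg_eq: "arr f X Y \<Longrightarrow> neg C X Y f = opp f"
  unfolding opp_def by simp

lemma zero_typing [simp]:
  assumes "X \<in> Obj C" "Y \<in> Obj C"
  shows "is_arr (zero X Y)" "src (zero X Y) = X" "tgt (zero X Y) = Y"
proof -
  interpret comm_group "hom_group C X Y" using hom_comm_group assms .
  have "zero X Y \<in> Hom C X Y" using one_closed by (simp add: hom_group_def)
  then have "arr (zero X Y) X Y" using assms hom_arr by blast
  then show "is_arr (zero X Y)" "src (zero X Y) = X" "tgt (zero X Y) = Y" by simp_all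
qed

lemma
  assumes f: "arr f X Y"
  shows opp_arr: "arr (opp f) X Y" and add_opp: "add f (opp f) = zero X Y"
    and add_zero: "add f (zero X Y) = f"
proof -
  have XY: "X \<in> Obj C" "Y \<in> Obj C" using f by simp_all
  interpret comm_group "hom_group C X Y" using hom_comm_group XY .
  have fc: "f \<in> carrier (hom_group C X Y)" using arr_hom[OF f] by (simp add: hom_group_def)
  have "inv\<^bsub>hom_group C X Y\<^esub> f \<in> Hom C X Y" using inv_closed[OF fc] by (simp add: hom_group_def)
  then show "arr (opp f) X Y"
    using hom_arr XY neg_eq[OF f] unfolding neg_def by simp
  show "add f (opp f) = zero X Y"
    using r_inv[OF fc] neg_eq[OF f] unfolding neg_def by (simp add: hom_group_def)
  show "add f (zero X Y) = f" using r_one[OF fc] by (simp add: hom_group_def)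
qed

lemma
  assumes f: "arr f X Y" and g: "arr g X Y"
  shows add_arr: "arr (add f g) X Y" and add_comm: "add f g = add g f"
proof -
  have XY: "X \<in> Obj C" "Y \<in> Obj C" using f by simp_all
  interpret comm_group "hom_group C X Y" using hom_comm_group XY .
  have c: "f \<in> carrier (hom_group C X Y)" "g \<in> carrier (hom_group C X Y)"
    using arr_hom[OF f] arr_hom[OF g] by (simp_all add: hom_group_def)
  have "add f g \<in> Hom C X Y" using m_closed[OF c] by (simp add: hom_group_def)
  then show "arr (add f g) X Y" using hom_arr XY by blast
  show "add f g = add g f" using m_comm[OF c] by (simp add: hom_group_def)
qed

lemma add_assoc:
  assumes f: "arr f X Y" and g: "arr g X Y" and h: "arr h X Y"
  shows "add (add f g) h = add f (add g h)"
proof -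
  have XY: "X \<in> Obj C" "Y \<in> Obj C" using f by simp_all
  interpret comm_group "hom_group C X Y" using hom_comm_group XY .
  have c: "f \<in> carrier (hom_group C X Y)" "g \<in> carrier (hom_group C X Y)"
    "h \<in> carrier (hom_group C X Y)"
    using arr_hom[OF f] arr_hom[OF g] arr_hom[OF h] by (simp_all add: hom_group_def)
  show ?thesis using m_assoc[OF c] by (simp add: hom_group_def)
qed

lemma opp_typing [simp]:
  assumes "is_arr f"
  shows "is_arr (opp f)" "src (opp f) = src f" "tgt (opp f) = tgt f"
  using opp_arr[OF is_arr_arr[OF assms]] by simp_all

lemma add_typing [simp]:
  assumes "is_arr f" "is_arr g" "src f = src g" "tgt f = tgt g"
  shows "is_arr (add f g)" "src (add f g) = src g" "tgt (add f g) = tgt g"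
  using add_arr[of f "src f" "tgt f" g] assms by simp_all

lemma dif_typing [simp]:
  assumes "is_arr f" "is_arr g" "src f = src g" "tgt f = tgt g"
  shows "is_arr (dif f g)" "src (dif f g) = src g" "tgt (dif f g) = tgt g"
  using assms unfolding dif_def by simp_all

lemma add_zero_right [simp]: "is_arr f \<Longrightarrow> src f = X \<Longrightarrow> tgt f = Y \<Longrightarrow> add f (zero X Y) = f"
  using add_zero[of f X Y] by auto

lemma add_zero_left [simp]: "is_arr f \<Longrightarrow> src f = X \<Longrightarrow> tgt f = Y \<Longrightarrow> add (zero X Y) f = f"
  using add_zero[of f X Y] add_comm[of f X Y "zero X Y"] by auto

lemma cmp_add_left [simp]:
  assumes "is_arr f" "is_arr g" "is_arr g'" "tgt f = src g" "src g = src g'" "tgt g = tgt g'"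
  shows "add g g' \<cdot> f = add (g \<cdot> f) (g' \<cdot> f)"
  using cmp_plus_left[of "src f" "tgt f" "tgt g" f g g'] assms
    arr_hom[OF is_arr_arr[of f]] arr_hom[OF is_arr_arr[of g]] arr_hom[OF is_arr_arr[of g']] by simp

lemma cmp_add_right [simp]:
  assumes "is_arr f" "is_arr f'" "is_arr g" "tgt f = src g" "src f = src f'" "tgt f = tgt f'"
  shows "g \<cdot> add f f' = add (g \<cdot> f) (g \<cdot> f')"
  using cmp_plus_right[of "src f" "tgt f" "tgt g" f f' g] assms
    arr_hom[OF is_arr_arr[of f]] arr_hom[OF is_arr_arr[of g]] arr_hom[OF is_arr_arr[of f']] by simp

text \<open>An additive map sends a zero morphism to an additive idempotent; in this way composition
  and the shift are shown to preserve zero.\<close>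

lemma add_idem_zero:
  assumes "arr f X Y" "add f f = f" shows "f = zero X Y"
  using add_assoc[of f X Y f "opp f"] assms add_opp[OF assms(1)] by simp

lemma cmp_zero_right [simp]:
  assumes "is_arr g" "X \<in> Obj C" "src g = Y"
  shows "g \<cdot> zero X Y = zero X (tgt g)"
proof (rule add_idem_zero)
  have Y: "Y \<in> Obj C" using assms by auto
  show "arr (g \<cdot> zero X Y) X (tgt g)" using assms Y by simp_all
  have "g \<cdot> add (zero X Y) (zero X Y) = add (g \<cdot> zero X Y) (g \<cdot> zero X Y)"
    using assms Y by (intro cmp_add_right) auto
  then show "add (g \<cdot> zero X Y) (g \<cdot> zero X Y) = g \<cdot> zero X Y" using assms Y by simp
qed

lemma cmp_zero_left [simp]:
  assumes "is_arr f" "Z \<in> Obj C" "tgt f = Y"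
  shows "zero Y Z \<cdot> f = zero (src f) Z"
proof (rule add_idem_zero)
  have Y: "Y \<in> Obj C" using assms by auto
  show "arr (zero Y Z \<cdot> f) (src f) Z" using assms Y by simp_all
  have "add (zero Y Z) (zero Y Z) \<cdot> f = add (zero Y Z \<cdot> f) (zero Y Z \<cdot> f)"
    using assms Y by (intro cmp_add_left) auto
  then show "add (zero Y Z \<cdot> f) (zero Y Z \<cdot> f) = zero Y Z \<cdot> f" using assms Y by simp
qed

lemma opp_unique:
  assumes "arr f X Y" "arr g X Y" "add f g = zero X Y" shows "g = opp f"
proof -
  have "g = add g (add f (opp f))" using add_opp[OF assms(1)] assms by simp_all
  also have "\<dots> = add (add g f) (opp f)"
    using add_assoc[OF assms(2) assms(1) opp_arr[OF assms(1)]] by simp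
  also have "\<dots> = opp f" using add_comm[OF assms(1,2)] assms add_zero_left[of "opp f" X Y] by (metis arr_iff opp_typing)
  finally show ?thesis .
qed

lemma opp_opp [simp]: "is_arr f \<Longrightarrow> opp (opp f) = f"
  using opp_unique[of "opp f" "src f" "tgt f" f] add_opp[of f "src f" "tgt f"]
    add_comm[of f "src f" "tgt f" "opp f"] by simp_all

lemma opp_zero [simp]: "X \<in> Obj C \<Longrightarrow> Y \<in> Obj C \<Longrightarrow> opp (zero X Y) = zero X Y"
  using opp_unique[of "zero X Y" X Y "zero X Y"] by simp

lemma cmp_opp_left [simp]:
  assumes "is_arr f" "is_arr g" "tgt f = src g"
  shows "opp g \<cdot> f = opp (g \<cdot> f)"
proof (rule opp_unique)
  show "arr (g \<cdot> f) (src f) (tgt g)" "arr (opp g \<cdot> f) (src f) (tgt g)" using assms by simp_all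
  have "add (g \<cdot> f) (opp g \<cdot> f) = add g (opp g) \<cdot> f" using assms by simp_all
  then show "add (g \<cdot> f) (opp g \<cdot> f) = zero (src f) (tgt g)"
    using assms add_opp[of g "src g" "tgt g"] by simp
qed

lemma cmp_opp_right [simp]:
  assumes "is_arr f" "is_arr g" "tgt f = src g"
  shows "g \<cdot> opp f = opp (g \<cdot> f)"
proof (rule opp_unique)
  show "arr (g \<cdot> f) (src f) (tgt g)" "arr (g \<cdot> opp f) (src f) (tgt g)" using assms by simp_all
  have "add (g \<cdot> f) (g \<cdot> opp f) = g \<cdot> add f (opp f)" using assms by simp_all
  then show "add (g \<cdot> f) (g \<cdot> opp f) = zero (src f) (tgt g)"
    using assms add_opp[of f "src f" "tgt f"] by simp
qed

lemma dif_self: "arr f X Y \<Longrightarrow> dif f f = zero X Y"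
  unfolding dif_def by (rule add_opp)

lemma dif_zero_iff:
  assumes "arr f X Y" "arr g X Y" shows "dif f g = zero X Y \<longleftrightarrow> f = g"
proof
  assume "dif f g = zero X Y"
  then have "add (opp g) f = zero X Y"
    unfolding dif_def using add_comm[OF assms(1) opp_arr[OF assms(2)]] by simp
  then show "f = g" using opp_unique[of "opp g" X Y f] assms by simp
qed (use dif_self assms in simp)

lemma add_dif_cancel:
  assumes "arr f X Y" "arr g X Y" shows "add f (dif g f) = g"
proof -
  have "add f (dif g f) = add f (add (opp f) g)"
    unfolding dif_def using add_comm[OF assms(2) opp_arr[OF assms(1)]] by simp
  also have "\<dots> = add (add f (opp f)) g"
    using add_assoc[OF assms(1) opp_arr[OF assms(1)] assms(2)] by simp
  finally show ?thesis using add_opp[OF assms(1)] assms by simp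
qed

lemma dif_add_cancel:
  assumes "arr f X Y" "arr g X Y" shows "dif (add f g) g = f"
  unfolding dif_def using add_assoc[OF assms opp_arr[OF assms(2)]] add_opp[OF assms(2)] assms
  by simp_all

lemma cmp_dif_left:
  assumes "is_arr f" "is_arr g" "is_arr g'" "tgt f = src g" "src g = src g'" "tgt g = tgt g'"
  shows "dif g g' \<cdot> f = dif (g \<cdot> f) (g' \<cdot> f)"
  unfolding dif_def using assms by simp

lemma cmp_dif_right:
  assumes "is_arr f" "is_arr f'" "is_arr g" "tgt f = src g" "src f = src f'" "tgt f = tgt f'"
  shows "g \<cdot> dif f f' = dif (g \<cdot> f) (g \<cdot> f')"
  unfolding dif_def using assms by simp

lemma
  assumes "zero_object C N"
  shows zero_object_obj: "N \<in> Obj C"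
    and arr_to_zero_object: "arr f X N \<Longrightarrow> f = zero X N"
proof -
  show N: "N \<in> Obj C" using assms unfolding zero_object_def by blast
  have *: "\<And>X. X \<in> Obj C \<Longrightarrow> (\<exists>!f. f \<in> Hom C X N) \<and> (\<exists>!f. f \<in> Hom C N X)"
    using assms unfolding zero_object_def by blast
  have "arr (zero X N) X N" if "X \<in> Obj C" for X using that N by simp
  then have z: "zero X N \<in> Hom C X N" if "X \<in> Obj C" for X
    using that arr_hom by blast
  show "arr f X N \<Longrightarrow> f = zero X N"
    using *[of X] z[of X] unfolding arr_def by blast
qed

lemma zero_objectI:
  assumes N: "N \<in> Obj C" and 0: "Ident C N = zero N N"
  shows "zero_object C N"
  unfolding zero_object_def
proof (intro conjI ballI N)
  fix X assume X: "X \<in> Obj C"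
  show "\<exists>!f. f \<in> Hom C X N"
  proof (rule ex1I)
    show "zero X N \<in> Hom C X N" using X N by (intro arr_hom) simp
    fix f assume "f \<in> Hom C X N"
    then have f: "arr f X N" using hom_arr X N by simp
    then have "f = Ident C N \<cdot> f" by simp
    then show "f = zero X N" using f 0 by simp_all
  qed
  show "\<exists>!f. f \<in> Hom C N X"
  proof (rule ex1I)
    show "zero N X \<in> Hom C N X" using X N by (intro arr_hom) simp
    fix f assume "f \<in> Hom C N X"
    then have f: "arr f N X" using hom_arr X N by simp
    then have "f = f \<cdot> Ident C N" by simp
    then show "f = zero N X" using f 0 by simp_all
  qed
qed

lemma biproduct_arr:
  assumes "biproduct C A B D i j p q" "A \<in> Obj C" "B \<in> Obj C"
  shows "arr i A D" "arr j B D" "arr p D A" "arr q D B" "p \<cdot> i = Ident C A" "q \<cdot> j = Ident C B"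
    "q \<cdot> i = zero A B" "p \<cdot> j = zero B A" "add (i \<cdot> p) (j \<cdot> q) = Ident C D"
  using assms hom_arr unfolding biproduct_def by blast+

end

section \<open>Triangulated categories\<close>

context triangulated_category
begin

abbreviation "Sh \<equiv> Shift C"
abbreviation "Sm \<equiv> ShiftM C"

sublocale shift: functor_pair C C "Shift C" "ShiftM C"
  using shift_equivalence category_axioms
  unfolding additive_equivalence_def is_equivalence_def functor_pair_def functor_pair_axioms_def
  by blast

lemma shift_inj: "\<lbrakk>arr f X Y; arr g X Y; Sm f = Sm g\<rbrakk> \<Longrightarrow> f = g"
  and shift_full: "\<lbrakk>X \<in> Obj C; Y \<in> Obj C; arr h (Sh X) (Sh Y)\<rbrakk> \<Longrightarrow> \<exists>f. arr f X Y \<and> Sm f = h"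
  and shift_dense: "Z \<in> Obj C \<Longrightarrow> \<exists>X\<in>Obj C. \<exists>h. is_iso C (Sh X) Z h"
proof -
  have "is_equivalence C C Sh Sm" using shift_equivalence unfolding additive_equivalence_def by blast
  note eq = shift.equivalenceD[OF this]
  show "\<lbrakk>arr f X Y; arr g X Y; Sm f = Sm g\<rbrakk> \<Longrightarrow> f = g"
    using eq(1) unfolding shift.faithful_def by blast
  show "\<lbrakk>X \<in> Obj C; Y \<in> Obj C; arr h (Sh X) (Sh Y)\<rbrakk> \<Longrightarrow> \<exists>f. arr f X Y \<and> Sm f = h"
    using eq(2) unfolding shift.full_def by blast
  show "Z \<in> Obj C \<Longrightarrow> \<exists>X\<in>Obj C. \<exists>h. is_iso C (Sh X) Z h"
    using eq(3) unfolding shift.dense_def by blast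
qed

lemma shift_add [simp]:
  assumes "is_arr f" "is_arr g" "src f = src g" "tgt f = tgt g"
  shows "Sm (add f g) = add (Sm f) (Sm g)"
  using assms shift_equivalence is_arr_arr[of f] is_arr_arr[of g]
  unfolding additive_equivalence_def arr_def by metis

lemma shift_zero [simp]:
  assumes "X \<in> Obj C" "Y \<in> Obj C"
  shows "Sm (zero X Y) = zero (Sh X) (Sh Y)"
proof (rule add_idem_zero)
  show "arr (Sm (zero X Y)) (Sh X) (Sh Y)" using assms by simp
  have "Sm (add (zero X Y) (zero X Y)) = add (Sm (zero X Y)) (Sm (zero X Y))"
    using assms by (intro shift_add) simp_all
  then show "add (Sm (zero X Y)) (Sm (zero X Y)) = Sm (zero X Y)" using assms by simp
qed

lemma shift_opp [simp]:
  assumes "is_arr f" shows "Sm (opp f) = opp (Sm f)"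
proof (rule opp_unique)
  show "arr (Sm f) (Sh (src f)) (Sh (tgt f))" "arr (Sm (opp f)) (Sh (src f)) (Sh (tgt f))"
    using assms by simp_all
  have "add (Sm f) (Sm (opp f)) = Sm (add f (opp f))" using assms by simp
  then show "add (Sm f) (Sm (opp f)) = zero (Sh (src f)) (Sh (tgt f))"
    using assms add_opp[of f "src f" "tgt f"] by simp
qed

lemma shift_reflects_zero: "\<lbrakk>arr f X Y; Sm f = zero (Sh X) (Sh Y)\<rbrakk> \<Longrightarrow> f = zero X Y"
  using shift_inj[of f X Y "zero X Y"] by simp

lemma tri_arr:
  assumes "(X, Y, Z, f, g, h) \<in> Tri C"
  shows "arr f X Y" "arr g Y Z" "arr h Z (Sh X)"
  using assms tri_diagrams unfolding diagrams_def arr_def by fastforce+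

lemma diagrams_iff:
  "(X, Y, Z, f, g, h) \<in> diagrams C \<longleftrightarrow> arr f X Y \<and> arr g Y Z \<and> arr h Z (Sh X)"
  unfolding diagrams_def arr_def using shift.obj_map by auto

lemma tri_rotated:
  assumes "(X, Y, Z, f, g, h) \<in> Tri C" shows "(Y, Z, Sh X, g, h, opp (Sm f)) \<in> Tri C"
proof -
  have "(X, Y, Z, f, g, h) \<in> diagrams C" using assms tri_diagrams by blast
  from tri_rotate[OF this] assms show ?thesis
    using neg_eq[OF shift.map_arr[OF tri_arr(1)[OF assms]]] by metis
qed

lemma tri_unrotated:
  assumes "arr f X Y" "arr g Y Z" "arr h Z (Sh X)" "(Y, Z, Sh X, g, h, opp (Sm f)) \<in> Tri C"
  shows "(X, Y, Z, f, g, h) \<in> Tri C"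
  using assms tri_rotate[of X Y Z f g h] diagrams_iff neg_eq[OF shift.map_arr[OF assms(1)]] by simp

lemma tri_homI:
  assumes "arr a X X'" "arr b Y Y'" "arr c Z Z'"
    "b \<cdot> f = f' \<cdot> a" "c \<cdot> g = g' \<cdot> b" "Sm a \<cdot> h = h' \<cdot> c"
  shows "tri_hom C (X, Y, Z, f, g, h) (X', Y', Z', f', g', h') a b c"
  using assms unfolding tri_hom.simps arr_def by blast

lemma tri_transfer:
  assumes "(X, Y, Z, f, g, h) \<in> Tri C" "arr f' X' Y'" "arr g' Y' Z'" "arr h' Z' (Sh X')"
    and iso: "is_iso C X X' a" "is_iso C Y Y' b" "is_iso C Z Z' c"
    and "b \<cdot> f = f' \<cdot> a" "c \<cdot> g = g' \<cdot> b" "Sm a \<cdot> h = h' \<cdot> c"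
  shows "(X', Y', Z', f', g', h') \<in> Tri C"
proof (rule tri_iso_closed[OF assms(1)])
  show "(X', Y', Z', f', g', h') \<in> diagrams C" using assms diagrams_iff by simp
  have "a \<in> Hom C X X'" "b \<in> Hom C Y Y'" "c \<in> Hom C Z Z'"
    using iso unfolding is_iso_def by blast+
  then show "tri_iso C (X, Y, Z, f, g, h) (X', Y', Z', f', g', h')"
    unfolding tri_iso.simps tri_hom.simps using assms by blast
qed

lemma opp_ident_iso: "X \<in> Obj C \<Longrightarrow> is_iso C X X (opp (Ident C X))"
  by (rule is_isoI[where g = "opp (Ident C X)"]) simp_all

text \<open>The isomorphism (1, -1, 1) of diagrams changes two signs at once.\<close>

lemma tri_opp12:
  assumes "(X, Y, Z, f, g, h) \<in> Tri C"
  shows "(X, Y, Z, opp f, opp g, h) \<in> Tri C"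
proof -
  note a = tri_arr[OF assms]
  then have o: "X \<in> Obj C" "Y \<in> Obj C" "Z \<in> Obj C" by simp_all
  show ?thesis
    by (rule tri_transfer[OF assms _ _ _ iso_ident opp_ident_iso iso_ident])
      (use a o in simp_all)
qed

text \<open>Three rotations shift every term and negate all three maps; \<open>tri_opp12\<close>
  removes two of the signs.\<close>

lemma tri_shift:
  assumes t: "(X, Y, Z, f, g, h) \<in> Tri C"
  shows "(Sh X, Sh Y, Sh Z, Sm f, Sm g, opp (Sm h)) \<in> Tri C"
proof -
  have "(Sh X, Sh Y, Sh Z, opp (Sm f), opp (Sm g), opp (Sm h)) \<in> Tri C"
    using tri_rotated[OF tri_rotated[OF tri_rotated[OF t]]] .
  from tri_opp12[OF this] show ?thesis using tri_arr[OF t] by simp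
qed

lemma tri_complete_arr:
  assumes "(X, Y, Z, f, g, h) \<in> Tri C" "(X', Y', Z', f', g', h') \<in> Tri C"
    "arr a X X'" "arr b Y Y'" "b \<cdot> f = f' \<cdot> a"
  shows "\<exists>c. arr c Z Z' \<and> c \<cdot> g = g' \<cdot> b \<and> Sm a \<cdot> h = h' \<cdot> c"
proof -
  obtain c where c: "tri_hom C (X, Y, Z, f, g, h) (X', Y', Z', f', g', h') a b c"
    using tri_complete assms arr_hom by blast
  have "Z \<in> Obj C" "Z' \<in> Obj C"
    using arr_objs[OF tri_arr(2)[OF assms(1)]] arr_objs[OF tri_arr(2)[OF assms(2)]] by blast+
  then show ?thesis using c hom_arr unfolding tri_hom.simps by blast
qed

lemma zero_object_shift:
  assumes "zero_object C N" shows "zero_object C (Sh N)"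
proof (rule zero_objectI)
  have N: "N \<in> Obj C" using zero_object_obj assms by blast
  then show "Sh N \<in> Obj C" by simp
  have "Ident C N = zero N N" using arr_to_zero_object[OF assms, of "Ident C N" N] N by simp
  then have "Sm (Ident C N) = Sm (zero N N)" by simp
  then show "Ident C (Sh N) = zero (Sh N) (Sh N)" using N by simp
qed

section \<open>Vanishing composites and exact Hom sequences of a triangle\<close>

lemma tri_comp_zero1:
  assumes t: "(X, Y, Z, f, g, h) \<in> Tri C"
  shows "g \<cdot> f = zero X Z"
proof -
  note a = tri_arr[OF t]
  then have o: "X \<in> Obj C" "Y \<in> Obj C" "Z \<in> Obj C" by simp_all
  obtain N where N: "zero_object C N" using ex_zero_object by blast
  have No: "N \<in> Obj C" using zero_object_obj N by blast
  have "(X, X, N, Ident C X, zero X N, zero N (Sh X)) \<in> Tri C" using tri_ident o N by blast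
  from tri_complete_arr[OF this t ident_arr[OF o(1)] a(1)]
  obtain c where "arr c N Z" "c \<cdot> zero X N = g \<cdot> f" by blast
  then show ?thesis using o by simp
qed

lemma tri_comp_zero2:
  assumes t: "(X, Y, Z, f, g, h) \<in> Tri C"
  shows "h \<cdot> g = zero Y (Sh X)"
  using tri_comp_zero1[OF tri_rotated[OF t]] .

lemma tri_comp_zero3:
  assumes t: "(X, Y, Z, f, g, h) \<in> Tri C"
  shows "Sm f \<cdot> h = zero Z (Sh Y)"
proof -
  note a = tri_arr[OF t]
  have "opp (Sm f) \<cdot> h = zero Z (Sh Y)"
    using tri_comp_zero2[OF tri_rotated[OF t]] .
  then have "opp (Sm f \<cdot> h) = zero Z (Sh Y)" using a by simp
  then have "opp (opp (Sm f \<cdot> h)) = opp (zero Z (Sh Y))" by (rule arg_cong)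
  moreover have "opp (zero Z (Sh Y)) = zero Z (Sh Y)" "opp (opp (Sm f \<cdot> h)) = Sm f \<cdot> h"
    using a by simp_all
  ultimately show ?thesis by metis
qed

text \<open>Compare the rotated trivial triangle W -> 0 -> W[1] with the rotated given one, along
  \<open>k\<close> and zero. The fill-in W[1] -> X[1] is, by fullness of the shift, the shift of the
  desired factorisation.\<close>

lemma exact_mid:
  assumes t: "(X, Y, Z, f, g, h) \<in> Tri C" and k: "arr k W Y" "g \<cdot> k = zero W Z"
  shows "\<exists>l. arr l W X \<and> k = f \<cdot> l"
proof -
  note a = tri_arr[OF t]
  have o: "X \<in> Obj C" "Y \<in> Obj C" "Z \<in> Obj C" "W \<in> Obj C" using a k by simp_all
  obtain N where N: "zero_object C N" using ex_zero_object by blast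
  have No: "N \<in> Obj C" using zero_object_obj N by blast
  have "(W, W, N, Ident C W, zero W N, zero N (Sh W)) \<in> Tri C" using tri_ident o N by blast
  from tri_rotated[OF this]
  have t': "(W, N, Sh W, zero W N, zero N (Sh W), opp (Ident C (Sh W))) \<in> Tri C"
    using o by simp
  have "arr (zero N Z) N Z" "zero N Z \<cdot> zero W N = g \<cdot> k" using k o No by simp_all
  from tri_complete_arr[OF t' tri_rotated[OF t] k(1) this]
  obtain c where c: "arr c (Sh W) (Sh X)" "Sm k \<cdot> opp (Ident C (Sh W)) = opp (Sm f) \<cdot> c" by blast
  obtain l where l: "arr l W X" "Sm l = c" using shift_full c(1) o by blast
  have "opp (Sm k) = opp (Sm (f \<cdot> l))" using c l k a by simp
  then have "opp (opp (Sm k)) = opp (opp (Sm (f \<cdot> l)))" by simp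
  then have "Sm k = Sm (f \<cdot> l)" using c(1) k l a by simp
  then have "k = f \<cdot> l" using shift_inj[of k W Y "f \<cdot> l"] k l a by simp
  then show ?thesis using l by blast
qed

text \<open>Dual to \<open>exact_mid\<close>: the given triangle is mapped to the trivial triangle 0
  -> W -> W, whose fill-in is already the factorisation.\<close>

lemma coexact_mid:
  assumes t: "(X, Y, Z, f, g, h) \<in> Tri C" and k: "arr k Y W" "k \<cdot> f = zero X W"
  shows "\<exists>l. arr l Z W \<and> k = l \<cdot> g"
proof -
  note a = tri_arr[OF t]
  have o: "X \<in> Obj C" "Y \<in> Obj C" "Z \<in> Obj C" "W \<in> Obj C" using a k by simp_all
  obtain N where N: "zero_object C N" using ex_zero_object by blast
  have No: "N \<in> Obj C" using zero_object_obj N by blast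
  have "(W, W, Sh N, Ident C W, zero W (Sh N), zero (Sh N) (Sh W)) \<in> Tri C"
    using tri_ident o zero_object_shift[OF N] by blast
  then have t': "(N, W, W, zero N W, Ident C W, zero W (Sh N)) \<in> Tri C"
    using o No by (rule_tac tri_unrotated) simp_all
  have "arr (zero X N) X N" "k \<cdot> f = zero N W \<cdot> zero X N" using k o No by simp_all
  from tri_complete_arr[OF t t' this(1) k(1) this(2)]
  obtain c where "arr c Z W" "c \<cdot> g = Ident C W \<cdot> k" by blast
  then show ?thesis using k by (intro exI[of _ c]) simp
qed

lemma exact_right:
  assumes t: "(X, Y, Z, f, g, h) \<in> Tri C" and k: "arr k W Z" "h \<cdot> k = zero W (Sh X)"
  shows "\<exists>l. arr l W Y \<and> k = g \<cdot> l"
  using exact_mid[OF tri_rotated[OF t] k] .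

lemma coexact_right:
  assumes t: "(X, Y, Z, f, g, h) \<in> Tri C" and k: "arr k Z W" "k \<cdot> g = zero Y W"
  shows "\<exists>l. arr l (Sh X) W \<and> k = l \<cdot> h"
  using coexact_mid[OF tri_rotated[OF t] k] .

lemma exact_shift:
  assumes t: "(X, Y, Z, f, g, h) \<in> Tri C" and k: "arr k W (Sh X)" "Sm f \<cdot> k = zero W (Sh Y)"
  shows "\<exists>l. arr l W Z \<and> k = h \<cdot> l"
proof -
  have "opp (Sm f) \<cdot> k = zero W (Sh Y)" using k tri_arr[OF t] by simp
  then show ?thesis using exact_right[OF tri_rotated[OF t] k(1)] by simp
qed

lemma coexact_shift:
  assumes t: "(X, Y, Z, f, g, h) \<in> Tri C" and k: "arr k (Sh X) W" "k \<cdot> h = zero Z W"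
  shows "\<exists>l. arr l (Sh Y) W \<and> k = l \<cdot> Sm f"
proof -
  obtain l where l: "arr l (Sh Y) W" "k = l \<cdot> opp (Sm f)"
    using coexact_right[OF tri_rotated[OF t] k] by blast
  then show ?thesis using tri_arr[OF t] by (intro exI[of _ "opp l"]) simp
qed

lemma exact_shift_mid:
  assumes t: "(X, Y, Z, f, g, h) \<in> Tri C" and k: "arr k W (Sh Y)" "Sm g \<cdot> k = zero W (Sh Z)"
  shows "\<exists>l. arr l W (Sh X) \<and> k = Sm f \<cdot> l"
  using exact_mid[OF tri_shift[OF t] k] .

text \<open>The shifted morphism factors by exactness further to the right; fullness and
  faithfulness of the shift bring the factorisation back.\<close>

lemma coexact_left:
  assumes t: "(X, Y, Z, f, g, h) \<in> Tri C" and k: "arr k X W" "Sm k \<cdot> h = zero Z (Sh W)"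
  shows "\<exists>l. arr l Y W \<and> k = l \<cdot> f"
proof -
  note a = tri_arr[OF t]
  obtain m where m: "arr m (Sh Y) (Sh W)" "Sm k = m \<cdot> Sm f"
    using coexact_shift[OF t shift.map_arr[OF k(1)] k(2)] by blast
  obtain l where l: "arr l Y W" "Sm l = m"
    using shift_full[OF _ _ m(1)] arr_objs[OF a(1)] arr_objs[OF k(1)] by blast
  have "Sm k = Sm (l \<cdot> f)" using l m a by simp
  then have "k = l \<cdot> f" using shift_inj[of k X W] k l a by simp
  then show ?thesis using l by blast
qed

text \<open>The rotated diagrams are completed, and the fill-in X[1] -> X'[1] is
  desuspended.\<close>

lemma tri_complete_left:
  assumes t: "(X, Y, Z, f, g, h) \<in> Tri C" and t': "(X', Y', Z', f', g', h') \<in> Tri C"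
    and b: "arr b Y Y'" and c: "arr c Z Z'" and eq: "c \<cdot> g = g' \<cdot> b"
  shows "\<exists>a. arr a X X' \<and> b \<cdot> f = f' \<cdot> a \<and> Sm a \<cdot> h = h' \<cdot> c"
proof -
  note a = tri_arr[OF t] note a' = tri_arr[OF t']
  obtain d where d: "arr d (Sh X) (Sh X')" "d \<cdot> h = h' \<cdot> c" "Sm b \<cdot> opp (Sm f) = opp (Sm f') \<cdot> d"
    using tri_complete_arr[OF tri_rotated[OF t] tri_rotated[OF t'] b c eq] by blast
  obtain e where e: "arr e X X'" "Sm e = d" 
    using shift_full[OF _ _ d(1)] arr_objs[OF a(1)] arr_objs[OF a'(1)] by blast
  have "opp (Sm (b \<cdot> f)) = opp (Sm (f' \<cdot> e))" using d(1,3) e a a' b by simp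
  then have "opp (opp (Sm (b \<cdot> f))) = opp (opp (Sm (f' \<cdot> e)))" by simp
  then have "Sm (b \<cdot> f) = Sm (f' \<cdot> e)" using d(1) e a a' b by simp
  then have "b \<cdot> f = f' \<cdot> e" using shift_inj[of "b \<cdot> f" X Y' "f' \<cdot> e"] e a a' b by simp
  then show ?thesis using e d by blast
qed

text \<open>Rotating backwards requires the third term to be a shift on the nose. It is one only up
  to isomorphism, so the triangle is first transported along an isomorphism \<open>Sh W\<close> ->
  Z.\<close>

lemma fibre:
  assumes t: "(X, Y, Z, f, g, h) \<in> Tri C"
  shows "\<exists>W \<theta> u v. W \<in> Obj C \<and> is_iso C (Sh W) Z \<theta> \<and> (W, X, Y, u, f, v) \<in> Tri C"
proof -
  note a = tri_arr[OF t]
  then have o: "X \<in> Obj C" "Y \<in> Obj C" "Z \<in> Obj C" by simp_all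
  obtain W e where W: "W \<in> Obj C" and e: "is_iso C (Sh W) Z e" using shift_dense o by blast
  obtain d where d: "arr e (Sh W) Z" "arr d Z (Sh W)" "d \<cdot> e = Ident C (Sh W)" "e \<cdot> d = Ident C Z"
    using is_isoD[OF e] W o shift.obj_map by blast
  then have iso: "is_iso C Z (Sh W) d" by (intro is_isoI[where g = e])
  \<comment> \<open>The sign in \<open>u\<close> cancels the one that the rotation axiom puts on the
    shifted first map.\<close>
  obtain u where u: "arr u W X" "Sm u = opp (h \<cdot> e)" 
    using shift_full[OF W o(1), of "opp (h \<cdot> e)"] W o a d by fastforce
  have "(X, Y, Sh W, f, d \<cdot> g, h \<cdot> e) \<in> Tri C"
    by (rule tri_transfer[OF t _ _ _ iso_ident iso_ident iso])
      (use a d o in \<open>simp_all add: cmp_pre[OF d(3)]\<close>)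
  then have "(W, X, Y, u, f, d \<cdot> g) \<in> Tri C"
    using u a d by (rule_tac tri_unrotated) simp_all
  then show ?thesis using W e by blast
qed

lemma iso_tri:
  assumes s: "is_iso C X Y s" "X \<in> Obj C" "Y \<in> Obj C" and N: "zero_object C N"
  shows "(X, Y, N, s, zero Y N, zero N (Sh X)) \<in> Tri C"
proof -
  have No: "N \<in> Obj C" using zero_object_obj N by blast
  have sa: "arr s X Y" using is_isoD s by blast
  show ?thesis
    by (rule tri_transfer[OF tri_ident[OF s(2) N] _ _ _ iso_ident s(1) iso_ident])
      (use sa No s in simp_all)
qed

lemma octahedral:
  assumes "(X, Y, Z', u, j, k) \<in> Tri C" "(Y, Z, X', v, l, i) \<in> Tri C"
    "(X, Z, Y', v \<cdot> u, m, n) \<in> Tri C"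
  shows "\<exists>f g. (Z', Y', X', f, g, Sm j \<cdot> i) \<in> Tri C \<and> arr f Z' Y' \<and> arr g Y' X' \<and>
     f \<cdot> j = m \<cdot> v \<and> n \<cdot> f = k \<and> g \<cdot> m = l \<and> i \<cdot> g = Sm u \<cdot> n"
  using tri_octahedral[OF assms] tri_arr by metis

end

section \<open>Thick subcategories and denominators\<close>

locale thick_subcategory = triangulated_category C
  for C :: "('o, 'm, 'x) tcat_scheme" (structure) +
  fixes S :: "'o set"
  assumes thick: "thick C S"
begin

abbreviation "den \<equiv> denoms C S"

lemma S_obj: "E \<in> S \<Longrightarrow> E \<in> Obj C"
  using thick unfolding thick_def by blast

lemma S_shift: "A \<in> Obj C \<Longrightarrow> Sh A \<in> S \<longleftrightarrow> A \<in> S"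
  using thick unfolding thick_def by blast

lemma S_third: "\<lbrakk>(A, B, E, f, g, h) \<in> Tri C; A \<in> S; B \<in> S\<rbrakk> \<Longrightarrow> E \<in> S"
  using thick unfolding thick_def by blast

lemma S_first: "\<lbrakk>(A, B, E, f, g, h) \<in> Tri C; B \<in> S; E \<in> S\<rbrakk> \<Longrightarrow> A \<in> S"
  using S_third[OF tri_rotated] S_shift arr_objs[OF tri_arr(1)] by metis

lemma S_mid: "\<lbrakk>(A, B, E, f, g, h) \<in> Tri C; A \<in> S; E \<in> S\<rbrakk> \<Longrightarrow> B \<in> S"
  using S_first[OF tri_rotated] S_shift arr_objs[OF tri_arr(1)] by metis

lemma S_zero: "zero_object C N \<Longrightarrow> N \<in> S"
proof -
  assume N: "zero_object C N"
  obtain D where "D \<in> S" using thick unfolding thick_def by blast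
  then show "N \<in> S" using tri_ident[OF S_obj N] S_third by blast
qed

lemma S_iso:
  assumes "is_iso C A B s" "A \<in> Obj C" "B \<in> Obj C"
  shows "A \<in> S \<longleftrightarrow> B \<in> S"
proof -
  obtain N where N: "zero_object C N" using ex_zero_object by blast
  show ?thesis using S_mid S_first S_zero[OF N] iso_tri[OF assms N] by blast
qed

section \<open>Denominators: two-out-of-three, the Ore condition and cancellation\<close>

lemma den_arr: "s \<in> den A X \<Longrightarrow> arr s A X"
  unfolding denoms_def using tri_arr by blast

lemma denI: "\<lbrakk>(A, X, E, s, g, h) \<in> Tri C; E \<in> S\<rbrakk> \<Longrightarrow> s \<in> den A X"
  unfolding denoms_def using tri_arr(1) arr_hom by blast

lemma denD: "s \<in> den A X \<Longrightarrow> \<exists>E g h. E \<in> S \<and> (A, X, E, s, g, h) \<in> Tri C"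
  unfolding denoms_def by blast

lemma ex_cone: "arr f X Y \<Longrightarrow> \<exists>Z g h. (X, Y, Z, f, g, h) \<in> Tri C"
  using tri_cone unfolding arr_def by blast

lemma den_iso: "\<lbrakk>is_iso C A X s; A \<in> Obj C; X \<in> Obj C\<rbrakk> \<Longrightarrow> s \<in> den A X"
  using denI iso_tri S_zero ex_zero_object by metis

lemma den_ident: "X \<in> Obj C \<Longrightarrow> Ident C X \<in> den X X"
  using den_iso iso_ident by blast

text \<open>The octahedral axiom puts the cones of \<open>s\<close>, \<open>t\<close> and
  \<open>t \<cdot> s\<close> into one triangle, and \<open>S\<close> contains all three terms as
  soon as it contains two.\<close>

lemma
  assumes "arr s A B" "arr t B X"
  shows den_cmp_imp: "\<lbrakk>s \<in> den A B; t \<in> den B X\<rbrakk> \<Longrightarrow> t \<cdot> s \<in> den A X"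
    and den_right: "\<lbrakk>t \<cdot> s \<in> den A X; t \<in> den B X\<rbrakk> \<Longrightarrow> s \<in> den A B"
    and den_left: "\<lbrakk>t \<cdot> s \<in> den A X; s \<in> den A B\<rbrakk> \<Longrightarrow> t \<in> den B X"
proof -
  have oct: "\<exists>f g h. (Z', Y', X', f, g, h) \<in> Tri C"
    if "(A, B, Z', s, j, k) \<in> Tri C" "(B, X, X', t, l, i) \<in> Tri C" "(A, X, Y', t \<cdot> s, m, n) \<in> Tri C"
    for Z' Y' X' j k l i m n
    using octahedral[OF that] by blast
  have ts: "arr (t \<cdot> s) A X" using assms by simp
  show "\<lbrakk>s \<in> den A B; t \<in> den B X\<rbrakk> \<Longrightarrow> t \<cdot> s \<in> den A X"
    using denD[of s A B] denD[of t B X] ex_cone[OF ts] oct S_mid denI by metis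
  show "\<lbrakk>t \<cdot> s \<in> den A X; t \<in> den B X\<rbrakk> \<Longrightarrow> s \<in> den A B"
    using denD[of "t \<cdot> s" A X] denD[of t B X] ex_cone[OF assms(1)] oct S_first denI by metis
  show "\<lbrakk>t \<cdot> s \<in> den A X; s \<in> den A B\<rbrakk> \<Longrightarrow> t \<in> den B X"
    using denD[of "t \<cdot> s" A X] denD[of s A B] ex_cone[OF assms(2)] oct S_third denI by metis
qed

lemma den_cmp: "\<lbrakk>s \<in> den A B; t \<in> den B X\<rbrakk> \<Longrightarrow> t \<cdot> s \<in> den A X"
  using den_cmp_imp den_arr by blast

lemma den_shift: "s \<in> den A X \<Longrightarrow> Sm s \<in> den (Sh A) (Sh X)"
  using denD[of s A X] tri_shift denI S_shift S_obj by meson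

text \<open>With E the cone of \<open>t\<close>, the fibre of A -> Y -> E has a map to A whose cone
  is again E, and the comparison with the triangle of \<open>t\<close> gives its map to B.\<close>

lemma ore:
  assumes f: "arr f A Y" and t: "t \<in> den B Y"
  shows "\<exists>D t' f'. t' \<in> den D A \<and> arr f' D B \<and> f \<cdot> t' = t \<cdot> f'"
proof -
  obtain E g h where E: "E \<in> S" "(B, Y, E, t, g, h) \<in> Tri C" using denD[OF t] by blast
  note a = tri_arr[OF E(2)]
  obtain Z p q where "(A, E, Z, g \<cdot> f, p, q) \<in> Tri C" using ex_cone[of "g \<cdot> f" A E] a f by auto
  then obtain D t' v where D: "(D, A, E, t', g \<cdot> f, v) \<in> Tri C" using fibre by blast
  have "Ident C E \<cdot> (g \<cdot> f) = g \<cdot> f" using a f by simp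
  from tri_complete_left[OF D E(2) f ident_arr[OF S_obj[OF E(1)]] this]
  obtain f' where "arr f' D B" "f \<cdot> t' = t \<cdot> f'" by blast
  then show ?thesis using denI[OF D E(1)] by blast
qed

text \<open>The denominator is the fibre of \<open>k\<close>; its cone is the target E.\<close>

lemma factor_den_kill:
  assumes k: "arr k A E" "E \<in> S"
  shows "\<exists>D w. w \<in> den D A \<and> k \<cdot> w = zero D E"
proof -
  obtain Z p q where "(A, E, Z, k, p, q) \<in> Tri C" using ex_cone[OF k(1)] by blast
  then obtain D w v where D: "(D, A, E, w, k, v) \<in> Tri C" using fibre by blast
  then show ?thesis using denI[OF D k(2)] tri_comp_zero1[OF D] by blast
qed

text \<open>The difference of \<open>a\<close> and \<open>b\<close> is killed by \<open>t\<close>,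
  hence factors through the fibre of \<open>t\<close>. That fibre lies in \<open>S\<close>, so a
  denominator annihilates the difference.\<close>

lemma cancel:
  assumes a: "arr a E B" "arr b E B" and t: "t \<in> den B X" and eq: "t \<cdot> a = t \<cdot> b"
  shows "\<exists>D w. w \<in> den D E \<and> a \<cdot> w = b \<cdot> w"
proof -
  note ta = den_arr[OF t]
  obtain Q g h where Q: "Q \<in> S" "(B, X, Q, t, g, h) \<in> Tri C" using denD[OF t] by blast
  obtain W e u v where W: "W \<in> Obj C" "is_iso C (Sh W) Q e" "(W, B, X, u, t, v) \<in> Tri C"
    using fibre[OF Q(2)] by blast
  have WS: "W \<in> S" using S_iso[OF W(2)] Q(1) S_obj[OF Q(1)] S_shift[OF W(1)] W(1) by simp
  have d: "arr (dif a b) E B" using a by simp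
  have "t \<cdot> dif a b = zero E X" using cmp_dif_right[of a b t] a ta eq dif_self[of "t \<cdot> b" E X] by simp
  then obtain l where l: "arr l E W" "dif a b = u \<cdot> l" using exact_mid[OF W(3) d] by blast
  obtain D w where w: "w \<in> den D E" "l \<cdot> w = zero D W" using factor_den_kill[OF l(1) WS] by blast
  note wa = den_arr[OF w(1)]
  have "dif (a \<cdot> w) (b \<cdot> w) = (u \<cdot> l) \<cdot> w" using cmp_dif_left[of w a b] a wa l by simp
  also have "\<dots> = zero D B" using w wa l tri_arr[OF W(3)] by simp
  finally have "a \<cdot> w = b \<cdot> w" using dif_zero_iff[of "a \<cdot> w" D B "b \<cdot> w"] a wa by simp
  then show ?thesis using w by blast
qed

text \<open>In the Ore square the remaining side is a denominator by two-out-of-three.\<close>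

lemma den_common:
  assumes "s \<in> den A X" "t \<in> den B X"
  shows "\<exists>D p q. p \<in> den D A \<and> q \<in> den D B \<and> s \<cdot> p = t \<cdot> q"
proof -
  obtain D p q where D: "p \<in> den D A" "arr q D B" "s \<cdot> p = t \<cdot> q"
    using ore[OF den_arr[OF assms(1)] assms(2)] by blast
  have "t \<cdot> q \<in> den D X" using D den_cmp assms(1) by metis
  then have "q \<in> den D B" using den_right[OF D(2) den_arr[OF assms(2)]] assms(2) by blast
  then show ?thesis using D by blast
qed

text \<open>The square is filled in along its diagonal, with one octahedron for each half.\<close>

lemma third_den:
  assumes t: "(X, Y, Z, f, g, h) \<in> Tri C" and t': "(X', Y', Z', f', g', h') \<in> Tri C"
    and a: "a \<in> den X X'" and b: "b \<in> den Y Y'" and eq: "b \<cdot> f = f' \<cdot> a"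
  shows "\<exists>c. c \<in> den Z Z' \<and> c \<cdot> g = g' \<cdot> b \<and> Sm a \<cdot> h = h' \<cdot> c"
proof -
  note ta = tri_arr[OF t] and ta' = tri_arr[OF t'] and aa = den_arr[OF a] and ba = den_arr[OF b]
  obtain W m n where W: "(X, Y', W, b \<cdot> f, m, n) \<in> Tri C" using ex_cone[of "b \<cdot> f" X Y'] ta ba by auto
  obtain E p q where E: "E \<in> S" "(X, X', E, a, p, q) \<in> Tri C" using denD[OF a] by blast
  obtain F k l where F: "F \<in> S" "(Y, Y', F, b, k, l) \<in> Tri C" using denD[OF b] by blast
  obtain u x where u: "(Z, W, F, u, x, Sm g \<cdot> l) \<in> Tri C" "u \<cdot> g = m \<cdot> b" "n \<cdot> u = h"
    using octahedral[OF t F(2) W] by blast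
  obtain y v where v: "(E, W, Z', y, v, Sm p \<cdot> h') \<in> Tri C" "v \<cdot> m = g'" "h' \<cdot> v = Sm a \<cdot> n"
    using octahedral[OF E(2) t' W[unfolded eq]] by blast
  note ua = tri_arr[OF u(1)] and va = tri_arr[OF v(1)] and Wa = tri_arr[OF W]
  have "u \<in> den Z W" using denI[OF u(1) F(1)] .
  moreover have "v \<in> den W Z'" using denI[OF tri_rotated[OF v(1)]] S_shift S_obj E(1) by blast
  ultimately have "v \<cdot> u \<in> den Z Z'" using den_cmp by blast
  moreover have "(v \<cdot> u) \<cdot> g = g' \<cdot> b"
    using ta ua va Wa ba v(2) u(2) cmp_pre[OF v(2)] by simp
  moreover have "Sm a \<cdot> h = h' \<cdot> (v \<cdot> u)"
    using ta' ua va Wa aa u(3) cmp_pre[OF v(3)] by simp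
  ultimately show ?thesis by blast
qed

text \<open>The cone of the inclusion of a summand is the complementary summand.\<close>

lemma biproduct_den:
  assumes bp: "biproduct C A B D i j p q" and A: "A \<in> Obj C" and B: "B \<in> S"
  shows "i \<in> den A D" "p \<in> den D A"
proof -
  note b = biproduct_arr[OF bp A S_obj[OF B]]
  obtain E g h where t: "(A, D, E, i, g, h) \<in> Tri C" using ex_cone[OF b(1)] by blast
  note ta = tri_arr[OF t]
  have o: "A \<in> Obj C" "D \<in> Obj C" "E \<in> Obj C" "B \<in> Obj C" using b(1,2) ta by simp_all
  \<comment> \<open>The retraction \<open>p\<close> forces the connecting morphism \<open>h\<close>
    to vanish, so the identity of the cone lifts to D along \<open>g\<close>.\<close>
  have "Sm p \<cdot> Sm i = Ident C (Sh A)" using shift.map_cmp[of i p] b(1,3,5) o by simp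
  then have "h = (Sm p \<cdot> Sm i) \<cdot> h" using ta(3) by simp
  also have "\<dots> = Sm p \<cdot> zero E (Sh D)" using tri_comp_zero3[OF t] b(1,3) ta by simp
  finally have "h = zero E (Sh A)" using b(3) o by simp
  then have "h \<cdot> Ident C E = zero E (Sh A)" using ta by simp
  then obtain r where r: "arr r E D" "Ident C E = g \<cdot> r"
    using exact_right[OF t ident_arr[OF o(3)]] by blast
  \<comment> \<open>\<open>q\<close> kills \<open>i\<close> and hence descends to the cone E; this
    \<open>k\<close> and \<open>g \<cdot> j\<close> turn out to be mutually inverse.\<close>
  obtain k where k: "arr k E B" "q = k \<cdot> g" using coexact_mid[OF t b(4) b(7)] by blast
  have kg: "k \<cdot> (g \<cdot> j) = Ident C B" using b(2,6) k ta by simp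
  have gj: "(g \<cdot> j) \<cdot> k = Ident C E"
  proof -
    have "g = g \<cdot> add (i \<cdot> p) (j \<cdot> q)" using b(9) ta by simp
    also have "\<dots> = add ((g \<cdot> i) \<cdot> p) (g \<cdot> (j \<cdot> q))" using b(1-4) ta by simp
    also have "\<dots> = g \<cdot> (j \<cdot> q)" using tri_comp_zero1[OF t] b(1-4) ta by simp
    finally have g: "g \<cdot> (j \<cdot> (k \<cdot> g)) = g" using k(2) by simp
    have "(g \<cdot> j) \<cdot> k = ((g \<cdot> j) \<cdot> k) \<cdot> (g \<cdot> r)" using r(2)[symmetric] k ta b(2) by simp
    also have "\<dots> = (g \<cdot> (j \<cdot> (k \<cdot> g))) \<cdot> r" using r(1) k(1) ta b(2) by simp
    also have "\<dots> = Ident C E" using g r(2) by simp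
    finally show ?thesis .
  qed
  have "is_iso C E B k" by (rule is_isoI[where g = "g \<cdot> j"]) (use k(1) ta b(2) kg gj in simp_all)
  then have "E \<in> S" using S_iso o B by blast
  then show i: "i \<in> den A D" using denI[OF t] by blast
  show "p \<in> den D A" using den_left[OF b(1,3)] b(5) den_ident[OF A] i by simp
qed

section \<open>The Verdier quotient as a category\<close>

abbreviation "cls \<equiv> roof_class C S"

text \<open>The apices quantified in \<open>roof_rel\<close> are determined by the morphisms, so
  they can be fixed in advance.\<close>

lemma rel_iff:
  assumes "s \<in> den A X" "arr f A Y" "t \<in> den B X" "arr g B Y"
  shows "((s, f), (t, g)) \<in> roof_rel C S X Y \<longleftrightarrow>
    (\<exists>D u v. arr u D A \<and> arr v D B \<and> s \<cdot> u \<in> den D X \<and> s \<cdot> u = t \<cdot> v \<and> f \<cdot> u = g \<cdot> v)"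
    (is "_ \<longleftrightarrow> ?R")
proof
  assume "((s, f), (t, g)) \<in> roof_rel C S X Y"
  then obtain A' B' D u v where *: "A' \<in> Obj C" "B' \<in> Obj C" "D \<in> Obj C"
    "s \<in> den A' X" "t \<in> den B' X" "u \<in> Hom C D A'" "v \<in> Hom C D B'"
    "s \<cdot> u \<in> den D X" "s \<cdot> u = t \<cdot> v" "f \<cdot> u = g \<cdot> v"
    unfolding roof_rel_def by blast
  have "A' = A" "B' = B" using * assms den_arr arr_unique by metis+
  then show ?R using * hom_arr by blast
next
  assume ?R
  moreover have "A \<in> Obj C" "B \<in> Obj C" using assms(2,4) by auto
  ultimately show "((s, f), (t, g)) \<in> roof_rel C S X Y"
    unfolding roof_rel_def using assms arr_hom arr_objs by blast
qed

lemma roof_iff: "(s, f) \<in> roofs C S X Y \<and> Y \<in> Obj C \<longleftrightarrow> (\<exists>A. s \<in> den A X \<and> arr f A Y)"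
  unfolding roofs_def using arr_hom arr_objs hom_arr by blast

lemma rel_roofs: "r \<in> roof_rel C S X Y \<Longrightarrow> r \<in> roofs C S X Y \<times> roofs C S X Y"
  unfolding roof_rel_def roofs_def by blast

text \<open>Equivalent roofs agree over some apex, but later arguments need agreement over a given E
  on which the denominators already coincide. An Ore square carries the known apex to E, and
  cancelling \<open>s\<close> and then \<open>t\<close> yields the numerators. Transitivity and the
  well-definedness of composition both rest on this.\<close>

lemma rel_refine:
  assumes r: "((s, f), (t, g)) \<in> roof_rel C S X Y"
    and s: "s \<in> den A X" "arr f A Y" and t: "t \<in> den B X" "arr g B Y"
    and a: "arr a E A" and b: "arr b E B" and eq: "s \<cdot> a = t \<cdot> b"
  shows "\<exists>D w. w \<in> den D E \<and> f \<cdot> (a \<cdot> w) = g \<cdot> (b \<cdot> w)"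
proof -
  note sa = den_arr[OF s(1)] and ta = den_arr[OF t(1)]
  obtain R u v where u: "arr u R A" "arr v R B" "s \<cdot> u \<in> den R X" "s \<cdot> u = t \<cdot> v" "f \<cdot> u = g \<cdot> v"
    using r rel_iff[OF s t] by blast
  obtain E1 w1 c where w1: "w1 \<in> den E1 E" "arr c E1 R" "(s \<cdot> a) \<cdot> w1 = (s \<cdot> u) \<cdot> c"
    using ore[of "s \<cdot> a" E X "s \<cdot> u" R] u(3) a sa by auto
  note w1a = den_arr[OF w1(1)]
  \<comment> \<open>The next denominator \<open>w2\<close> pays for cancelling \<open>s\<close>; the
    square with \<open>t\<close> is then treated alike with \<open>w3\<close>.\<close>
  have "s \<cdot> (a \<cdot> w1) = s \<cdot> (u \<cdot> c)" using w1 w1a u(1) a sa by simp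
  then obtain E2 w2 where w2: "w2 \<in> den E2 E1" "(a \<cdot> w1) \<cdot> w2 = (u \<cdot> c) \<cdot> w2"
    using cancel[of "a \<cdot> w1" E1 A "u \<cdot> c" s X] w1 w1a u(1) a s by auto
  note w2a = den_arr[OF w2(1)]
  have "t \<cdot> (b \<cdot> (w1 \<cdot> w2)) = t \<cdot> (v \<cdot> (c \<cdot> w2))"
  proof -
    have "t \<cdot> (b \<cdot> (w1 \<cdot> w2)) = s \<cdot> (a \<cdot> (w1 \<cdot> w2))"
      using cmp_pre[OF eq] a b sa ta w1a w2a by simp
    also have "\<dots> = s \<cdot> (u \<cdot> (c \<cdot> w2))" using w2(2) a u(1) w1 w1a w2a by simp
    also have "\<dots> = t \<cdot> (v \<cdot> (c \<cdot> w2))"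
      using cmp_pre[OF u(4)] u(1,2) sa ta w1(2) w2a by simp
    finally show ?thesis .
  qed
  then obtain E3 w3 where w3: "w3 \<in> den E3 E2"
    "(b \<cdot> (w1 \<cdot> w2)) \<cdot> w3 = (v \<cdot> (c \<cdot> w2)) \<cdot> w3"
    using cancel[of "b \<cdot> (w1 \<cdot> w2)" E2 B "v \<cdot> (c \<cdot> w2)" t X] w1 w1a w2a u(2) b t by auto
  note w3a = den_arr[OF w3(1)]
  have "f \<cdot> (a \<cdot> (w1 \<cdot> (w2 \<cdot> w3))) = f \<cdot> (((a \<cdot> w1) \<cdot> w2) \<cdot> w3)"
    using s a w1a w2a w3a by simp
  also have "\<dots> = f \<cdot> (u \<cdot> (c \<cdot> (w2 \<cdot> w3)))"
    unfolding w2(2) using s u(1) w1(2) w2a w3a by simp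
  also have "\<dots> = g \<cdot> (v \<cdot> (c \<cdot> (w2 \<cdot> w3)))"
    using cmp_pre[OF u(5)] u(1,2) s t w1(2) w2a w3a by simp
  also have "\<dots> = g \<cdot> (b \<cdot> (w1 \<cdot> (w2 \<cdot> w3)))"
    using w3(2) u(2) b w1a w1(2) w2a w3a by simp
  finally have "f \<cdot> (a \<cdot> (w1 \<cdot> (w2 \<cdot> w3))) = g \<cdot> (b \<cdot> (w1 \<cdot> (w2 \<cdot> w3)))" .
  moreover have "w1 \<cdot> (w2 \<cdot> w3) \<in> den E3 E" using den_cmp w1(1) w2(1) w3(1) by blast
  ultimately show ?thesis by blast
qed

lemma relI:
  assumes "s \<in> den A X" "arr f A Y" "t \<in> den B X" "arr g B Y"
    and "p \<in> den D A" "arr q D B" "s \<cdot> p = t \<cdot> q" "f \<cdot> p = g \<cdot> q"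
  shows "((s, f), (t, g)) \<in> roof_rel C S X Y"
  unfolding rel_iff[OF assms(1-4)] using den_cmp[OF assms(5,1)] den_arr[OF assms(5)] assms by blast

lemma rel_equiv:
  assumes Y: "Y \<in> Obj C"
  shows "equiv (roofs C S X Y) (roof_rel C S X Y)"
proof (rule equivI)
  show "roof_rel C S X Y \<subseteq> roofs C S X Y \<times> roofs C S X Y"
    using rel_roofs by (meson subsetI)
  show "refl_on (roofs C S X Y) (roof_rel C S X Y)"
  proof (rule refl_onI)
    fix r assume "r \<in> roofs C S X Y"
    then obtain s f A where r: "r = (s, f)" "s \<in> den A X" "arr f A Y"
      using roof_iff Y by (metis surj_pair)
    then have "A \<in> Obj C" by simp
    then show "(r, r) \<in> roof_rel C S X Y"
      unfolding r(1) using relI[OF r(2,3) r(2,3) den_ident[of A] ident_arr[of A]] by simp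
  qed
  show "sym (roof_rel C S X Y)"
  proof (rule symI)
    fix r q assume *: "(r, q) \<in> roof_rel C S X Y"
    then obtain s f A t g B where r: "r = (s, f)" "s \<in> den A X" "arr f A Y"
      and q: "q = (t, g)" "t \<in> den B X" "arr g B Y"
      using rel_roofs[OF *] roof_iff Y by (metis mem_Times_iff fst_conv snd_conv surj_pair)
    show "(q, r) \<in> roof_rel C S X Y"
      using * unfolding r(1) q(1) rel_iff[OF r(2,3) q(2,3)] rel_iff[OF q(2,3) r(2,3)]
      by metis
  qed
  show "trans (roof_rel C S X Y)"
  proof (rule transI)
    fix r q p assume *: "(r, q) \<in> roof_rel C S X Y" "(q, p) \<in> roof_rel C S X Y"
    obtain s f A t g B where r: "r = (s, f)" "s \<in> den A X" "arr f A Y"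
      and q: "q = (t, g)" "t \<in> den B X" "arr g B Y"
      using rel_roofs[OF *(1)] roof_iff Y by (metis mem_Times_iff fst_conv snd_conv surj_pair)
    obtain x h D where p: "p = (x, h)" "x \<in> den D X" "arr h D Y"
      using rel_roofs[OF *(2)] roof_iff Y by (metis mem_Times_iff fst_conv snd_conv surj_pair)
    \<comment> \<open>The two outer roofs are refined to a common denominator, which is then pulled
      over the middle roof; \<open>rel_refine\<close> compares neighbours in turn.\<close>
    obtain E a b where E: "a \<in> den E A" "b \<in> den E D" "s \<cdot> a = x \<cdot> b"
      using den_common[OF r(2) p(2)] by blast
    obtain F c d where F: "c \<in> den F E" "arr d F B" "(s \<cdot> a) \<cdot> c = t \<cdot> d"
      using ore[OF den_arr[OF den_cmp[OF E(1) r(2)]] q(2)] by blast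
    note arrs = den_arr[OF r(2)] den_arr[OF q(2)] den_arr[OF p(2)] den_arr[OF E(1)]
      den_arr[OF E(2)] den_arr[OF F(1)]
    have e1: "s \<cdot> (a \<cdot> c) = t \<cdot> d" using F(3) arrs by simp
    obtain G w where w: "w \<in> den G F" "f \<cdot> ((a \<cdot> c) \<cdot> w) = g \<cdot> (d \<cdot> w)"
      using rel_refine[OF *(1)[unfolded r(1) q(1)] r(2,3) q(2,3) _ F(2) e1] arrs by auto
    note wa = den_arr[OF w(1)]
    have e2: "t \<cdot> (d \<cdot> w) = x \<cdot> (b \<cdot> (c \<cdot> w))"
      using cmp_pre[OF e1, of w] cmp_pre[OF E(3), of "c \<cdot> w"] arrs wa F(2) by simp
    have ta: "arr (d \<cdot> w) G B" "arr (b \<cdot> (c \<cdot> w)) G D" using arrs wa F(2) by simp_all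
    obtain H v where v: "v \<in> den H G" "g \<cdot> ((d \<cdot> w) \<cdot> v) = h \<cdot> ((b \<cdot> (c \<cdot> w)) \<cdot> v)"
      using rel_refine[OF *(2)[unfolded p(1) q(1)] q(2,3) p(2,3) ta e2] by blast
    note va = den_arr[OF v(1)]
    show "(r, p) \<in> roof_rel C S X Y"
      unfolding r(1) p(1)
    proof (rule relI[OF r(2,3) p(2,3)])
      show "a \<cdot> (c \<cdot> (w \<cdot> v)) \<in> den H A" using den_cmp E(1) F(1) w(1) v(1) by blast
      show "arr (b \<cdot> (c \<cdot> (w \<cdot> v))) H D" using arrs wa va by simp
      show "s \<cdot> (a \<cdot> (c \<cdot> (w \<cdot> v))) = x \<cdot> (b \<cdot> (c \<cdot> (w \<cdot> v)))"
        using cmp_pre[OF E(3)] arrs wa va by simp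
      have "f \<cdot> (a \<cdot> (c \<cdot> (w \<cdot> v))) = (f \<cdot> ((a \<cdot> c) \<cdot> w)) \<cdot> v" using r(3) arrs wa va by simp
      also have "\<dots> = g \<cdot> ((d \<cdot> w) \<cdot> v)" unfolding w(2) using q(3) F(2) wa va by simp
      also have "\<dots> = h \<cdot> (b \<cdot> (c \<cdot> (w \<cdot> v)))" unfolding v(2) using p(3) arrs wa va by simp
      finally show "f \<cdot> (a \<cdot> (c \<cdot> (w \<cdot> v))) = h \<cdot> (b \<cdot> (c \<cdot> (w \<cdot> v)))" .
    qed
  qed
qed

section \<open>Composition of fractions and the category axioms of the quotient\<close>

abbreviation "V \<equiv> verdier C S"
abbreviation "loc \<equiv> loc_mor C S"

lemma verdier_fields [simp]:
  "Obj V = Obj C" "Shift V = Shift C"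
  "Obj (verdier_pre C S) = Obj C" "Shift (verdier_pre C S) = Shift C"
  "Hom (verdier_pre C S) = Hom V" "Cmp (verdier_pre C S) = Cmp V"
  "Ident (verdier_pre C S) = Ident V" "ShiftM (verdier_pre C S) = ShiftM V"
  by (simp_all add: verdier_def verdier_pre_def)

lemma verdier_ops:
  "Hom V X Y = roofs C S X Y // roof_rel C S X Y" "Ident V X = loc (Ident C X)"
  "Cmp V = verdier_cmp C S" "Plus V = verdier_plus C S" "ShiftM V = verdier_shift C S"
  by (simp_all add: verdier_def verdier_pre_def)

lemma cls_mem: "(t, g) \<in> cls X Y (s, f) \<longleftrightarrow> ((s, f), (t, g)) \<in> roof_rel C S X Y"
  unfolding roof_class_def by simp

lemma
  assumes "s \<in> den A X" "arr f A Y"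
  shows cls_hom: "cls X Y (s, f) \<in> Hom V X Y" and cls_self: "(s, f) \<in> cls X Y (s, f)"
proof -
  have r: "(s, f) \<in> roofs C S X Y" "Y \<in> Obj C" using assms roof_iff by blast+
  show "cls X Y (s, f) \<in> Hom V X Y"
    unfolding verdier_ops roof_class_def using r(1) by (rule quotientI)
  show "(s, f) \<in> cls X Y (s, f)"
    unfolding roof_class_def using equiv_class_self[OF rel_equiv[OF r(2)] r(1)] .
qed

lemma hom_cls:
  assumes "c \<in> Hom V X Y" "Y \<in> Obj C"
  shows "\<exists>A s f. s \<in> den A X \<and> arr f A Y \<and> c = cls X Y (s, f)"
proof -
  obtain r where r: "r \<in> roofs C S X Y" "c = roof_rel C S X Y `` {r}"
    using assms(1) unfolding verdier_ops by (rule quotientE)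
  then show ?thesis unfolding roof_class_def using roof_iff assms(2) by (metis surj_pair)
qed

lemma cls_eqI:
  assumes "((s, f), (t, g)) \<in> roof_rel C S X Y" "Y \<in> Obj C"
  shows "cls X Y (s, f) = cls X Y (t, g)"
  unfolding roof_class_def using equiv_class_eq[OF rel_equiv[OF assms(2)] assms(1)] .

lemma cls_eqD:
  assumes "cls X Y (s, f) = cls X Y (t, g)" "t \<in> den B X" "arr g B Y"
  shows "((s, f), (t, g)) \<in> roof_rel C S X Y"
  using cls_self[OF assms(2,3)] assms(1) cls_mem by metis

lemma cls_memD:
  assumes m: "(t, g) \<in> cls X Y (s, f)" and Y: "Y \<in> Obj C"
  shows "((s, f), (t, g)) \<in> roof_rel C S X Y" "\<exists>B. t \<in> den B X \<and> arr g B Y"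
proof -
  show r: "((s, f), (t, g)) \<in> roof_rel C S X Y" using m cls_mem by simp
  show "\<exists>B. t \<in> den B X \<and> arr g B Y" using rel_roofs[OF r] roof_iff Y by blast
qed

text \<open>Over a common refinement of both composite denominators, \<open>rel_refine\<close> first
  identifies the inner numerators, which makes the outer roofs comparable, and then the outer
  ones.\<close>

lemma cmp_well_defined:
  assumes r1: "((s, f), (s2, f2)) \<in> roof_rel C S X Y" and r2: "((t, g), (t2, g2)) \<in> roof_rel C S Y Z"
    and s: "s \<in> den A X" "arr f A Y" and s2: "s2 \<in> den A2 X" "arr f2 A2 Y"
    and t: "t \<in> den B Y" "arr g B Z" and t2: "t2 \<in> den B2 Y" "arr g2 B2 Z"
    and sq: "t' \<in> den D A" "arr f' D B" "f \<cdot> t' = t \<cdot> f'"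
    and sq2: "t2' \<in> den D2 A2" "arr f2' D2 B2" "f2 \<cdot> t2' = t2 \<cdot> f2'"
  shows "((s \<cdot> t', g \<cdot> f'), (s2 \<cdot> t2', g2 \<cdot> f2')) \<in> roof_rel C S X Z"
proof -
  note ty = den_arr[OF s(1)] den_arr[OF s2(1)] den_arr[OF t(1)] den_arr[OF t2(1)]
    den_arr[OF sq(1)] den_arr[OF sq2(1)] s(2) s2(2) t(2) t2(2) sq(2) sq2(2)
  obtain E p q where E: "p \<in> den E D" "q \<in> den E D2" "(s \<cdot> t') \<cdot> p = (s2 \<cdot> t2') \<cdot> q"
    using den_common[OF den_cmp[OF sq(1) s(1)] den_cmp[OF sq2(1) s2(1)]] by blast
  note ty = ty den_arr[OF E(1)] den_arr[OF E(2)]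
  have e1: "s \<cdot> (t' \<cdot> p) = s2 \<cdot> (t2' \<cdot> q)" using E(3) ty by simp
  have a1: "arr (t' \<cdot> p) E A" "arr (t2' \<cdot> q) E A2" using ty by simp_all
  obtain F w where w: "w \<in> den F E" "f \<cdot> ((t' \<cdot> p) \<cdot> w) = f2 \<cdot> ((t2' \<cdot> q) \<cdot> w)"
    using rel_refine[OF r1 s s2 a1 e1] by blast
  note ty = ty den_arr[OF w(1)]
  have "t \<cdot> (f' \<cdot> (p \<cdot> w)) = f \<cdot> (t' \<cdot> (p \<cdot> w))" using cmp_pre[OF sq(3)] ty by simp
  also have "\<dots> = f2 \<cdot> (t2' \<cdot> (q \<cdot> w))" using w(2) ty by simp
  also have "\<dots> = t2 \<cdot> (f2' \<cdot> (q \<cdot> w))" using cmp_pre[OF sq2(3)] ty by simp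
  finally have e2: "t \<cdot> (f' \<cdot> (p \<cdot> w)) = t2 \<cdot> (f2' \<cdot> (q \<cdot> w))" .
  have a2: "arr (f' \<cdot> (p \<cdot> w)) F B" "arr (f2' \<cdot> (q \<cdot> w)) F B2" using ty by simp_all
  obtain G v where v: "v \<in> den G F" "g \<cdot> ((f' \<cdot> (p \<cdot> w)) \<cdot> v) = g2 \<cdot> ((f2' \<cdot> (q \<cdot> w)) \<cdot> v)"
    using rel_refine[OF r2 t t2 a2 e2] by blast
  note ty = ty den_arr[OF v(1)]
  show ?thesis
  proof (rule relI[OF den_cmp[OF sq(1) s(1)] _ den_cmp[OF sq2(1) s2(1)]])
    show "arr (g \<cdot> f') D Z" "arr (g2 \<cdot> f2') D2 Z" using ty by simp_all
    show "p \<cdot> (w \<cdot> v) \<in> den G D" using den_cmp E(1) w(1) v(1) by blast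
    show "arr (q \<cdot> (w \<cdot> v)) G D2" using ty by simp
    show "(s \<cdot> t') \<cdot> (p \<cdot> (w \<cdot> v)) = (s2 \<cdot> t2') \<cdot> (q \<cdot> (w \<cdot> v))"
      using cmp_pre[OF E(3)] ty by simp
    show "(g \<cdot> f') \<cdot> (p \<cdot> (w \<cdot> v)) = (g2 \<cdot> f2') \<cdot> (q \<cdot> (w \<cdot> v))"
      using v(2) ty by simp
  qed
qed

text \<open>\<open>verdier_cmp\<close> collects the results of all representatives and all Ore
  squares; by \<open>cmp_well_defined\<close> they lie in a single class, so any one square computes
  the composite.\<close>

lemma cmp_cls:
  assumes s: "s \<in> den A X" "arr f A Y" and t: "t \<in> den B Y" "arr g B Z"
    and sq: "t' \<in> den D A" "arr f' D B" "f \<cdot> t' = t \<cdot> f'"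
  shows "Cmp V (cls Y Z (t, g)) (cls X Y (s, f)) = cls X Z (s \<cdot> t', g \<cdot> f')"
proof -
  have o: "X \<in> Obj C" "Y \<in> Obj C" "Z \<in> Obj C" "A \<in> Obj C" "B \<in> Obj C" "D \<in> Obj C"
    using s t sq arr_objs den_arr by blast+
  show ?thesis
    unfolding verdier_ops
  proof (intro subset_antisym subsetI)
    fix r assume "r \<in> verdier_cmp C S (cls Y Z (t, g)) (cls X Y (s, f))"
    then obtain X1 Y1 Z1 A1 B1 D1 s1 f1 t1 g1 t1' f1' where
      o1: "X1 \<in> Obj C" "Y1 \<in> Obj C" "Z1 \<in> Obj C" "A1 \<in> Obj C" "B1 \<in> Obj C" "D1 \<in> Obj C" and
      m: "(s1, f1) \<in> cls X Y (s, f)" "(t1, g1) \<in> cls Y Z (t, g)" and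
      h: "s1 \<in> den A1 X1" "f1 \<in> Hom C A1 Y1" "t1 \<in> den B1 Y1" "g1 \<in> Hom C B1 Z1"
       "t1' \<in> den D1 A1" "f1' \<in> Hom C D1 B1" "f1 \<cdot> t1' = t1 \<cdot> f1'" and
      r: "r \<in> cls X1 Z1 (s1 \<cdot> t1', g1 \<cdot> f1')"
      unfolding verdier_cmp_def by blast
    have a: "arr f1 A1 Y1" "arr g1 B1 Z1" "arr f1' D1 B1" using h o1 hom_arr by blast+
    note m1 = cls_memD[OF m(1) o(2)] and m2 = cls_memD[OF m(2) o(3)]
    have eq: "X1 = X" "Z1 = Z" "Y1 = Y" using m1(2) m2(2) h a den_arr arr_unique by metis+
    have "((s \<cdot> t', g \<cdot> f'), (s1 \<cdot> t1', g1 \<cdot> f1')) \<in> roof_rel C S X Z"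
      using cmp_well_defined[OF m1(1) m2(1) s h(1)[unfolded eq] a(1)[unfolded eq] t h(3)[unfolded eq]
        a(2)[unfolded eq] sq h(5) a(3) h(7)] .
    from cls_eqI[OF this o(3)] show "r \<in> cls X Z (s \<cdot> t', g \<cdot> f')" using r eq by simp
  next
    fix r assume "r \<in> cls X Z (s \<cdot> t', g \<cdot> f')"
    moreover have "f \<in> Hom C A Y" "g \<in> Hom C B Z" "f' \<in> Hom C D B" using s t sq arr_hom by blast+
    ultimately show "r \<in> verdier_cmp C S (cls Y Z (t, g)) (cls X Y (s, f))"
      unfolding verdier_cmp_def using o cls_self[OF s] cls_self[OF t] s t sq by blast
  qed
qed

lemma loc_cls: "arr f X Y \<Longrightarrow> loc f = cls X Y (Ident C X, f)"
proof -
  assume f: "arr f X Y"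
  have "X' = X \<and> Y' = Y" if "X' \<in> Obj C" "Y' \<in> Obj C" "f \<in> Hom C X' Y'" for X' Y'
    using that f hom_arr arr_unique by blast
  then show ?thesis unfolding loc_mor_def using f arr_hom arr_objs by blast
qed

lemma cmp_ex:
  assumes "c \<in> Hom V X Y" "d \<in> Hom V Y Z" "Y \<in> Obj C" "Z \<in> Obj C"
  shows "\<exists>A B D s f t g t' f'. s \<in> den A X \<and> arr f A Y \<and> t \<in> den B Y \<and> arr g B Z \<and>
    t' \<in> den D A \<and> arr f' D B \<and> f \<cdot> t' = t \<cdot> f' \<and> c = cls X Y (s, f) \<and> d = cls Y Z (t, g) \<and>
    Cmp V d c = cls X Z (s \<cdot> t', g \<cdot> f')"
proof -
  obtain A s f where c: "s \<in> den A X" "arr f A Y" "c = cls X Y (s, f)"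
    using hom_cls assms by blast
  obtain B t g where d: "t \<in> den B Y" "arr g B Z" "d = cls Y Z (t, g)"
    using hom_cls assms by blast
  obtain D t' f' where "t' \<in> den D A" "arr f' D B" "f \<cdot> t' = t \<cdot> f'"
    using ore[OF c(2) d(1)] by blast
  then show ?thesis using c d cmp_cls[OF c(1,2) d(1,2)] by metis
qed

lemma verdier_category: "category V"
proof
  fix X Y X' Y' c
  assume o: "X \<in> Obj V" "Y \<in> Obj V" "X' \<in> Obj V" "Y' \<in> Obj V" and c: "c \<in> Hom V X Y" "c \<in> Hom V X' Y'"
  obtain A s f where s: "s \<in> den A X" "arr f A Y" "c = cls X Y (s, f)"
    using hom_cls c o[unfolded verdier_fields] by blast
  obtain A' s' f' where s': "s' \<in> den A' X'" "arr f' A' Y'" "c = cls X' Y' (s', f')"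
    using hom_cls c o[unfolded verdier_fields] by blast
  have "(s, f) \<in> cls X' Y' (s', f')" using cls_self[OF s(1,2)] s(3) s'(3) by simp
  then obtain B where "s \<in> den B X'" "arr f B Y'" using cls_memD(2) o by auto
  then show "X = X' \<and> Y = Y'" using s(1,2) den_arr arr_unique by metis
next
  fix X assume "X \<in> Obj V"
  then have X: "X \<in> Obj C" by simp
  show "Ident V X \<in> Hom V X X"
    unfolding verdier_ops(2) loc_cls[OF ident_arr[OF X]]
    by (rule cls_hom[OF den_ident[OF X] ident_arr[OF X]])
next
  fix X Y Z c d assume "X \<in> Obj V" "Y \<in> Obj V" "Z \<in> Obj V" "c \<in> Hom V X Y" "d \<in> Hom V Y Z"
  then obtain A B D s f t g t' f' where s: "s \<in> den A X" "arr f A Y" "t \<in> den B Y" "arr g B Z"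
    "t' \<in> den D A" "arr f' D B" "Cmp V d c = cls X Z (s \<cdot> t', g \<cdot> f')"
    using cmp_ex[of c X Y d Z] by auto
  show "Cmp V d c \<in> Hom V X Z"
    unfolding s(7) by (rule cls_hom[OF den_cmp[OF s(5,1)] cmp_arr[OF s(6,4)]])
next
  fix X Y c assume o: "X \<in> Obj V" "Y \<in> Obj V" and c: "c \<in> Hom V X Y"
  obtain A s f where s: "s \<in> den A X" "arr f A Y" "c = cls X Y (s, f)"
    using hom_cls[OF c] o[unfolded verdier_fields] by blast
  have X: "X \<in> Obj C" "Y \<in> Obj C" "A \<in> Obj C" using s(2) o by auto
  note sa = den_arr[OF s(1)]
  have "Cmp V c (Ident V X) = cls X Y (Ident C X \<cdot> s, f \<cdot> Ident C A)"
    unfolding s(3) verdier_ops(2) loc_cls[OF ident_arr[OF X(1)]]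
    by (rule cmp_cls[OF den_ident[OF X(1)] ident_arr[OF X(1)] s(1,2,1) ident_arr[OF X(3)]])
      (use sa in simp)
  then show "Cmp V c (Ident V X) = c" using s sa by simp
  have "Cmp V (Ident V Y) c = cls X Y (s \<cdot> Ident C A, Ident C Y \<cdot> f)"
    unfolding s(3) verdier_ops(2) loc_cls[OF ident_arr[OF X(2)]]
    by (rule cmp_cls[OF s(1,2) den_ident[OF X(2)] ident_arr[OF X(2)] den_ident[OF X(3)] s(2)])
      (use s(2) in simp)
  then show "Cmp V (Ident V Y) c = c" using s sa by simp
next
  fix W X Y Z c d e assume "W \<in> Obj V" "X \<in> Obj V" "Y \<in> Obj V" "Z \<in> Obj V"
    and cde: "c \<in> Hom V W X" "d \<in> Hom V X Y" "e \<in> Hom V Y Z"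
  then have o: "W \<in> Obj C" "X \<in> Obj C" "Y \<in> Obj C" "Z \<in> Obj C" by simp_all
  obtain A s f where s: "s \<in> den A W" "arr f A X" "c = cls W X (s, f)"
    using hom_cls cde o by blast
  obtain B t g where t: "t \<in> den B X" "arr g B Y" "d = cls X Y (t, g)"
    using hom_cls cde o by blast
  obtain E x h where x: "x \<in> den E Y" "arr h E Z" "e = cls Y Z (x, h)"
    using hom_cls cde o by blast
  \<comment> \<open>Three Ore squares, for \<open>f\<close> over \<open>t\<close>, for
    \<open>g\<close> over \<open>x\<close> and for \<open>f'\<close> over \<open>x'\<close>, yield
    one roof that computes both bracketings.\<close>
  obtain D t' f' where sq: "t' \<in> den D A" "arr f' D B" "f \<cdot> t' = t \<cdot> f'"
    using ore[OF s(2) t(1)] by blast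
  obtain D2 x' g' where sq2: "x' \<in> den D2 B" "arr g' D2 E" "g \<cdot> x' = x \<cdot> g'"
    using ore[OF t(2) x(1)] by blast
  obtain D3 x'' f'' where sq3: "x'' \<in> den D3 D" "arr f'' D3 D2" "f' \<cdot> x'' = x' \<cdot> f''"
    using ore[OF sq(2) sq2(1)] by blast
  note ty = den_arr[OF s(1)] s(2) den_arr[OF t(1)] t(2) den_arr[OF x(1)] x(2)
    den_arr[OF sq(1)] sq(2) den_arr[OF sq2(1)] sq2(2) den_arr[OF sq3(1)] sq3(2)
  have "Cmp V e (Cmp V d c) = cls W Z ((s \<cdot> t') \<cdot> x'', h \<cdot> (g' \<cdot> f''))"
    unfolding s(3) t(3) x(3) cmp_cls[OF s(1,2) t(1,2) sq]
  proof (rule cmp_cls[OF den_cmp[OF sq(1) s(1)] cmp_arr[OF sq(2) t(2)] x(1,2) sq3(1)])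
    show "arr (g' \<cdot> f'') D3 E" using ty by simp
    show "(g \<cdot> f') \<cdot> x'' = x \<cdot> (g' \<cdot> f'')"
      using cmp_pre[OF sq2(3)] sq3(3) ty by simp
  qed
  moreover have "Cmp V (Cmp V e d) c = cls W Z (s \<cdot> (t' \<cdot> x''), (h \<cdot> g') \<cdot> f'')"
    unfolding s(3) t(3) x(3) cmp_cls[OF t(1,2) x(1,2) sq2]
  proof (rule cmp_cls[OF s(1,2) den_cmp[OF sq2(1) t(1)] cmp_arr[OF sq2(2) x(2)]])
    show "t' \<cdot> x'' \<in> den D3 A" using den_cmp sq(1) sq3(1) by blast
    show "arr f'' D3 D2" using sq3(2) .
    show "f \<cdot> (t' \<cdot> x'') = (t \<cdot> x') \<cdot> f''"
      using cmp_pre[OF sq(3)] sq3(3) ty by simp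
  qed
  ultimately show "Cmp V e (Cmp V d c) = Cmp V (Cmp V e d) c" using ty by simp
qed

sublocale V: category V
  by (rule verdier_category)

lemma V_arr_iff: "V.arr c X Y \<longleftrightarrow> X \<in> Obj C \<and> Y \<in> Obj C \<and> c \<in> Hom V X Y"
  unfolding V.arr_def by simp

lemma cls_arr: "s \<in> den A X \<Longrightarrow> arr f A Y \<Longrightarrow> V.arr (cls X Y (s, f)) X Y"
  using cls_hom V_arr_iff den_arr arr_objs by metis

section \<open>The localisation functor: equality, invertibility and addition of its images\<close>

lemma loc_functor: "is_functor C V (\<lambda>X. X) loc"
proof (rule is_functorI)
  fix X assume "X \<in> Obj C"
  then show "X \<in> Obj V" "loc (Ident C X) = Ident V X" by (simp_all add: verdier_ops(2))
next
  fix X Y f assume "X \<in> Obj C" "Y \<in> Obj C" "f \<in> Hom C X Y"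
  then have f: "arr f X Y" "X \<in> Obj C" using hom_arr by blast+
  show "loc f \<in> Hom V X Y" unfolding loc_cls[OF f(1)] using cls_hom[OF den_ident[OF f(2)] f(1)] .
next
  fix X Y Z f g assume o: "X \<in> Obj C" "Y \<in> Obj C" "Z \<in> Obj C" and "f \<in> Hom C X Y" "g \<in> Hom C Y Z"
  then have fg: "arr f X Y" "arr g Y Z" using hom_arr by blast+
  have "Cmp V (loc g) (loc f) = cls X Z (Ident C X \<cdot> Ident C X, g \<cdot> f)"
    unfolding loc_cls[OF fg(1)] loc_cls[OF fg(2)]
    by (rule cmp_cls[OF den_ident[OF o(1)] fg(1) den_ident[OF o(2)] fg(2) den_ident[OF o(1)] fg(1)])
      (use fg in simp)
  then show "loc (g \<cdot> f) = Cmp V (loc g) (loc f)"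
    using loc_cls[OF cmp_arr[OF fg]] o by simp
qed

sublocale loc: functor_pair C V "\<lambda>X. X" loc
  by unfold_locales (rule loc_functor)

lemma loc_arr: "arr f X Y \<Longrightarrow> V.arr (loc f) X Y"
  using loc.map_arr .

lemma loc_cmp: "arr f X Y \<Longrightarrow> arr g Y Z \<Longrightarrow> loc (g \<cdot> f) = Cmp V (loc g) (loc f)"
  by simp

lemma loc_eq_iff:
  assumes f: "arr f X Y" "arr g X Y"
  shows "loc f = loc g \<longleftrightarrow> (\<exists>D w. w \<in> den D X \<and> f \<cdot> w = g \<cdot> w)"
proof -
  have X: "X \<in> Obj C" "Y \<in> Obj C" using f by simp_all
  note i = den_ident[OF X(1)]
  have "loc f = loc g \<longleftrightarrow> ((Ident C X, f), (Ident C X, g)) \<in> roof_rel C S X Y"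
    unfolding loc_cls[OF f(1)] loc_cls[OF f(2)] using cls_eqD[OF _ i f(2)] cls_eqI X by blast
  also have "\<dots> \<longleftrightarrow> (\<exists>D w. w \<in> den D X \<and> f \<cdot> w = g \<cdot> w)" (is "_ \<longleftrightarrow> ?R")
  proof
    assume "((Ident C X, f), (Ident C X, g)) \<in> roof_rel C S X Y"
    then obtain D u v where u: "arr u D X" "arr v D X" "Ident C X \<cdot> u \<in> den D X"
      "Ident C X \<cdot> u = Ident C X \<cdot> v" "f \<cdot> u = g \<cdot> v"
      using rel_iff[OF i f(1) i f(2)] by blast
    have "Ident C X \<cdot> u = u" "Ident C X \<cdot> v = v" using u(1,2) by simp_all
    then show ?R using u by metis
  next
    assume ?R
    then obtain D w where "w \<in> den D X" "f \<cdot> w = g \<cdot> w" by blast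
    then show "((Ident C X, f), (Ident C X, g)) \<in> roof_rel C S X Y"
      using relI[OF i f(1) i f(2)] den_arr by blast
  qed
  finally show ?thesis .
qed

text \<open>Sums of numerators are formed over one apex, so a single denominator has to realise both
  equalities.\<close>

lemma loc_eq_common:
  assumes "arr f X Y" "arr f' X Y" "arr g X Z" "arr g' X Z" "loc f = loc f'" "loc g = loc g'"
  shows "\<exists>D w. w \<in> den D X \<and> f \<cdot> w = f' \<cdot> w \<and> g \<cdot> w = g' \<cdot> w"
proof -
  obtain D w where w: "w \<in> den D X" "f \<cdot> w = f' \<cdot> w" using loc_eq_iff assms by blast
  obtain E v where v: "v \<in> den E X" "g \<cdot> v = g' \<cdot> v" using loc_eq_iff assms by blast
  obtain F p q where p: "p \<in> den F D" "q \<in> den F E" "w \<cdot> p = v \<cdot> q"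
    using den_common[OF w(1) v(1)] by blast
  note ty = den_arr[OF w(1)] den_arr[OF v(1)] den_arr[OF p(1)] den_arr[OF p(2)]
  have "f \<cdot> (w \<cdot> p) = f' \<cdot> (w \<cdot> p)" using cmp_pre[OF w(2)] ty assms(1,2) by simp
  moreover have "g \<cdot> (w \<cdot> p) = g' \<cdot> (w \<cdot> p)"
    unfolding p(3) using cmp_pre[OF v(2)] ty assms(3,4) by simp
  ultimately show ?thesis using den_cmp[OF p(1) w(1)] by blast
qed

lemma loc_cong_add:
  assumes "arr f X Y" "arr f' X Y" "arr g X Y" "arr g' X Y" "loc f = loc f'" "loc g = loc g'"
  shows "loc (add f g) = loc (add f' g')"
proof -
  obtain D w where w: "w \<in> den D X" "f \<cdot> w = f' \<cdot> w" "g \<cdot> w = g' \<cdot> w"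
    using loc_eq_common[OF assms] by blast
  have "add f g \<cdot> w = add f' g' \<cdot> w" using w den_arr[OF w(1)] assms(1-4) by simp
  then show ?thesis using loc_eq_iff w(1) add_arr assms(1-4) by blast
qed

lemma loc_eq_dif:
  assumes "arr f X Y" "arr g X Y"
  shows "loc f = loc g \<longleftrightarrow> loc (dif f g) = loc (zero X Y)"
proof
  assume "loc f = loc g"
  then have "loc (dif f g) = loc (dif g g)"
    unfolding dif_def using loc_cong_add opp_arr assms by blast
  then show "loc (dif f g) = loc (zero X Y)" using dif_self assms by simp
next
  assume "loc (dif f g) = loc (zero X Y)"
  then have "loc (add g (dif f g)) = loc (add g (zero X Y))"
    using loc_cong_add[of g X Y g "dif f g" "zero X Y"] assms by simp
  then show "loc f = loc g" using add_dif_cancel[OF assms(2,1)] assms by simp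
qed

lemma loc_zero_iff:
  assumes f: "arr f X Y"
  shows "loc f = loc (zero X Y) \<longleftrightarrow> (\<exists>D w. w \<in> den D X \<and> f \<cdot> w = zero D Y)"
proof -
  have "zero X Y \<cdot> w = zero D Y" if "w \<in> den D X" for D w using den_arr[OF that] f by simp
  moreover have "arr (zero X Y) X Y" using f by simp
  ultimately show ?thesis using loc_eq_iff[OF f] by metis
qed

text \<open>Expresses that the class of \<open>(s, f)\<close> is the fraction of f by s; with
  \<open>loc_den_iso\<close> this replaces computing with roofs.\<close>

lemma roof_loc:
  assumes s: "s \<in> den A X" and f: "arr f A Y"
  shows "Cmp V (cls X Y (s, f)) (loc s) = loc f"
proof -
  note sa = den_arr[OF s]
  have A: "A \<in> Obj C" using f by simp
  have "Cmp V (cls X Y (s, f)) (loc s) = cls A Y (Ident C A \<cdot> Ident C A, f \<cdot> Ident C A)"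
    unfolding loc_cls[OF sa]
    by (rule cmp_cls[OF den_ident[OF A] sa s f den_ident[OF A] ident_arr[OF A]]) simp
  then show ?thesis using loc_cls[OF f] f by simp
qed

text \<open>The inverse is the class of the roof with denominator \<open>s\<close> and numerator the
  identity.\<close>

lemma loc_den_iso:
  assumes s: "s \<in> den A X"
  shows "is_iso V A X (loc s)"
proof -
  note sa = den_arr[OF s]
  have A: "A \<in> Obj C" "X \<in> Obj C" using sa by simp_all
  let ?r = "cls X A (s, Ident C A)"
  have 1: "Cmp V ?r (loc s) = Ident V A" using roof_loc[OF s ident_arr[OF A(1)]] A by simp
  have "Cmp V (loc s) ?r = cls X X (s \<cdot> Ident C A, s \<cdot> Ident C A)"
    unfolding loc_cls[OF sa]
    by (rule cmp_cls[OF s ident_arr[OF A(1)] den_ident[OF A(1)] sa den_ident[OF A(1)] ident_arr[OF A(1)]]) simp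
  also have "\<dots> = cls X X (s, s)" using sa by simp
  also have "\<dots> = cls X X (Ident C X, Ident C X)"
    by (rule cls_eqI[OF relI[OF s sa den_ident[OF A(2)] ident_arr[OF A(2)] den_ident[OF A(1)] sa] A(2)])
      (use sa in simp_all)
  also have "\<dots> = Ident V X" using loc_cls[OF ident_arr[OF A(2)]] verdier_ops(2) by metis
  finally have 2: "Cmp V (loc s) ?r = Ident V X" .
  show ?thesis
    by (rule V.is_isoI[OF loc_arr[OF sa] cls_arr[OF s ident_arr[OF A(1)]] 1 2])
qed

text \<open>\<open>verdier_plus\<close> ranges over all pairs of representatives with a common
  denominator; for localised morphisms every such pair can be compared with the one over the
  identity.\<close>

lemma loc_add:
  assumes f: "arr f X Y" and g: "arr g X Y"
  shows "Plus V (loc f) (loc g) = loc (add f g)"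
proof -
  have o: "X \<in> Obj C" "Y \<in> Obj C" using f by simp_all
  note i = den_ident[OF o(1)] and fg = add_arr[OF f g]
  show ?thesis
    unfolding verdier_ops(4)
  proof (intro subset_antisym subsetI)
    fix r assume "r \<in> verdier_plus C S (loc f) (loc g)"
    then obtain X1 Y1 A s f1 g1 where
      o1: "X1 \<in> Obj C" "Y1 \<in> Obj C" "A \<in> Obj C" and m: "(s, f1) \<in> loc f" "(s, g1) \<in> loc g" and
      h: "s \<in> den A X1" "f1 \<in> Hom C A Y1" "g1 \<in> Hom C A Y1" and r: "r \<in> cls X1 Y1 (s, add f1 g1)"
      unfolding verdier_plus_def by blast
    have a: "arr f1 A Y1" "arr g1 A Y1" using h o1 hom_arr by blast+
    note m1 = cls_memD[OF m(1)[unfolded loc_cls[OF f]] o(2)]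
      and m2 = cls_memD[OF m(2)[unfolded loc_cls[OF g]] o(2)]
    have eq: "X1 = X" "Y1 = Y" using m1(2) m2(2) h a den_arr arr_unique by metis+
    note s = h(1)[unfolded eq] and a = a[unfolded eq]
    note sa = den_arr[OF s]
    \<comment> \<open>Membership of \<open>(s, f1)\<close> in the class of \<open>f\<close> means
      that \<open>f1\<close> and \<open>f \<cdot> s\<close> have the same image, so the comparison
      can take place over the apex of \<open>s\<close>.\<close>
    have "loc f1 = loc (f \<cdot> s)"
      using roof_loc[OF s a(1)] cls_eqI[OF m1(1) o(2)] loc_cls[OF f] sa f by simp
    moreover have "loc g1 = loc (g \<cdot> s)"
      using roof_loc[OF s a(2)] cls_eqI[OF m2(1) o(2)] loc_cls[OF g] sa g by simp
    ultimately obtain D w where w: "w \<in> den D A" "f1 \<cdot> w = (f \<cdot> s) \<cdot> w" "g1 \<cdot> w = (g \<cdot> s) \<cdot> w"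
      using loc_eq_common[OF a(1) cmp_arr[OF sa f] a(2) cmp_arr[OF sa g]] by blast
    note wa = den_arr[OF w(1)]
    have "((s, add f1 g1), (Ident C X, add f g)) \<in> roof_rel C S X Y"
    proof (rule relI[OF s add_arr[OF a] i fg w(1)])
      show "arr (s \<cdot> w) D X" "s \<cdot> w = Ident C X \<cdot> (s \<cdot> w)" using sa wa by simp_all
      show "add f1 g1 \<cdot> w = add f g \<cdot> (s \<cdot> w)" using w sa wa a f g by simp
    qed
    from cls_eqI[OF this o(2)] show "r \<in> loc (add f g)" using r eq loc_cls[OF fg] by simp
  next
    fix r assume "r \<in> loc (add f g)"
    then have "r \<in> cls X Y (Ident C X, add f g)" using loc_cls[OF fg] by simp
    moreover have "(Ident C X, f) \<in> loc f" "(Ident C X, g) \<in> loc g"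
      using cls_self[OF i f] cls_self[OF i g] loc_cls f g by simp_all
    ultimately show "r \<in> verdier_plus C S (loc f) (loc g)"
      unfolding verdier_plus_def using o i arr_hom[OF f] arr_hom[OF g] by blast
  qed
qed

section \<open>The shift of the quotient and isomorphisms of its diagrams\<close>

lemma rel_shift:
  assumes r: "((s, f), (t, g)) \<in> roof_rel C S X Y"
    and s: "s \<in> den A X" "arr f A Y" and t: "t \<in> den B X" "arr g B Y"
  shows "((Sm s, Sm f), (Sm t, Sm g)) \<in> roof_rel C S (Sh X) (Sh Y)"
proof -
  obtain D u v where u: "arr u D A" "arr v D B" "s \<cdot> u \<in> den D X" "s \<cdot> u = t \<cdot> v" "f \<cdot> u = g \<cdot> v"
    using r rel_iff[OF s t] by blast
  note sa = den_arr[OF s(1)] and ta = den_arr[OF t(1)]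
  have "Sm s \<cdot> Sm u = Sm (s \<cdot> u)" "Sm t \<cdot> Sm v = Sm (t \<cdot> v)" "Sm f \<cdot> Sm u = Sm (f \<cdot> u)"
    "Sm g \<cdot> Sm v = Sm (g \<cdot> v)"
    using u(1,2) s(2) t(2) sa ta by simp_all
  then have "Sm s \<cdot> Sm u \<in> den (Sh D) (Sh X)" "Sm s \<cdot> Sm u = Sm t \<cdot> Sm v" "Sm f \<cdot> Sm u = Sm g \<cdot> Sm v"
    using den_shift[OF u(3)] u(4,5) by simp_all
  then show ?thesis
    using rel_iff[OF den_shift[OF s(1)] shift.map_arr[OF s(2)] den_shift[OF t(1)] shift.map_arr[OF t(2)]]
      shift.map_arr[OF u(1)] shift.map_arr[OF u(2)] by blast
qed

lemma shift_cls:
  assumes s: "s \<in> den A X" "arr f A Y"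
  shows "ShiftM V (cls X Y (s, f)) = cls (Sh X) (Sh Y) (Sm s, Sm f)"
proof -
  have o: "X \<in> Obj C" "Y \<in> Obj C" "A \<in> Obj C" using s den_arr arr_objs by blast+
  show ?thesis
    unfolding verdier_ops(5)
  proof (intro subset_antisym subsetI)
    fix r assume "r \<in> verdier_shift C S (cls X Y (s, f))"
    then obtain X1 Y1 t g where
      o1: "X1 \<in> Obj C" "Y1 \<in> Obj C" and m: "(t, g) \<in> cls X Y (s, f)" and
      h: "(t, g) \<in> roofs C S X1 Y1" and r: "r \<in> cls (Sh X1) (Sh Y1) (Sm t, Sm g)"
      unfolding verdier_shift_def by blast
    obtain B1 where B1: "t \<in> den B1 X1" "arr g B1 Y1" using h o1 roof_iff by blast
    note m1 = cls_memD[OF m o(2)]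
    obtain B where B: "t \<in> den B X" "arr g B Y" using m1(2) by blast
    have eq: "X1 = X" "Y1 = Y" using B B1 den_arr arr_unique by metis+
    show "r \<in> cls (Sh X) (Sh Y) (Sm s, Sm f)"
      using cls_eqI[OF rel_shift[OF m1(1) s B]] o r eq by simp
  next
    fix r assume "r \<in> cls (Sh X) (Sh Y) (Sm s, Sm f)"
    then show "r \<in> verdier_shift C S (cls X Y (s, f))"
      unfolding verdier_shift_def using o cls_self[OF s] roof_iff s by blast
  qed
qed

lemma verdier_shift_functor: "is_functor V V Sh (ShiftM V)"
proof (rule is_functorI)
  fix X assume "X \<in> Obj V"
  then have X: "X \<in> Obj C" by simp
  show "Sh X \<in> Obj V" using X by simp
  have "ShiftM V (loc (Ident C X)) = cls (Sh X) (Sh X) (Ident C (Sh X), Ident C (Sh X))"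
    unfolding loc_cls[OF ident_arr[OF X]] using shift_cls[OF den_ident[OF X] ident_arr[OF X]] X by simp
  also have "\<dots> = Ident V (Sh X)" using loc_cls[OF ident_arr[OF shift.obj_map[OF X]]] verdier_ops(2) by metis
  finally show "ShiftM V (Ident V X) = Ident V (Sh X)" using X by simp
next
  fix X Y c assume o: "X \<in> Obj V" "Y \<in> Obj V" and c: "c \<in> Hom V X Y"
  obtain A s f where s: "s \<in> den A X" "arr f A Y" "c = cls X Y (s, f)"
    using hom_cls[OF c] o[unfolded verdier_fields] by blast
  show "ShiftM V c \<in> Hom V (Sh X) (Sh Y)"
    unfolding s(3) shift_cls[OF s(1,2)] by (rule cls_hom[OF den_shift[OF s(1)] shift.map_arr[OF s(2)]])
next
  fix X Y Z c d assume "X \<in> Obj V" "Y \<in> Obj V" "Z \<in> Obj V" "c \<in> Hom V X Y" "d \<in> Hom V Y Z"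
  then obtain A B D s f t g t' f' where s: "s \<in> den A X" "arr f A Y" and t: "t \<in> den B Y" "arr g B Z"
    and sq: "t' \<in> den D A" "arr f' D B" "f \<cdot> t' = t \<cdot> f'"
    and c: "c = cls X Y (s, f)" and d: "d = cls Y Z (t, g)"
    and cd: "Cmp V d c = cls X Z (s \<cdot> t', g \<cdot> f')"
    using cmp_ex[of c X Y d Z] by auto
  note ty = den_arr[OF s(1)] s(2) den_arr[OF t(1)] t(2) den_arr[OF sq(1)] sq(2)
  have e: "Sm f \<cdot> Sm t' = Sm (f \<cdot> t')" "Sm t \<cdot> Sm f' = Sm (t \<cdot> f')"
    "Sm (s \<cdot> t') = Sm s \<cdot> Sm t'" "Sm (g \<cdot> f') = Sm g \<cdot> Sm f'" using ty by simp_all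
  have "Cmp V (ShiftM V d) (ShiftM V c) = cls (Sh X) (Sh Z) (Sm s \<cdot> Sm t', Sm g \<cdot> Sm f')"
    unfolding c d shift_cls[OF s] shift_cls[OF t]
    by (rule cmp_cls[OF den_shift[OF s(1)] shift.map_arr[OF s(2)] den_shift[OF t(1)]
      shift.map_arr[OF t(2)] den_shift[OF sq(1)] shift.map_arr[OF sq(2)]]) (use e sq(3) in simp)
  also have "\<dots> = ShiftM V (Cmp V d c)"
    unfolding cd using shift_cls[OF den_cmp[OF sq(1) s(1)] cmp_arr[OF sq(2) t(2)]] e by simp
  finally show "ShiftM V (Cmp V d c) = Cmp V (ShiftM V d) (ShiftM V c)" by simp
qed

sublocale Vshift: functor_pair V V Sh "ShiftM V"
  by unfold_locales (rule verdier_shift_functor)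

lemma shift_loc: "arr f X Y \<Longrightarrow> ShiftM V (loc f) = loc (Sm f)"
proof -
  assume f: "arr f X Y"
  then have X: "X \<in> Obj C" by simp
  show ?thesis
    unfolding loc_cls[OF f] loc_cls[OF shift.map_arr[OF f]]
    using shift_cls[OF den_ident[OF X] f] X by simp
qed

text \<open>Triangles of the quotient are defined through isomorphisms with images of triangles, so
  such isomorphisms have to be inverted and pasted; the category axioms and functoriality of the
  shift suffice for this.\<close>

lemma tri_iso_sym:
  assumes "tri_iso V (X, Y, Z, f, g, h) (X', Y', Z', f', g', h')"
    "V.arr f X Y" "V.arr g Y Z" "V.arr h Z (Sh X)" "V.arr f' X' Y'" "V.arr g' Y' Z'" "V.arr h' Z' (Sh X')"
  shows "tri_iso V (X', Y', Z', f', g', h') (X, Y, Z, f, g, h)"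
proof -
  have o: "X \<in> Obj V" "Y \<in> Obj V" "Z \<in> Obj V" "X' \<in> Obj V" "Y' \<in> Obj V" "Z' \<in> Obj V"
    using assms(2-7) V.arr_objs by blast+
  obtain a b c where iso: "is_iso V X X' a" "is_iso V Y Y' b" "is_iso V Z Z' c"
    and sq: "Cmp V b f = Cmp V f' a" "Cmp V c g = Cmp V g' b" "Cmp V (ShiftM V a) h = Cmp V h' c"
    using assms(1) unfolding tri_iso.simps tri_hom.simps by blast
  obtain a' where a': "is_iso V X' X a'" "Cmp V a' a = Ident V X" "Cmp V a a' = Ident V X'"
    using V.iso_inverse[OF iso(1) o(1,4)] by blast
  obtain b' where b': "is_iso V Y' Y b'" "Cmp V b' b = Ident V Y" "Cmp V b b' = Ident V Y'"
    using V.iso_inverse[OF iso(2) o(2,5)] by blast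
  obtain c' where c': "is_iso V Z' Z c'" "Cmp V c' c = Ident V Z" "Cmp V c c' = Ident V Z'"
    using V.iso_inverse[OF iso(3) o(3,6)] by blast
  have ty: "V.arr a X X'" "V.arr b Y Y'" "V.arr c Z Z'" "V.arr a' X' X" "V.arr b' Y' Y" "V.arr c' Z' Z"
    using V.is_isoD iso a' b' c' o by metis+
  \<comment> \<open>One commuting square with its two vertical maps replaced by inverses; it serves
    all three squares.\<close>
  have swap: "Cmp V g1 r' = Cmp V q' g2"
    if "Cmp V q g1 = Cmp V g2 r" "V.arr g1 A B" "V.arr g2 A' B'" "V.arr q B B'" "V.arr r A A'"
      "V.arr q' B' B" "V.arr r' A' A" "Cmp V q' q = Ident V B" "Cmp V r r' = Ident V A'"
    for g1 g2 q r q' r' A B A' B'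
  proof -
    have "Cmp V q' (Cmp V (Cmp V q g1) r') = Cmp V q' (Cmp V (Cmp V g2 r) r')" using that(1) by simp
    then show ?thesis using that(2-9) V.cmp_pre[OF that(8)] by simp
  qed
  have sa: "Cmp V (ShiftM V a') (ShiftM V a) = Ident V (Sh X)"
    using Vshift.map_cmp[of a a'] a' ty by simp
  have "tri_hom V (X', Y', Z', f', g', h') (X, Y, Z, f, g, h) a' b' c'"
    unfolding tri_hom.simps
    using swap[OF sq(1) assms(2,5) ty(2,1,5,4) b'(2) a'(3)]
      swap[OF sq(2) assms(3,6) ty(3,2,6,5) c'(2) b'(3)]
      swap[OF sq(3) assms(4,7) Vshift.map_arr[OF ty(1)] ty(3) Vshift.map_arr[OF ty(4)] ty(6) sa c'(3)]
      V.arr_hom[OF ty(4)] V.arr_hom[OF ty(5)] V.arr_hom[OF ty(6)]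
    by metis
  then show ?thesis unfolding tri_iso.simps using a' b' c' by blast
qed

lemma tri_iso_trans:
  assumes "tri_iso V (X, Y, Z, f, g, h) (X', Y', Z', f', g', h')"
    "tri_iso V (X', Y', Z', f', g', h') (X'', Y'', Z'', f'', g'', h'')"
    "V.arr f X Y" "V.arr g Y Z" "V.arr h Z (Sh X)" "V.arr f' X' Y'" "V.arr g' Y' Z'" "V.arr h' Z' (Sh X')"
    "V.arr f'' X'' Y''" "V.arr g'' Y'' Z''" "V.arr h'' Z'' (Sh X'')"
  shows "tri_iso V (X, Y, Z, f, g, h) (X'', Y'', Z'', f'', g'', h'')"
proof -
  have o: "X \<in> Obj V" "Y \<in> Obj V" "Z \<in> Obj V" "X' \<in> Obj V" "Y' \<in> Obj V" "Z' \<in> Obj V"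
    "X'' \<in> Obj V" "Y'' \<in> Obj V" "Z'' \<in> Obj V"
    using assms(3-11) V.arr_objs by blast+
  obtain a b c where iso: "is_iso V X X' a" "is_iso V Y Y' b" "is_iso V Z Z' c"
    and sq: "Cmp V b f = Cmp V f' a" "Cmp V c g = Cmp V g' b" "Cmp V (ShiftM V a) h = Cmp V h' c"
    using assms(1) unfolding tri_iso.simps tri_hom.simps by blast
  obtain a' b' c' where iso': "is_iso V X' X'' a'" "is_iso V Y' Y'' b'" "is_iso V Z' Z'' c'"
    and sq': "Cmp V b' f' = Cmp V f'' a'" "Cmp V c' g' = Cmp V g'' b'"
      "Cmp V (ShiftM V a') h' = Cmp V h'' c'"
    using assms(2) unfolding tri_iso.simps tri_hom.simps by blast
  note co = V.iso_cmp[OF iso(1) iso'(1) o(1,4,7)] V.iso_cmp[OF iso(2) iso'(2) o(2,5,8)]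
    V.iso_cmp[OF iso(3) iso'(3) o(3,6,9)]
  have ty: "V.arr a X X'" "V.arr b Y Y'" "V.arr c Z Z'" "V.arr a' X' X''" "V.arr b' Y' Y''" "V.arr c' Z' Z''"
    using V.is_isoD iso iso' o by metis+
  have paste: "Cmp V (Cmp V q' q) g1 = Cmp V g3 (Cmp V r' r)"
    if "Cmp V q g1 = Cmp V g2 r" "Cmp V q' g2 = Cmp V g3 r'" "V.arr g1 A1 B1" "V.arr g2 A2 B2"
      "V.arr g3 A3 B3" "V.arr q B1 B2" "V.arr r A1 A2" "V.arr q' B2 B3" "V.arr r' A2 A3"
    for g1 g2 g3 q r q' r' A1 A2 A3 B1 B2 B3
    using that V.cmp_pre[OF that(2)] by simp
  have sa: "ShiftM V (Cmp V a' a) = Cmp V (ShiftM V a') (ShiftM V a)" using ty by simp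
  have "tri_hom V (X, Y, Z, f, g, h) (X'', Y'', Z'', f'', g'', h'') (Cmp V a' a) (Cmp V b' b) (Cmp V c' c)"
    unfolding tri_hom.simps sa
    using paste[OF sq(1) sq'(1) assms(3,6,9) ty(2,1,5,4)] paste[OF sq(2) sq'(2) assms(4,7,10) ty(3,2,6,5)]
      paste[OF sq(3) sq'(3) assms(5,8,11) Vshift.map_arr[OF ty(1)] ty(3) Vshift.map_arr[OF ty(4)] ty(6)]
      co unfolding is_iso_def by blast
  then show ?thesis unfolding tri_iso.simps using co by blast
qed

lemma loc_tri_arr:
  assumes "(X, Y, Z, f, g, h) \<in> Tri C"
  shows "V.arr (loc f) X Y" "V.arr (loc g) Y Z" "V.arr (loc h) Z (Sh X)"
  using tri_arr[OF assms] loc_arr by blast+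

text \<open>\<open>third_den\<close> supplies a denominator on the third term, and all three become
  invertible.\<close>

lemma den_link:
  assumes t: "(X, Y, Z, f, g, h) \<in> Tri C" and t': "(X', Y', Z', f', g', h') \<in> Tri C"
    and a: "a \<in> den X X'" and b: "b \<in> den Y Y'" and eq: "b \<cdot> f = f' \<cdot> a"
  shows "tri_iso V (X, Y, Z, loc f, loc g, loc h) (X', Y', Z', loc f', loc g', loc h')"
proof -
  obtain c where c: "c \<in> den Z Z'" "c \<cdot> g = g' \<cdot> b" "Sm a \<cdot> h = h' \<cdot> c"
    using third_den[OF t t' a b eq] by blast
  note ty = tri_arr[OF t] tri_arr[OF t'] den_arr[OF a] den_arr[OF b] den_arr[OF c(1)]
  have m: "Cmp V (loc y) (loc x) = loc (y \<cdot> x)" if "arr x A B" "arr y B D" for x y A B D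
    using that by simp
  have "Cmp V (loc b) (loc f) = Cmp V (loc f') (loc a)" "Cmp V (loc c) (loc g) = Cmp V (loc g') (loc b)"
    "Cmp V (ShiftM V (loc a)) (loc h) = Cmp V (loc h') (loc c)"
    using m[OF ty(1) ty(8)] m[OF ty(7) ty(4)] m[OF ty(2) ty(9)] m[OF ty(8) ty(5)]
      m[OF ty(3) shift.map_arr[OF ty(7)]] m[OF ty(9) ty(6)] shift_loc[OF ty(7)] eq c(2,3) by simp_all
  moreover note loc_den_iso[OF a] loc_den_iso[OF b] loc_den_iso[OF c(1)]
  ultimately show ?thesis unfolding tri_iso.simps tri_hom.simps is_iso_def by blast
qed

end

section \<open>Torsion pairs\<close>

context triangulated_category
begin

definition no_hom :: "'o \<Rightarrow> 'o \<Rightarrow> bool" where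
  "no_hom A B \<longleftrightarrow> (\<forall>k. arr k A B \<longrightarrow> k = zero A B)"

lemma no_homD: "no_hom A B \<Longrightarrow> arr k A B \<Longrightarrow> k = zero A B"
  unfolding no_hom_def by blast

lemma hom_zero_iff:
  assumes "A \<subseteq> Obj C" "B \<subseteq> Obj C"
  shows "hom_zero C A B \<longleftrightarrow> (\<forall>a\<in>A. \<forall>b\<in>B. no_hom a b)"
proof -
  have "Hom C a b = {zero a b} \<longleftrightarrow> no_hom a b" if "a \<in> Obj C" "b \<in> Obj C" for a b
  proof -
    have "arr (zero a b) a b" using that by simp
    then have "zero a b \<in> Hom C a b" by (rule arr_hom)
    then show ?thesis unfolding no_hom_def using hom_arr[OF that] by blast
  qed
  then show ?thesis unfolding hom_zero_def using assms by (meson subsetD)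
qed

lemma no_hom_shift:
  assumes "A \<in> Obj C" "B \<in> Obj C"
  shows "no_hom (Sh A) (Sh B) \<longleftrightarrow> no_hom A B"
proof
  assume *: "no_hom (Sh A) (Sh B)"
  show "no_hom A B"
    unfolding no_hom_def
  proof (intro allI impI)
    fix k assume k: "arr k A B"
    show "k = zero A B"
      using shift_reflects_zero[OF k no_homD[OF * shift.map_arr[OF k]]] .
  qed
next
  assume *: "no_hom A B"
  show "no_hom (Sh A) (Sh B)"
    unfolding no_hom_def
  proof (intro allI impI)
    fix k assume k: "arr k (Sh A) (Sh B)"
    then obtain m where m: "arr m A B" "Sm m = k" using shift_full assms by blast
    then show "k = zero (Sh A) (Sh B)" using no_homD[OF * m(1)] shift_zero[OF assms] by simp
  qed
qed

lemma no_hom_iso_left: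
  assumes "is_iso C A A' e" "A \<in> Obj C" "A' \<in> Obj C" "no_hom A B"
  shows "no_hom A' B"
  unfolding no_hom_def
proof (intro allI impI)
  fix k assume k: "arr k A' B"
  obtain d where d: "arr e A A'" "arr d A' A" "e \<cdot> d = Ident C A'" using is_isoD[OF assms(1-3)] by blast
  have "k = (k \<cdot> e) \<cdot> d" using k d by simp
  moreover have "k \<cdot> e = zero A B" using no_homD[OF assms(4)] cmp_arr[OF d(1) k] by blast
  ultimately have "k = zero A B \<cdot> d" by metis
  also have "\<dots> = zero A' B" using k d by simp
  finally show "k = zero A' B" .
qed

lemma no_hom_iso_right:
  assumes "is_iso C B B' e" "B \<in> Obj C" "B' \<in> Obj C" "no_hom A B"
  shows "no_hom A B'"
  unfolding no_hom_def
proof (intro allI impI)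
  fix k assume k: "arr k A B'"
  obtain d where d: "arr e B B'" "arr d B' B" "e \<cdot> d = Ident C B'" using is_isoD[OF assms(1-3)] by blast
  have "k = e \<cdot> (d \<cdot> k)" using k d cmp_pre[OF d(3)] by simp
  moreover have "d \<cdot> k = zero A B" using no_homD[OF assms(4)] cmp_arr[OF k d(2)] by blast
  ultimately have "k = e \<cdot> zero A B" by metis
  also have "\<dots> = zero A B'" using k d by simp
  finally show "k = zero A B'" .
qed

lemma no_hom_mid_left:
  assumes t: "(A, B, E, f, g, h) \<in> Tri C" and "no_hom A W" "no_hom E W"
  shows "no_hom B W"
  unfolding no_hom_def
proof (intro allI impI)
  fix k assume k: "arr k B W"
  note ta = tri_arr[OF t]
  have "k \<cdot> f = zero A W" using no_homD[OF assms(2)] cmp_arr[OF ta(1) k] by blast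
  then obtain l where l: "arr l E W" "k = l \<cdot> g" using coexact_mid[OF t k] by blast
  then show "k = zero B W" using no_homD[OF assms(3) l(1)] ta k by simp
qed

lemma no_hom_mid_right:
  assumes t: "(A, B, E, f, g, h) \<in> Tri C" and "no_hom W A" "no_hom W E"
  shows "no_hom W B"
  unfolding no_hom_def
proof (intro allI impI)
  fix k assume k: "arr k W B"
  note ta = tri_arr[OF t]
  have "g \<cdot> k = zero W E" using no_homD[OF assms(3)] cmp_arr[OF k ta(2)] by blast
  then obtain l where l: "arr l W A" "k = f \<cdot> l" using exact_mid[OF t k] by blast
  then show "k = zero W B" using no_homD[OF assms(2) l(1)] ta k by simp
qed

lemma biproduct_no_hom:
  assumes bp: "biproduct C A B D i j p q" and o: "A \<in> Obj C" "B \<in> Obj C"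
  shows "no_hom W A \<Longrightarrow> no_hom W B \<Longrightarrow> no_hom W D"
    and "no_hom A W \<Longrightarrow> no_hom B W \<Longrightarrow> no_hom D W"
proof -
  note b = biproduct_arr[OF bp o]
  have D: "D \<in> Obj C" using b(1) by simp
  show "no_hom W D" if "no_hom W A" "no_hom W B"
    unfolding no_hom_def
  proof (intro allI impI)
    fix k assume k: "arr k W D"
    have z: "p \<cdot> k = zero W A" "q \<cdot> k = zero W B"
      using no_homD[OF that(1) cmp_arr[OF k b(3)]] no_homD[OF that(2) cmp_arr[OF k b(4)]] by simp_all
    have "k = add (i \<cdot> p) (j \<cdot> q) \<cdot> k" using b(9) k by simp
    also have "\<dots> = add (i \<cdot> (p \<cdot> k)) (j \<cdot> (q \<cdot> k))" using b(1-4) k by simp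
    also have "\<dots> = zero W D" unfolding z using b(1-4) k by simp
    finally show "k = zero W D" .
  qed
  show "no_hom D W" if "no_hom A W" "no_hom B W"
    unfolding no_hom_def
  proof (intro allI impI)
    fix k assume k: "arr k D W"
    have z: "k \<cdot> i = zero A W" "k \<cdot> j = zero B W"
      using no_homD[OF that(1) cmp_arr[OF b(1) k]] no_homD[OF that(2) cmp_arr[OF b(2) k]] by simp_all
    have "k = k \<cdot> add (i \<cdot> p) (j \<cdot> q)" using b(9) k by simp
    also have "\<dots> = add ((k \<cdot> i) \<cdot> p) ((k \<cdot> j) \<cdot> q)" using b(1-4) k by simp
    also have "\<dots> = zero D W" unfolding z using b(1-4) k by simp
    finally show "k = zero D W" .
  qed
qed

end

lemma full_sub_fields [simp]:
  "Obj (full_sub T S) = S" "Hom (full_sub T S) = Hom T" "Zero (full_sub T S) = Zero T"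
  "Ident (full_sub T S) = Ident T" "Cmp (full_sub T S) = Cmp T" "Shift (full_sub T S) = Shift T"
  by (simp_all add: full_sub_def)

lemma full_sub_hom_zero [simp]: "hom_zero (full_sub T S) A B \<longleftrightarrow> hom_zero T A B"
  by (simp add: hom_zero_def)

locale silting_reduction = thick_subcategory C S
  for C :: "('o, 'm, 'x) tcat_scheme" (structure) and S +
  fixes XX YY :: "'o set"
  assumes co_t: "co_t_structure (full_sub C S) XX YY"
    and torsion_X: "torsion_pair C XX (right_perp C XX)"
    and torsion_Y: "torsion_pair C (left_perp C YY) YY"
begin

definition "ZZ = right_perp C XX \<inter> left_perp C (shifted C YY)"
definition "PP = shifted C XX \<inter> YY"

lemma co_t_decomposition: "perp_decomposition (full_sub C S) [XX, YY]"
  and XX_shifted: "XX \<subseteq> shifted (full_sub C S) XX"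
  using co_t unfolding co_t_structure_def torsion_pair_def by blast+

lemma torsion_decomposition:
  "perp_decomposition C [XX, right_perp C XX]" "perp_decomposition C [left_perp C YY, YY]"
  using torsion_X torsion_Y unfolding torsion_pair_def by blast+

lemma XX_S: "XX \<subseteq> S" and YY_S: "YY \<subseteq> S"
  using co_t_decomposition unfolding perp_decomposition_def by auto

lemma XX_obj: "X \<in> XX \<Longrightarrow> X \<in> Obj C" and YY_obj: "Y \<in> YY \<Longrightarrow> Y \<in> Obj C"
  using XX_S YY_S S_obj by blast+

lemma no_hom_XY: "X \<in> XX \<Longrightarrow> Y \<in> YY \<Longrightarrow> no_hom X Y"
proof -
  have "hom_zero C XX YY"
    using co_t_decomposition unfolding perp_decomposition_def by simp
  then show "X \<in> XX \<Longrightarrow> Y \<in> YY \<Longrightarrow> no_hom X Y"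
    using hom_zero_iff[of XX YY] XX_obj YY_obj by blast
qed

lemma S_decomposition:
  assumes "E \<in> S"
  shows "\<exists>X\<in>XX. \<exists>Y\<in>YY. \<exists>f g h. (X, E, Y, f, g, h) \<in> Tri C"
proof -
  have "E \<in> star (full_sub C S) XX YY"
    using assms co_t_decomposition unfolding perp_decomposition_def by simp
  then show ?thesis unfolding star_def full_sub_def by fastforce
qed

text \<open>The perpendicular is formed inside \<open>S\<close>. Hence membership in
  \<open>XX\<close> amounts to membership in \<open>S\<close> and a vanishing condition, and that is
  how it is established later.\<close>

lemma XX_iff: "A \<in> XX \<longleftrightarrow> A \<in> S \<and> (\<forall>Y\<in>YY. no_hom A Y)"
proof -
  have "XX = left_perp (full_sub C S) YY"
    using co_t unfolding co_t_structure_def torsion_pair_def by blast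
  then have "A \<in> XX \<longleftrightarrow> A \<in> S \<and> hom_zero C {A} YY" unfolding left_perp_def by simp
  then show ?thesis using hom_zero_iff[of "{A}" YY] S_obj YY_obj by blast
qed

lemma YY_iff: "A \<in> YY \<longleftrightarrow> A \<in> S \<and> (\<forall>X\<in>XX. no_hom X A)"
proof -
  have "YY = right_perp (full_sub C S) XX"
    using co_t unfolding co_t_structure_def torsion_pair_def by blast
  then have "A \<in> YY \<longleftrightarrow> A \<in> S \<and> hom_zero C XX {A}" unfolding right_perp_def by simp
  then show ?thesis using hom_zero_iff[of XX "{A}"] S_obj XX_obj by blast
qed

lemma XX_unshift: "A \<in> XX \<Longrightarrow> \<exists>B\<in>XX. \<exists>e. is_iso C (Sh B) A e"
  using XX_shifted unfolding shifted_def by (auto simp: isomorphic_def is_iso_def)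

lemma shifted_iff: "A \<in> shifted C W \<longleftrightarrow> A \<in> Obj C \<and> (\<exists>B\<in>W. \<exists>e. is_iso C (Sh B) A e)"
  unfolding shifted_def isomorphic_def by blast

lemma shift_in_shifted: "Y \<in> YY \<Longrightarrow> Sh Y \<in> shifted C YY"
  unfolding shifted_iff using YY_obj iso_ident shift.obj_map by blast

section \<open>Perpendicularity of single objects, and its behaviour under the shift\<close>

definition X_perp :: "'o \<Rightarrow> bool" where
  "X_perp M \<longleftrightarrow> M \<in> Obj C \<and> (\<forall>X\<in>XX. no_hom X M)"

definition perp_Y :: "'o \<Rightarrow> bool" where
  "perp_Y M \<longleftrightarrow> M \<in> Obj C \<and> (\<forall>Y\<in>YY. no_hom M Y)"

text \<open>Only the objects \<open>Sh Y\<close> are tested, while \<open>shifted C YY\<close> is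
  closed under isomorphism; \<open>perp_Y1_iff\<close> shows that this makes no difference.\<close>

definition perp_Y1 :: "'o \<Rightarrow> bool" where
  "perp_Y1 M \<longleftrightarrow> M \<in> Obj C \<and> (\<forall>Y\<in>YY. no_hom M (Sh Y))"

lemma X_perp_iff: "M \<in> right_perp C XX \<longleftrightarrow> X_perp M"
  unfolding X_perp_def right_perp_def using hom_zero_iff[of XX "{M}"] XX_obj by blast

lemma perp_Y_iff: "M \<in> left_perp C YY \<longleftrightarrow> perp_Y M"
  unfolding perp_Y_def left_perp_def using hom_zero_iff[of "{M}" YY] YY_obj by blast

lemma perp_Y1_iff: "M \<in> left_perp C (shifted C YY) \<longleftrightarrow> perp_Y1 M"
proof -
  have "M \<in> left_perp C (shifted C YY) \<longleftrightarrow> M \<in> Obj C \<and> (\<forall>A\<in>shifted C YY. no_hom M A)"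
    unfolding left_perp_def using hom_zero_iff[of "{M}" "shifted C YY"] shifted_iff by blast
  moreover note shift_in_shifted
  moreover have "no_hom M A" if "A \<in> shifted C YY" "perp_Y1 M" for A
    using that no_hom_iso_right YY_obj shift.obj_map unfolding shifted_iff perp_Y1_def by blast
  ultimately show ?thesis unfolding perp_Y1_def by blast
qed

lemma ZZ_iff: "M \<in> ZZ \<longleftrightarrow> X_perp M \<and> perp_Y1 M"
  unfolding ZZ_def using X_perp_iff perp_Y1_iff by blast

lemma ZZ_obj: "M \<in> ZZ \<Longrightarrow> M \<in> Obj C"
  unfolding ZZ_iff X_perp_def by blast

lemma decomposition_X:
  assumes "A \<in> Obj C"
  shows "\<exists>X\<in>XX. \<exists>B f g h. X_perp B \<and> (X, A, B, f, g, h) \<in> Tri C"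
proof -
  have "A \<in> star C XX (right_perp C XX)"
    using assms torsion_decomposition(1) unfolding perp_decomposition_def by simp
  then show ?thesis unfolding star_def using X_perp_iff by blast
qed

lemma decomposition_Y:
  assumes "A \<in> Obj C"
  shows "\<exists>B. \<exists>Y\<in>YY. \<exists>f g h. perp_Y B \<and> (B, A, Y, f, g, h) \<in> Tri C"
proof -
  have "A \<in> star C (left_perp C YY) YY"
    using assms torsion_decomposition(2) unfolding perp_decomposition_def by simp
  then show ?thesis unfolding star_def using perp_Y_iff by blast
qed

text \<open>The co-t-structure allows X to be written as B[1] with B in \<open>XX\<close>, which
  reduces the claim to Hom(B, M) = 0.\<close>

lemma X_perp_shift:
  assumes "X_perp M" "X \<in> XX"
  shows "no_hom X (Sh M)"
proof -
  obtain B e where B: "B \<in> XX" "is_iso C (Sh B) X e" using XX_unshift assms(2) by blast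
  have "no_hom (Sh B) (Sh M)" using no_hom_shift[of B M] assms B(1) XX_obj X_perp_def by blast
  then show ?thesis using no_hom_iso_left[OF B(2)] XX_obj assms(2) B(1) shift.obj_map by blast
qed

lemma YY_shift:
  assumes "Y \<in> YY" shows "Sh Y \<in> YY"
proof -
  have "X_perp Y" unfolding X_perp_def using assms YY_obj no_hom_XY by blast
  then have "\<forall>X\<in>XX. no_hom X (Sh Y)" using X_perp_shift by blast
  moreover have "Sh Y \<in> S" using S_shift[OF YY_obj[OF assms]] YY_S assms by blast
  ultimately show ?thesis using YY_iff by blast
qed

text \<open>Desuspended, the hypothesis says that the object of \<open>S\<close> has no maps to
  \<open>YY\<close>, which characterises \<open>XX\<close> inside \<open>S\<close>.\<close>

lemma S_perp_Y1:
  assumes "M \<in> S" "perp_Y1 M" shows "M \<in> shifted C XX"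
proof -
  have M: "M \<in> Obj C" using S_obj assms by blast
  obtain B e where B: "B \<in> Obj C" "is_iso C (Sh B) M e" using shift_dense M by blast
  obtain d where d: "is_iso C M (Sh B) d" using iso_inverse[OF B(2)] B(1) M shift.obj_map by blast
  have "B \<in> S" using S_iso[OF B(2)] S_shift[OF B(1)] B(1) M assms(1) shift.obj_map by blast
  moreover have "no_hom B Y" if "Y \<in> YY" for Y
  proof -
    have "no_hom (Sh B) (Sh Y)"
      using no_hom_iso_left[OF d M shift.obj_map[OF B(1)]] assms(2) that unfolding perp_Y1_def by blast
    then show ?thesis using no_hom_shift B(1) YY_obj that by blast
  qed
  ultimately show ?thesis unfolding shifted_iff using XX_iff B(2) M by blast
qed

text \<open>Desuspending gives Hom(B, M) = 0. Applied to P in \<open>PP\<close> and M in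
  \<open>ZZ\<close>, this is the vanishing that controls the functor <1>.\<close>

lemma shifted_XX_no_hom:
  assumes "P \<in> shifted C XX" "X_perp M" shows "no_hom P (Sh M)"
proof -
  obtain B e where B: "B \<in> XX" "is_iso C (Sh B) P e" "P \<in> Obj C" using assms(1) shifted_iff by blast
  have "no_hom (Sh B) (Sh M)" using no_hom_shift[of B M] assms B(1) XX_obj X_perp_def by blast
  then show ?thesis using no_hom_iso_left[OF B(2)] XX_obj B shift.obj_map by blast
qed

lemma YY_X_perp: "Y \<in> YY \<Longrightarrow> X_perp Y"
  unfolding X_perp_def using YY_obj no_hom_XY by blast

lemma shifted_XX_perp_Y1: "P \<in> shifted C XX \<Longrightarrow> perp_Y1 P"
  unfolding perp_Y1_def using shifted_XX_no_hom YY_X_perp shifted_iff by blast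

text \<open>Membership in \<open>shifted C XX\<close> is traded for a vanishing condition that
  passes to extensions; the objects of \<open>PP\<close> constructed below are recognised in this
  way.\<close>

lemma PP_I: "P \<in> YY \<Longrightarrow> perp_Y1 P \<Longrightarrow> P \<in> PP"
  unfolding PP_def using S_perp_Y1 YY_S by blast

lemma PP_YY: "P \<in> PP \<Longrightarrow> P \<in> YY" and PP_shifted: "P \<in> PP \<Longrightarrow> P \<in> shifted C XX"
  unfolding PP_def by blast+

lemma PP_S: "P \<in> PP \<Longrightarrow> P \<in> S" and PP_obj: "P \<in> PP \<Longrightarrow> P \<in> Obj C"
  using PP_YY YY_S YY_obj by blast+

lemma PP_ZZ: "P \<in> PP \<Longrightarrow> P \<in> ZZ"
  unfolding ZZ_iff using YY_X_perp shifted_XX_perp_Y1 PP_YY PP_shifted by blast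

lemma decomposition_XZY:
  assumes A: "A \<in> Obj C"
  shows "\<exists>X\<in>XX. \<exists>B f g h. (X, A, B, f, g, h) \<in> Tri C \<and>
    (\<exists>M\<in>ZZ. \<exists>Y\<in>YY. \<exists>f g h. (M, B, Sh Y, f, g, h) \<in> Tri C)"
proof -
  obtain X B f g h where X: "X \<in> XX" "X_perp B" "(X, A, B, f, g, h) \<in> Tri C"
    using decomposition_X[OF A] by blast
  have Bo: "B \<in> Obj C" using X(2) X_perp_def by blast
  \<comment> \<open>The second torsion pair is applied to a desuspension of B and the resulting
    triangle is shifted, so that its last term becomes Y[1].\<close>
  obtain B' e where B': "B' \<in> Obj C" "is_iso C (Sh B') B e" using shift_dense[OF Bo] by blast
  obtain D Y u v w where D: "Y \<in> YY" "perp_Y D" "(D, B', Y, u, v, w) \<in> Tri C"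
    using decomposition_Y[OF B'(1)] by blast
  note ta = tri_arr[OF D(3)]
  have o: "D \<in> Obj C" "Y \<in> Obj C" "Sh D \<in> Obj C" "Sh Y \<in> Obj C" using ta by simp_all
  obtain d where d: "arr e (Sh B') B" "arr d B (Sh B')" "d \<cdot> e = Ident C (Sh B')" "e \<cdot> d = Ident C B"
    using is_isoD[OF B'(2) shift.obj_map[OF B'(1)] Bo] by blast
  have t: "(Sh D, B, Sh Y, e \<cdot> Sm u, Sm v \<cdot> d, opp (Sm w)) \<in> Tri C"
    by (rule tri_transfer[OF tri_shift[OF D(3)] _ _ _ iso_ident[OF o(3)] B'(2) iso_ident[OF o(4)]])
      (use ta d o B' in simp_all)
  have "perp_Y1 (Sh D)"
    unfolding perp_Y1_def using D(2) no_hom_shift o YY_obj unfolding perp_Y_def by blast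
  \<comment> \<open>A map from X' to D[1] vanishes in B'[1], hence comes from a map to Y along
    \<open>w\<close>, and Hom(X', Y) = 0.\<close>
  moreover have "no_hom X' (Sh D)" if X': "X' \<in> XX" for X'
    unfolding no_hom_def
  proof (intro allI impI)
    fix k assume k: "arr k X' (Sh D)"
    have "no_hom X' (Sh B')"
    proof -
      obtain e' where "is_iso C B (Sh B') e'" using iso_inverse[OF B'(2) shift.obj_map[OF B'(1)] Bo] by blast
      then show ?thesis using no_hom_iso_right Bo B'(1) X(2) X' unfolding X_perp_def by simp
    qed
    moreover have "arr (Sm u \<cdot> k) X' (Sh B')" using k ta by simp
    ultimately have "Sm u \<cdot> k = zero X' (Sh B')" using no_homD by blast
    then obtain l where l: "arr l X' Y" "k = w \<cdot> l" using exact_shift[OF D(3) k] by blast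
    then have "l = zero X' Y" using no_homD no_hom_XY[OF X' D(1)] by blast
    then show "k = zero X' (Sh D)" using l ta k by simp
  qed
  ultimately have "Sh D \<in> ZZ" unfolding ZZ_iff X_perp_def using o by blast
  then show ?thesis using X t D(1) by blast
qed

text \<open>The right perpendicular of \<open>XX\<close> is closed under extensions and contains
  both ends, since Y[1] again lies in \<open>YY\<close>.\<close>

lemma star_ZZ_X_perp: "A \<in> star C ZZ (shifted C YY) \<Longrightarrow> X_perp A"
proof -
  assume "A \<in> star C ZZ (shifted C YY)"
  then obtain M Y f g h where *: "A \<in> Obj C" "M \<in> ZZ" "Y \<in> shifted C YY" "(M, A, Y, f, g, h) \<in> Tri C"
    unfolding star_def by blast
  have "no_hom X A" if X: "X \<in> XX" for X
  proof (rule no_hom_mid_right[OF *(4)])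
    show "no_hom X M" using *(2) X unfolding ZZ_iff X_perp_def by blast
    obtain Y' e where "Y' \<in> YY" "is_iso C (Sh Y') Y e" "Y \<in> Obj C" using *(3) shifted_iff by blast
    then show "no_hom X Y" using no_hom_iso_right no_hom_XY[OF X YY_shift] YY_obj shift.obj_map by metis
  qed
  then show "X_perp A" unfolding X_perp_def using *(1) by blast
qed

text \<open>The iterated notation demands vanishing from \<open>XX\<close> into the whole of
  \<open>star C ZZ (shifted C YY)\<close>, not only into its two pieces; this is
  \<open>star_ZZ_X_perp\<close>.\<close>

theorem perp_decomposition_XZY: "perp_decomposition C [XX, ZZ, shifted C YY]"
proof -
  have sub: "XX \<subseteq> Obj C" "ZZ \<subseteq> Obj C" "shifted C YY \<subseteq> Obj C"
    using XX_obj ZZ_obj shifted_iff by blast+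
  have "star C ZZ (shifted C YY) \<subseteq> Obj C" unfolding star_def by blast
  then have "hom_zero C XX (star C ZZ (shifted C YY))"
    using hom_zero_iff[OF sub(1)] star_ZZ_X_perp unfolding X_perp_def by blast
  moreover have "hom_zero C ZZ (shifted C YY)"
    using hom_zero_iff[OF sub(2,3)] hom_zero_iff[of "{_}", OF _ sub(3)] sub(2)
    unfolding ZZ_def left_perp_def by blast
  moreover have "A \<in> star C XX (star C ZZ (shifted C YY))" if A: "A \<in> Obj C" for A
  proof -
    obtain X B f g h where X: "X \<in> XX" "(X, A, B, f, g, h) \<in> Tri C"
      and B: "\<exists>M\<in>ZZ. \<exists>Y\<in>YY. \<exists>f g h. (M, B, Sh Y, f, g, h) \<in> Tri C"
      using decomposition_XZY[OF A] by blast
    have "B \<in> Obj C" using tri_arr[OF X(2)] by simp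
    moreover note shift_in_shifted
    ultimately have "B \<in> star C ZZ (shifted C YY)" unfolding star_def using B by blast
    then show ?thesis unfolding star_def using A X by blast
  qed
  moreover have "star C XX (star C ZZ (shifted C YY)) \<subseteq> Obj C" unfolding star_def by blast
  ultimately show ?thesis unfolding perp_decomposition_def using sub by auto
qed

section \<open>Approximations and the functor to the Verdier quotient\<close>

text \<open>The approximation is the truncation B -> X -> P for the torsion pair ending in
  \<open>YY\<close>. Maps from X to any object of \<open>YY\<close> vanish on B, hence factor
  through P; and P lies in \<open>PP\<close> because neither X nor B[1] has maps to Y[1].\<close>

lemma ex_approx:
  assumes X: "X \<in> ZZ"
  shows "\<exists>P N i p d. P \<in> PP \<and> (X, P, N, i, p, d) \<in> Tri C \<and>
    (\<forall>Y\<in>YY. \<forall>g. arr g X Y \<longrightarrow> (\<exists>\<phi>. arr \<phi> P Y \<and> g = \<phi> \<cdot> i))"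
proof -
  obtain B P c y e where B: "P \<in> YY" "perp_Y B" "(B, X, P, c, y, e) \<in> Tri C"
    using decomposition_Y[OF ZZ_obj[OF X]] by blast
  note ta = tri_arr[OF B(3)]
  have o: "B \<in> Obj C" "P \<in> Obj C" using ta by simp_all
  have "no_hom P (Sh Y)" if Y: "Y \<in> YY" for Y
  proof (rule no_hom_mid_left[OF tri_rotated[OF B(3)]])
    show "no_hom X (Sh Y)" using X Y unfolding ZZ_iff perp_Y1_def by blast
    show "no_hom (Sh B) (Sh Y)" using B(2) no_hom_shift o YY_obj Y unfolding perp_Y_def by blast
  qed
  then have "P \<in> PP" using PP_I B(1) o unfolding perp_Y1_def by blast
  moreover have "\<exists>\<phi>. arr \<phi> P Y \<and> g = \<phi> \<cdot> y" if Y: "Y \<in> YY" and g: "arr g X Y" for Y g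
  proof -
    have "g \<cdot> c = zero B Y"
      using no_homD[of B Y "g \<cdot> c"] B(2) Y cmp_arr[OF ta(1) g] unfolding perp_Y_def by blast
    then show ?thesis using coexact_mid[OF B(3) g] by blast
  qed
  ultimately show ?thesis using tri_rotated[OF B(3)] by blast
qed

lemma left_approxD:
  assumes "left_approx C PP X P i" "X \<in> Obj C"
  shows "P \<in> PP" "arr i X P" "\<lbrakk>P' \<in> PP; arr g X P'\<rbrakk> \<Longrightarrow> \<exists>\<phi>. arr \<phi> P P' \<and> g = \<phi> \<cdot> i"
proof -
  show P: "P \<in> PP" using assms unfolding left_approx_def by blast
  show "arr i X P" using assms PP_obj[OF P] hom_arr unfolding left_approx_def by blast
  show "\<lbrakk>P' \<in> PP; arr g X P'\<rbrakk> \<Longrightarrow> \<exists>\<phi>. arr \<phi> P P' \<and> g = \<phi> \<cdot> i"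
    using assms(1) arr_hom hom_arr PP_obj P unfolding left_approx_def by blast
qed

text \<open>The truncation of \<open>ex_approx\<close>, through which all maps to \<open>YY\<close>
  factor, itself factors through any given left approximation.\<close>

lemma left_approx_YY:
  assumes X: "X \<in> ZZ" and i: "left_approx C PP X P i" and Y: "Y \<in> YY" and g: "arr g X Y"
  shows "\<exists>\<phi>. arr \<phi> P Y \<and> g = \<phi> \<cdot> i"
proof -
  note i = left_approxD[OF i ZZ_obj[OF X]]
  obtain P0 N0 i0 p0 d0 where P0: "P0 \<in> PP" "(X, P0, N0, i0, p0, d0) \<in> Tri C"
    "\<forall>Y\<in>YY. \<forall>g. arr g X Y \<longrightarrow> (\<exists>\<phi>. arr \<phi> P0 Y \<and> g = \<phi> \<cdot> i0)"
    using ex_approx[OF X] by blast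
  obtain a where a: "arr a P0 Y" "g = a \<cdot> i0" using P0(3) Y g by blast
  obtain b where b: "arr b P P0" "i0 = b \<cdot> i" using i(3)[OF P0(1) tri_arr(1)[OF P0(2)]] by blast
  have "g = (a \<cdot> b) \<cdot> i" using a b i(2) by simp
  then show ?thesis using cmp_arr[OF b(1) a(1)] by blast
qed

text \<open>Maps from \<open>XX\<close> to N vanish because they do for M and X[1]. A map from N to
  Y[1] vanishes on M, so it comes from X[1] -> Y[1]; the extension property lets this factor through
  X[1] -> M[1], whose composite with \<open>d\<close> is zero.\<close>

lemma cone_ZZ:
  assumes t: "(X, M, N, i, p, d) \<in> Tri C" and X: "X \<in> ZZ" and M: "M \<in> ZZ"
    and ext: "\<And>Y g. Y \<in> YY \<Longrightarrow> arr g X Y \<Longrightarrow> \<exists>\<phi>. arr \<phi> M Y \<and> g = \<phi> \<cdot> i"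
  shows "N \<in> ZZ"
proof -
  note ta = tri_arr[OF t]
  have "no_hom W N" if W: "W \<in> XX" for W
    using no_hom_mid_right[OF tri_rotated[OF t], of W] X_perp_shift[of X W] X M W
    unfolding ZZ_iff X_perp_def by blast
  moreover have "no_hom N (Sh Y)" if Y: "Y \<in> YY" for Y
    unfolding no_hom_def
  proof (intro allI impI)
    fix k assume k: "arr k N (Sh Y)"
    have "k \<cdot> p = zero M (Sh Y)"
      using no_homD[of M "Sh Y" "k \<cdot> p"] M Y cmp_arr[OF ta(2) k] unfolding ZZ_iff perp_Y1_def by blast
    then obtain l where l: "arr l (Sh X) (Sh Y)" "k = l \<cdot> d" using coexact_right[OF t k] by blast
    obtain m where m: "arr m X Y" "Sm m = l" using shift_full[of X Y l] ZZ_obj X YY_obj Y l by blast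
    obtain n where n: "arr n M Y" "m = n \<cdot> i" using ext[OF Y m(1)] by blast
    have "k = (Sm n \<cdot> Sm i) \<cdot> d" using l m n ta by simp
    also have "\<dots> = Sm n \<cdot> zero N (Sh M)" using n ta tri_comp_zero3[OF t] by simp
    also have "\<dots> = zero N (Sh Y)" using n k by simp
    finally show "k = zero N (Sh Y)" .
  qed
  ultimately show ?thesis unfolding ZZ_iff X_perp_def perp_Y1_def using ta by simp
qed

text \<open>The map from \<open>M\<close> to the \<open>\<Y>[1]\<close>-part of the cone of \<open>s\<close> vanishes.\<close>

lemma den_refine:
  assumes M: "M \<in> ZZ" and s: "s \<in> den A M"
  shows "\<exists>A' u B q r. arr u A' A \<and> B \<in> XX \<and> (A', M, Sh B, s \<cdot> u, q, r) \<in> Tri C"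
proof -
  obtain E g h where E: "E \<in> S" "(A, M, E, s, g, h) \<in> Tri C" using denD[OF s] by blast
  note ta = tri_arr[OF E(2)] and Eo = S_obj[OF E(1)]
  \<comment> \<open>The cone is desuspended before it is decomposed, so that the shifted triangle
    exhibits E as an extension of Y[1] by B[1] with B in \<open>XX\<close>.\<close>
  obtain E' e where E': "E' \<in> Obj C" "is_iso C (Sh E') E e" using shift_dense[OF Eo] by blast
  have "E' \<in> S" using S_iso[OF E'(2)] S_shift E'(1) Eo E(1) shift.obj_map by blast
  then obtain B Y x y z where B: "B \<in> XX" "Y \<in> YY" "(B, E', Y, x, y, z) \<in> Tri C"
    using S_decomposition by blast
  note tb = tri_arr[OF B(3)]
  have Bo: "B \<in> Obj C" "Sh B \<in> Obj C" using tb by simp_all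
  obtain d where d: "arr e (Sh E') E" "arr d E (Sh E')" "d \<cdot> e = Ident C (Sh E')" "e \<cdot> d = Ident C E"
    using is_isoD[OF E'(2) shift.obj_map[OF E'(1)] Eo] by blast
  have dg: "arr (d \<cdot> g) M (Sh E')" using d ta by simp
  have "arr (Sm y \<cdot> (d \<cdot> g)) M (Sh Y)" using dg tb by simp
  then have "Sm y \<cdot> (d \<cdot> g) = zero M (Sh Y)"
    using no_homD M B(2) unfolding ZZ_iff perp_Y1_def by blast
  then obtain q where q: "arr q M (Sh B)" "d \<cdot> g = Sm x \<cdot> q"
    using exact_shift_mid[OF B(3) dg] by blast
  have gq: "(e \<cdot> Sm x) \<cdot> q = g \<cdot> Ident C M"
  proof -
    have "(e \<cdot> Sm x) \<cdot> q = e \<cdot> (d \<cdot> g)" unfolding q(2) using d q(1) tb by simp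
    also have "\<dots> = g \<cdot> Ident C M" using cmp_pre[OF d(4)] d ta by simp
    finally show ?thesis .
  qed
  \<comment> \<open>A' is the fibre of \<open>q\<close> : M -> B[1]; the square \<open>gq\<close>
    then makes its map to M factor through \<open>s\<close>.\<close>
  obtain Z1 p1 q1 where "(M, Sh B, Z1, q, p1, q1) \<in> Tri C" using ex_cone[OF q(1)] by blast
  then obtain A' s' v where A': "(A', M, Sh B, s', q, v) \<in> Tri C" using fibre by blast
  note tc = tri_arr[OF A']
  have ex: "arr (e \<cdot> Sm x) (Sh B) E" using d tb by simp
  have Mo: "arr (Ident C M) M M" using ident_arr ta by simp
  obtain u where u: "arr u A' A" "Ident C M \<cdot> s' = s \<cdot> u"
    using tri_complete_left[OF A' E(2) Mo ex gq] by blast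
  have "s' = s \<cdot> u" using u tc by simp
  then show ?thesis using u(1) B(1) A' by blast
qed

text \<open>The obstruction to extending \<open>f\<close> is a map B[1] -> N[1], and Hom(B, N) =
  0.\<close>

lemma extend_along:
  assumes t: "(A, M, Sh B, s, q, r) \<in> Tri C" and B: "B \<in> XX" and N: "X_perp N" and f: "arr f A N"
  shows "\<exists>g. arr g M N \<and> f = g \<cdot> s"
proof (rule coexact_left[OF t f])
  have "no_hom (Sh B) (Sh N)" using no_hom_shift[of B N] XX_obj B N unfolding X_perp_def by blast
  moreover have "arr (Sm f \<cdot> r) (Sh B) (Sh N)" using f tri_arr[OF t] by simp
  ultimately show "Sm f \<cdot> r = zero (Sh B) (Sh N)" by (rule no_homD)
qed

section \<open>Fullness, kernel and density of the functor from Z to the quotient\<close>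

lemma loc_full:
  assumes M: "M \<in> ZZ" and N: "N \<in> ZZ" and c: "V.arr c M N"
  shows "\<exists>g. arr g M N \<and> loc g = c"
proof -
  obtain A s f where s: "s \<in> den A M" "arr f A N" "c = cls M N (s, f)"
    using hom_cls c V_arr_iff by blast
  obtain A' u B q r where u: "arr u A' A" "B \<in> XX" "(A', M, Sh B, s \<cdot> u, q, r) \<in> Tri C"
    using den_refine[OF M s(1)] by blast
  have fu: "arr (f \<cdot> u) A' N" using cmp_arr[OF u(1) s(2)] .
  have "X_perp N" using N ZZ_iff by blast
  then obtain g where g: "arr g M N" "f \<cdot> u = g \<cdot> (s \<cdot> u)"
    using extend_along[OF u(3,2) _ fu] by blast
  have "Sh B \<in> S" using S_shift u(2) XX_obj XX_S by blast
  then have su: "s \<cdot> u \<in> den A' M" using denI[OF u(3)] by blast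
  note ty = den_arr[OF s(1)] den_arr[OF su] and cs = roof_loc[OF s(1,2), folded s(3)]
  have "Cmp V (loc g) (loc (s \<cdot> u)) = loc (f \<cdot> u)" using g ty u(1) by simp
  also have "\<dots> = Cmp V c (loc (s \<cdot> u))" using V.cmp_pre[OF cs] ty u(1) s(2) c by simp
  finally have "loc g = c"
    using V.iso_cancel_right[OF loc_den_iso[OF su]] loc_arr[OF g(1)] c ty by simp
  then show ?thesis using g(1) by blast
qed

lemma factoring_iff:
  assumes "M \<in> Obj C" "N \<in> Obj C"
  shows "f \<in> factoring C PP M N \<longleftrightarrow> (\<exists>P h g. P \<in> PP \<and> arr h M P \<and> arr g P N \<and> f = g \<cdot> h)"
  unfolding factoring_def using hom_arr PP_obj assms by blast

lemma loc_zero_S: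
  assumes "arr h M P" "arr g P N" "P \<in> S"
  shows "loc (g \<cdot> h) = loc (zero M N)"
proof -
  obtain D w where w: "w \<in> den D M" "h \<cdot> w = zero D P" using factor_den_kill assms by blast
  have "(g \<cdot> h) \<cdot> w = zero D N" using w assms(1,2) den_arr[OF w(1)] by simp
  then show ?thesis using loc_zero_iff[OF cmp_arr[OF assms(1,2)]] w(1) by blast
qed

lemma loc_kernel:
  assumes M: "M \<in> ZZ" and N: "N \<in> ZZ" and f: "arr f M N"
  shows "loc f = loc (zero M N) \<longleftrightarrow> f \<in> factoring C PP M N"
proof
  assume "f \<in> factoring C PP M N"
  then show "loc f = loc (zero M N)"
    using factoring_iff loc_zero_S PP_S f by (metis arr_objs)
next
  assume "loc f = loc (zero M N)"
  then obtain A s where s: "s \<in> den A M" "f \<cdot> s = zero A N" using loc_zero_iff[OF f] by blast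
  obtain A' u B q r where u: "arr u A' A" "B \<in> XX" "(A', M, Sh B, s \<cdot> u, q, r) \<in> Tri C"
    using den_refine[OF M s(1)] by blast
  have "f \<cdot> (s \<cdot> u) = zero A' N"
    using cmp_pre[OF s(2)] f u(1) den_arr[OF s(1)] by simp
  then obtain l where l: "arr l (Sh B) N" "f = l \<cdot> q" using coexact_mid[OF u(3) f] by blast
  have BS: "Sh B \<in> S" using S_shift u(2) XX_obj XX_S by blast
  \<comment> \<open>To replace B[1] by an object of \<open>PP\<close>, decompose it in
    \<open>S\<close>. The part X has no maps to N, so \<open>l\<close> factors through Y; and Y lies
    in \<open>PP\<close>, being an extension of X[1] by B[1].\<close>
  obtain X Y x y z where X: "X \<in> XX" "Y \<in> YY" "(X, Sh B, Y, x, y, z) \<in> Tri C"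
    using S_decomposition[OF BS] by blast
  note ta = tri_arr[OF u(3)] and tx = tri_arr[OF X(3)]
  have "l \<cdot> x = zero X N"
    using no_homD[of X N] N X(1) cmp_arr[OF tx(1) l(1)] unfolding ZZ_iff X_perp_def by blast
  then obtain l' where l': "arr l' Y N" "l = l' \<cdot> y" using coexact_mid[OF X(3) l(1)] by blast
  have "no_hom Y (Sh Y')" if Y': "Y' \<in> YY" for Y'
  proof (rule no_hom_mid_left[OF tri_rotated[OF X(3)]])
    show "no_hom (Sh B) (Sh Y')" using no_hom_shift XX_obj YY_obj no_hom_XY u(2) Y' by blast
    show "no_hom (Sh X) (Sh Y')" using no_hom_shift XX_obj YY_obj no_hom_XY X(1) Y' by blast
  qed
  then have "Y \<in> PP" using PP_I X(2) YY_obj unfolding perp_Y1_def by blast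
  moreover have "arr (y \<cdot> q) M Y" "f = l' \<cdot> (y \<cdot> q)" using l l' tx ta by simp_all
  ultimately show "f \<in> factoring C PP M N"
    using factoring_iff ZZ_obj M N l'(1) by blast
qed

lemma loc_dense:
  assumes A: "A \<in> Obj C"
  shows "\<exists>M\<in>ZZ. \<exists>c. is_iso V M A c"
proof -
  obtain X B f g h M Y f' g' h' where X: "X \<in> XX" "(X, A, B, f, g, h) \<in> Tri C"
    and M: "M \<in> ZZ" "Y \<in> YY" "(M, B, Sh Y, f', g', h') \<in> Tri C"
    using decomposition_XZY[OF A] by blast
  have "Sh X \<in> S" "Sh Y \<in> S" using S_shift X(1) M(2) XX_obj XX_S YY_obj YY_S by blast+
  then have "g \<in> den A B" "f' \<in> den M B" using denI[OF tri_rotated[OF X(2)]] denI[OF M(3)] by blast+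
  then have iso: "is_iso V A B (loc g)" "is_iso V M B (loc f')" using loc_den_iso by blast+
  have o: "A \<in> Obj V" "B \<in> Obj V" "M \<in> Obj V" using tri_arr[OF X(2)] tri_arr[OF M(3)] by simp_all
  obtain k where "is_iso V B A k" using V.iso_inverse[OF iso(1) o(1,2)] by blast
  then show ?thesis using V.iso_cmp[OF iso(2) _ o(3,2,1)] M(1) by blast
qed

text \<open>Adding P is invisible in the quotient, as P lies in \<open>S\<close> and the projection
  is a denominator. The component \<open>c\<close> makes every map from M to \<open>YY\<close>
  factor through \<open>k\<close>, which is the extension property required by
  \<open>cone_ZZ\<close>.\<close>

lemma ZZ_model_of_map:
  assumes M: "M \<in> ZZ" and M': "M' \<in> ZZ" and f: "arr f M M'"
  shows "\<exists>D Z p k g h. D \<in> ZZ \<and> Z \<in> ZZ \<and> (M, D, Z, k, g, h) \<in> Tri C \<and> p \<in> den D M' \<and> p \<cdot> k = f"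
proof -
  obtain P N c l d where P: "P \<in> PP" "(M, P, N, c, l, d) \<in> Tri C"
    "\<forall>Y\<in>YY. \<forall>g. arr g M Y \<longrightarrow> (\<exists>\<phi>. arr \<phi> P Y \<and> g = \<phi> \<cdot> c)"
    using ex_approx[OF M] by blast
  note c = tri_arr(1)[OF P(2)]
  have o: "M \<in> Obj C" "M' \<in> Obj C" "P \<in> Obj C" using ZZ_obj M M' PP_obj P(1) by blast+
  obtain D i j p q where bp: "biproduct C M' P D i j p q" using ex_biproduct[OF o(2,3)] by blast
  note b = biproduct_arr[OF bp o(2,3)]
  have Do: "D \<in> Obj C" using b(1) by simp
  define k where "k = add (i \<cdot> f) (j \<cdot> c)"
  have k: "arr k M D" unfolding k_def using b(1,2) f c by simp
  have "p \<cdot> k = add ((p \<cdot> i) \<cdot> f) ((p \<cdot> j) \<cdot> c)" unfolding k_def using b(1-3) f c by simp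
  then have pk: "p \<cdot> k = f" using b(5,8) f c by simp
  have "q \<cdot> k = add ((q \<cdot> i) \<cdot> f) ((q \<cdot> j) \<cdot> c)" unfolding k_def using b(1,2,4) f c by simp
  then have qk: "q \<cdot> k = c" using b(6,7) f c by simp
  have "D \<in> ZZ"
    using biproduct_no_hom[OF bp o(2,3)] M' PP_ZZ[OF P(1)] Do
    unfolding ZZ_iff X_perp_def perp_Y1_def by blast
  obtain Z g h where Z: "(M, D, Z, k, g, h) \<in> Tri C" using ex_cone[OF k] by blast
  have "Z \<in> ZZ"
  proof (rule cone_ZZ[OF Z M \<open>D \<in> ZZ\<close>])
    fix Y x assume "Y \<in> YY" and x: "arr x M Y"
    then obtain \<phi> where \<phi>: "arr \<phi> P Y" "x = \<phi> \<cdot> c" using P(3) by blast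
    have "x = (\<phi> \<cdot> q) \<cdot> k" unfolding \<phi>(2) qk[symmetric] using \<phi>(1) b(4) k by simp
    then show "\<exists>\<phi>. arr \<phi> D Y \<and> x = \<phi> \<cdot> k" using cmp_arr[OF b(4) \<phi>(1)] by blast
  qed
  then show ?thesis
    using \<open>D \<in> ZZ\<close> Z pk biproduct_den(2)[OF bp o(2) PP_S[OF P(1)]] by blast
qed

text \<open>X and Y are joined to objects of \<open>ZZ\<close> by denominators X -> B <- M and Y ->
  B' <- M'. The map \<open>f\<close> is carried across both, and each passage becomes an isomorphism
  of diagrams by \<open>den_link\<close>.\<close>

lemma ZZ_model:
  assumes t: "(X, Y, Z, f, g, h) \<in> Tri C"
  shows "\<exists>X' Y' Z' f' g' h'. X' \<in> ZZ \<and> Y' \<in> ZZ \<and> Z' \<in> ZZ \<and> (X', Y', Z', f', g', h') \<in> Tri C \<and>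
    tri_iso V (X', Y', Z', loc f', loc g', loc h') (X, Y, Z, loc f, loc g, loc h)"
proof -
  note ta = tri_arr[OF t]
  have o: "X \<in> Obj C" "Y \<in> Obj C" using ta by simp_all
  obtain A B u a v where A: "A \<in> XX" "(A, X, B, u, a, v) \<in> Tri C"
    and "\<exists>M\<in>ZZ. \<exists>Y\<in>YY. \<exists>f g h. (M, B, Sh Y, f, g, h) \<in> Tri C"
    using decomposition_XZY[OF o(1)] by blast
  then obtain M W m mg mh where M: "M \<in> ZZ" "W \<in> YY" "(M, B, Sh W, m, mg, mh) \<in> Tri C" by blast
  obtain A' B' u' b v' where A': "A' \<in> XX" "(A', Y, B', u', b, v') \<in> Tri C"
    and "\<exists>M\<in>ZZ. \<exists>Y\<in>YY. \<exists>f g h. (M, B', Sh Y, f, g, h) \<in> Tri C"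
    using decomposition_XZY[OF o(2)] by blast
  then obtain M' W' m' mg' mh' where M': "M' \<in> ZZ" "W' \<in> YY" "(M', B', Sh W', m', mg', mh') \<in> Tri C"
    by blast
  have "B' \<in> star C ZZ (shifted C YY)"
    unfolding star_def using M' shift_in_shifted arr_objs[OF tri_arr(1)[OF M'(3)]] by blast
  then have B': "X_perp B'" by (rule star_ZZ_X_perp)
  have S: "Sh A \<in> S" "Sh A' \<in> S" "Sh W \<in> S" "Sh W' \<in> S"
    using S_shift XX_obj YY_obj XX_S YY_S A(1) A'(1) M(2) M'(2) by blast+
  have den: "a \<in> den X B" "b \<in> den Y B'" "m \<in> den M B" "m' \<in> den M' B'"
    using denI[OF tri_rotated[OF A(2)] S(1)] denI[OF tri_rotated[OF A'(2)] S(2)]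
      denI[OF M(3) S(3)] denI[OF M'(3) S(4)] .
  note ty = den_arr[OF den(1)] den_arr[OF den(2)] den_arr[OF den(3)] den_arr[OF den(4)]
  \<comment> \<open>\<open>f\<close> passes to the truncations because B' admits no maps from A in
    \<open>XX\<close>.\<close>
  have "arr ((b \<cdot> f) \<cdot> u) A B'" using ty ta tri_arr[OF A(2)] by simp
  then have "(b \<cdot> f) \<cdot> u = zero A B'" using no_homD B' A(1) unfolding X_perp_def by blast
  then obtain f1 where f1: "arr f1 B B'" "b \<cdot> f = f1 \<cdot> a"
    using coexact_mid[OF A(2), of "b \<cdot> f" B'] cmp_arr[OF ta(1) ty(2)] by blast
  \<comment> \<open>\<open>f1\<close> restricts to M -> M' because M has no maps to W'[1].\<close>
  have "arr (mg' \<cdot> (f1 \<cdot> m)) M (Sh W')" using ty f1 tri_arr[OF M'(3)] by simp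
  then have "mg' \<cdot> (f1 \<cdot> m) = zero M (Sh W')"
    using no_homD M(1) M'(2) unfolding ZZ_iff perp_Y1_def by blast
  then obtain f2 where f2: "arr f2 M M'" "f1 \<cdot> m = m' \<cdot> f2"
    using exact_mid[OF M'(3), of "f1 \<cdot> m" M] cmp_arr[OF ty(3) f1(1)] by blast
  obtain D Z3 p k g3 h3 where D: "D \<in> ZZ" "Z3 \<in> ZZ" "(M, D, Z3, k, g3, h3) \<in> Tri C"
    "p \<in> den D M'" "p \<cdot> k = f2"
    using ZZ_model_of_map[OF M(1) M'(1) f2(1)] by blast
  obtain Z1 g1 h1 where t1: "(B, B', Z1, f1, g1, h1) \<in> Tri C" using ex_cone[OF f1(1)] by blast
  have "M \<in> Obj C" using ZZ_obj M(1) .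
  have mp: "m' \<cdot> p \<in> den D B'" using den_cmp[OF D(4) den(4)] .
  have "(m' \<cdot> p) \<cdot> k = f1 \<cdot> m"
    using cmp_pre[OF D(5)] D(5) f2(2) den_arr[OF D(4)] tri_arr[OF D(3)] ty by simp
  then have l1: "tri_iso V (M, D, Z3, loc k, loc g3, loc h3) (B, B', Z1, loc f1, loc g1, loc h1)"
    by (rule den_link[OF D(3) t1 den(3) mp])
  \<comment> \<open>The denominators \<open>a\<close>, \<open>b\<close> start at the given triangle,
    whereas \<open>m\<close> and \<open>m' \<cdot> p\<close> end at the truncated one; hence the
    inversion.\<close>
  have l2: "tri_iso V (B, B', Z1, loc f1, loc g1, loc h1) (X, Y, Z, loc f, loc g, loc h)"
    by (rule tri_iso_sym[OF den_link[OF t t1 den(1,2) f1(2)] loc_tri_arr[OF t] loc_tri_arr[OF t1]])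
  have "tri_iso V (M, D, Z3, loc k, loc g3, loc h3) (X, Y, Z, loc f, loc g, loc h)"
    by (rule tri_iso_trans[OF l1 l2 loc_tri_arr[OF D(3)] loc_tri_arr[OF t1] loc_tri_arr[OF t]])
  then show ?thesis using M(1) D by blast
qed

section \<open>The ideal quotient\<close>

abbreviation "Q \<equiv> ideal_quotient C ZZ PP"
abbreviation "ic \<equiv> ideal_class C ZZ PP"
abbreviation "ind \<equiv> induced_mor C S"

lemma factoring_arr:
  assumes "k \<in> factoring C PP X Y" "X \<in> Obj C" "Y \<in> Obj C"
  shows "arr k X Y"
proof -
  obtain P h g where "arr h X P" "arr g P Y" "k = g \<cdot> h" using factoring_iff[OF assms(2,3)] assms(1) by blast
  then show ?thesis using cmp_arr by blast
qed

text \<open>The cosets of the ideal are the fibres of localisation: by \<open>loc_kernel\<close> a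
  difference factors through \<open>PP\<close> exactly when it becomes zero in the quotient.
  Independence of representatives then reduces to functoriality and additivity of
  \<open>loc\<close>.\<close>

lemma factoring_coset:
  assumes X: "X \<in> ZZ" and Y: "Y \<in> ZZ" and f: "arr f X Y"
  shows "h \<in> factoring C PP X Y #>\<^bsub>hom_group C X Y\<^esub> f \<longleftrightarrow> arr h X Y \<and> loc h = loc f"
proof -
  have z: "arr (zero X Y) X Y" using f by simp
  have "h \<in> factoring C PP X Y #>\<^bsub>hom_group C X Y\<^esub> f \<longleftrightarrow> (\<exists>k\<in>factoring C PP X Y. h = add k f)"
    by (simp add: r_coset_def hom_group_def)
  also have "\<dots> \<longleftrightarrow> arr h X Y \<and> loc h = loc f"
  proof
    assume "\<exists>k\<in>factoring C PP X Y. h = add k f"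
    then obtain k where k: "k \<in> factoring C PP X Y" "h = add k f" by blast
    have ka: "arr k X Y" using factoring_arr k(1) X Y ZZ_obj by blast
    have "loc k = loc (zero X Y)" using loc_kernel[OF X Y ka] k(1) by blast
    then have "loc (add k f) = loc (add (zero X Y) f)" by (rule loc_cong_add[OF ka z f f _ refl])
    then show "arr h X Y \<and> loc h = loc f" using add_arr[OF ka f] f k(2) by simp
  next
    assume *: "arr h X Y \<and> loc h = loc f"
    then have h: "arr h X Y" and l: "loc h = loc f" by blast+
    have d: "arr (dif h f) X Y" using h f by simp
    have "loc (dif h f) = loc (zero X Y)" using loc_eq_dif[OF h f] l by blast
    then have "dif h f \<in> factoring C PP X Y" using loc_kernel[OF X Y d] by blast
    moreover have "h = add (dif h f) f" using add_dif_cancel[OF f h] add_comm[OF f d] by simp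
    ultimately show "\<exists>k\<in>factoring C PP X Y. h = add k f" by blast
  qed
  finally show ?thesis .
qed

lemma ic_eq:
  assumes "X \<in> ZZ" "Y \<in> ZZ" "arr f X Y"
  shows "ic f = {h. arr h X Y \<and> loc h = loc f}"
proof -
  have "X' = X \<and> Y' = Y" if "X' \<in> ZZ" "Y' \<in> ZZ" "f \<in> Hom C X' Y'" for X' Y'
    using that hom_arr ZZ_obj arr_unique assms(3) by blast
  then have "ic f = {h. h \<in> factoring C PP X Y #>\<^bsub>hom_group C X Y\<^esub> f}"
    unfolding ideal_class_def using assms arr_hom by blast
  then show ?thesis using factoring_coset[OF assms] by blast
qed

lemma ic_self: "X \<in> ZZ \<Longrightarrow> Y \<in> ZZ \<Longrightarrow> arr f X Y \<Longrightarrow> f \<in> ic f"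
  using ic_eq by blast

lemma ic_eq_iff:
  assumes "X \<in> ZZ" "Y \<in> ZZ" "arr f X Y" "arr g X Y"
  shows "ic f = ic g \<longleftrightarrow> loc f = loc g"
proof
  assume "ic f = ic g"
  then have "f \<in> ic g" using ic_self[OF assms(1-3)] by simp
  then show "loc f = loc g" using ic_eq[OF assms(1,2,4)] by blast
next
  assume "loc f = loc g"
  then show "ic f = ic g" unfolding ic_eq[OF assms(1-3)] ic_eq[OF assms(1,2,4)] by simp
qed

lemma Q_obj [simp]: "Obj Q = ZZ"
  by (simp add: ideal_quotient_def)

lemma Q_hom:
  assumes "X \<in> ZZ" "Y \<in> ZZ"
  shows "Hom Q X Y = {ic f |f. arr f X Y}"
proof -
  have e1: "Hom Q X Y = {factoring C PP X Y #>\<^bsub>hom_group C X Y\<^esub> f |f. f \<in> Hom C X Y}"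
    by (auto simp: ideal_quotient_def FactGroup_def RCOSETS_def hom_group_def)
  have e2: "f \<in> Hom C X Y \<longleftrightarrow> arr f X Y" for f using hom_arr assms ZZ_obj by blast
  have e3: "factoring C PP X Y #>\<^bsub>hom_group C X Y\<^esub> f = ic f" if "arr f X Y" for f
    using factoring_coset[OF assms that] ic_eq[OF assms that] by blast
  show ?thesis unfolding e1 e2 by (rule Collect_cong) (metis e3)
qed

lemma Q_homD: "c \<in> Hom Q X Y \<Longrightarrow> X \<in> ZZ \<Longrightarrow> Y \<in> ZZ \<Longrightarrow> \<exists>f. arr f X Y \<and> c = ic f"
  using Q_hom by blast

lemma Q_homI: "arr f X Y \<Longrightarrow> X \<in> ZZ \<Longrightarrow> Y \<in> ZZ \<Longrightarrow> ic f \<in> Hom Q X Y"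
  using Q_hom by blast

lemma Q_ident: "Ident Q X = ic (Ident C X)"
  by (simp add: ideal_quotient_def)

lemma loc_cong_cmp:
  assumes "arr f X Y" "arr f' X Y" "arr g Y Z" "arr g' Y Z" "loc f = loc f'" "loc g = loc g'"
  shows "loc (g \<cdot> f) = loc (g' \<cdot> f')"
proof -
  have "loc (g \<cdot> f) = Cmp V (loc g) (loc f)" "loc (g' \<cdot> f') = Cmp V (loc g') (loc f')"
    using assms(1-4) by simp_all
  then show ?thesis using assms(5,6) by simp
qed

text \<open>The union in the definition of the composite is constant, since other representatives
  have the same image in \<open>V\<close>.\<close>

lemma Q_cmp:
  assumes o: "X \<in> ZZ" "Y \<in> ZZ" "Z \<in> ZZ" and f: "arr f X Y" and g: "arr g Y Z"
  shows "Cmp Q (ic g) (ic f) = ic (g \<cdot> f)"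
proof -
  have "ic (g' \<cdot> f') = ic (g \<cdot> f)" if "g' \<in> ic g" "f' \<in> ic f" for f' g'
  proof -
    have "arr g' Y Z" "loc g' = loc g" "arr f' X Y" "loc f' = loc f"
      using that ic_eq[OF o(1,2) f] ic_eq[OF o(2,3) g] by blast+
    then show ?thesis
      using ic_eq_iff[OF o(1,3) cmp_arr cmp_arr[OF f g]] loc_cong_cmp[OF _ f _ g] by blast
  qed
  moreover have "Cmp Q (ic g) (ic f) = (\<Union>g'\<in>ic g. \<Union>f'\<in>ic f. ic (g' \<cdot> f'))"
    by (simp add: ideal_quotient_def)
  moreover have "g \<in> ic g" "f \<in> ic f" using ic_self o f g by blast+
  ultimately show ?thesis by blast
qed

lemma Q_plus:
  assumes o: "X \<in> ZZ" "Y \<in> ZZ" and f: "arr f X Y" and g: "arr g X Y"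
  shows "Plus Q (ic f) (ic g) = ic (add f g)"
proof -
  note fg = add_arr[OF f g]
  have P: "Plus Q (ic f) (ic g) = {add f' g' | f' g'. f' \<in> ic f \<and> g' \<in> ic g}"
    by (simp add: ideal_quotient_def)
  have "h \<in> ic (add f g)" if *: "f' \<in> ic f" "g' \<in> ic g" "h = add f' g'" for h f' g'
  proof -
    have "arr f' X Y" "loc f' = loc f" "arr g' X Y" "loc g' = loc g"
      using * ic_eq[OF o f] ic_eq[OF o g] by blast+
    then show ?thesis
      unfolding ic_eq[OF o fg] *(3) using add_arr loc_cong_add[OF _ f _ g] by blast
  qed
  moreover have "\<exists>f' g'. h = add f' g' \<and> f' \<in> ic f \<and> g' \<in> ic g" if "h \<in> ic (add f g)" for h
  proof -
    have h: "arr h X Y" "loc h = loc (add f g)" using that ic_eq[OF o fg] by blast+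
    have d: "arr (dif h f) X Y" using h(1) f by simp
    have nf: "arr (opp f) X Y" using opp_arr[OF f] .
    have "loc (add h (opp f)) = loc (add (add g f) (opp f))"
      using loc_cong_add[OF h(1) fg nf nf h(2) refl] add_comm[OF f g] by simp
    then have "loc (dif h f) = loc g"
      using dif_add_cancel[OF g f] unfolding dif_def by simp
    then have "dif h f \<in> ic g" unfolding ic_eq[OF o g] using d by blast
    moreover have "h = add f (dif h f)" using add_dif_cancel[OF f h(1)] by simp
    ultimately show ?thesis using ic_self[OF o f] by blast
  qed
  ultimately show ?thesis unfolding P by blast
qed

text \<open>The union over representatives collapses because they all have the same image.\<close>

lemma ind_ic:
  assumes "X \<in> ZZ" "Y \<in> ZZ" "arr f X Y"
  shows "ind (ic f) = loc f"
  unfolding induced_mor_def using ic_eq[OF assms] ic_self[OF assms] by blast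

lemma Q_category: "category Q"
proof
  fix X Y X' Y' c assume "X \<in> Obj Q" "Y \<in> Obj Q" "X' \<in> Obj Q" "Y' \<in> Obj Q"
    and c: "c \<in> Hom Q X Y" "c \<in> Hom Q X' Y'"
  then have o: "X \<in> ZZ" "Y \<in> ZZ" "X' \<in> ZZ" "Y' \<in> ZZ" by simp_all
  obtain f f' where f: "arr f X Y" "c = ic f" "arr f' X' Y'" "c = ic f'"
    using c Q_homD o by metis
  have "f \<in> ic f'" using ic_self[OF o(1,2) f(1)] f by simp
  then have "arr f X' Y'" using ic_eq[OF o(3,4) f(3)] by blast
  then show "X = X' \<and> Y = Y'" using arr_unique f(1) by blast
next
  fix X assume "X \<in> Obj Q"
  then show "Ident Q X \<in> Hom Q X X"
    unfolding Q_ident Q_obj using Q_homI[OF ident_arr] ZZ_obj by blast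
next
  fix X Y Z c d assume "X \<in> Obj Q" "Y \<in> Obj Q" "Z \<in> Obj Q" and c: "c \<in> Hom Q X Y" "d \<in> Hom Q Y Z"
  then have o: "X \<in> ZZ" "Y \<in> ZZ" "Z \<in> ZZ" by simp_all
  obtain f where f: "arr f X Y" "c = ic f" using Q_homD c o by blast
  obtain g where g: "arr g Y Z" "d = ic g" using Q_homD c o by blast
  show "Cmp Q d c \<in> Hom Q X Z"
    unfolding f(2) g(2) Q_cmp[OF o f(1) g(1)] using Q_homI cmp_arr[OF f(1) g(1)] o by blast
next
  fix X Y c assume "X \<in> Obj Q" "Y \<in> Obj Q" and c: "c \<in> Hom Q X Y"
  then have o: "X \<in> ZZ" "Y \<in> ZZ" "X \<in> Obj C" "Y \<in> Obj C" using ZZ_obj by simp_all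
  obtain f where f: "arr f X Y" "c = ic f" using Q_homD c o by blast
  show "Cmp Q c (Ident Q X) = c"
    unfolding f(2) Q_ident Q_cmp[OF o(1,1,2) ident_arr[OF o(3)] f(1)] using f(1) by simp
  show "Cmp Q (Ident Q Y) c = c"
    unfolding f(2) Q_ident Q_cmp[OF o(1,2,2) f(1) ident_arr[OF o(4)]] using f(1) by simp
next
  fix W X Y Z c d e assume "W \<in> Obj Q" "X \<in> Obj Q" "Y \<in> Obj Q" "Z \<in> Obj Q"
    and c: "c \<in> Hom Q W X" "d \<in> Hom Q X Y" "e \<in> Hom Q Y Z"
  then have o: "W \<in> ZZ" "X \<in> ZZ" "Y \<in> ZZ" "Z \<in> ZZ" by simp_all
  obtain f where f: "arr f W X" "c = ic f" using Q_homD c o by blast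
  obtain g where g: "arr g X Y" "d = ic g" using Q_homD c o by blast
  obtain h where h: "arr h Y Z" "e = ic h" using Q_homD c o by blast
  show "Cmp Q e (Cmp Q d c) = Cmp Q (Cmp Q e d) c"
    unfolding f(2) g(2) h(2) Q_cmp[OF o(1-3) f(1) g(1)] Q_cmp[OF o(2-4) g(1) h(1)]
      Q_cmp[OF o(1,3,4) cmp_arr[OF f(1) g(1)] h(1)] Q_cmp[OF o(1,2,4) f(1) cmp_arr[OF g(1) h(1)]]
    using f(1) g(1) h(1) by simp
qed

sublocale Q: category Q
  by (rule Q_category)

lemma Q_arrD: "Q.arr c X Y \<Longrightarrow> \<exists>f. arr f X Y \<and> c = ic f"
  unfolding Q.arr_def Q_obj using Q_homD by blast

lemma Q_arrI: "X \<in> ZZ \<Longrightarrow> Y \<in> ZZ \<Longrightarrow> arr f X Y \<Longrightarrow> Q.arr (ic f) X Y"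
  unfolding Q.arr_def Q_obj using Q_homI by blast

lemma ind_functor: "is_functor Q V id ind"
proof (rule is_functorI)
  fix X assume "X \<in> Obj Q"
  then have X: "X \<in> ZZ" "X \<in> Obj C" using ZZ_obj by simp_all
  show "id X \<in> Obj V" using X by simp
  show "ind (Ident Q X) = Ident V (id X)"
    unfolding Q_ident ind_ic[OF X(1,1) ident_arr[OF X(2)]] using X by simp
next
  fix X Y c assume "X \<in> Obj Q" "Y \<in> Obj Q" and c: "c \<in> Hom Q X Y"
  then have o: "X \<in> ZZ" "Y \<in> ZZ" by simp_all
  obtain f where f: "arr f X Y" "c = ic f" using Q_homD c o by blast
  show "ind c \<in> Hom V (id X) (id Y)"
    unfolding f(2) ind_ic[OF o f(1)] using V.arr_hom[OF loc_arr[OF f(1)]] by simp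
next
  fix X Y Z c d assume "X \<in> Obj Q" "Y \<in> Obj Q" "Z \<in> Obj Q" and c: "c \<in> Hom Q X Y" "d \<in> Hom Q Y Z"
  then have o: "X \<in> ZZ" "Y \<in> ZZ" "Z \<in> ZZ" by simp_all
  obtain f where f: "arr f X Y" "c = ic f" using Q_homD c o by blast
  obtain g where g: "arr g Y Z" "d = ic g" using Q_homD c o by blast
  show "ind (Cmp Q d c) = Cmp V (ind d) (ind c)"
    unfolding f(2) g(2) Q_cmp[OF o f(1) g(1)] ind_ic[OF o(1,2) f(1)] ind_ic[OF o(2,3) g(1)]
      ind_ic[OF o(1,3) cmp_arr[OF f(1) g(1)]] using f(1) g(1) by simp
qed

sublocale ind: functor_pair Q V id ind
  by unfold_locales (rule ind_functor)

lemma ind_faithful: "ind.faithful"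
  unfolding ind.faithful_def
proof (intro allI impI)
  fix X Y c d assume c: "Q.arr c X Y" and d: "Q.arr d X Y" and eq: "ind c = ind d"
  have o: "X \<in> ZZ" "Y \<in> ZZ" using c by simp_all
  obtain f where f: "arr f X Y" "c = ic f" using Q_arrD c by blast
  obtain g where g: "arr g X Y" "d = ic g" using Q_arrD d by blast
  show "c = d" using eq ic_eq_iff[OF o f(1) g(1)] ind_ic[OF o f(1)] ind_ic[OF o g(1)] f(2) g(2) by simp
qed

lemma ind_full: "ind.full"
  unfolding ind.full_def
proof (intro ballI allI impI)
  fix X Y h assume "X \<in> Obj Q" "Y \<in> Obj Q" and h: "V.arr h (id X) (id Y)"
  then have o: "X \<in> ZZ" "Y \<in> ZZ" by simp_all
  obtain g where g: "arr g X Y" "loc g = h" using loc_full[OF o] h by auto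
  then show "\<exists>f. Q.arr f X Y \<and> ind f = h" using ind_ic[OF o g(1)] Q_arrI[OF o g(1)] by blast
qed

lemma ind_dense: "ind.dense"
  unfolding ind.dense_def using loc_dense by simp

theorem ind_additive_equivalence: "additive_equivalence Q V id ind"
  unfolding additive_equivalence_def
proof (intro conjI ballI)
  show "is_equivalence Q V id ind" using ind.equivalence_if ind_faithful ind_full ind_dense by blast
  fix X Y c d assume "X \<in> Obj Q" "Y \<in> Obj Q" and c: "c \<in> Hom Q X Y" "d \<in> Hom Q X Y"
  then have o: "X \<in> ZZ" "Y \<in> ZZ" by simp_all
  obtain f where f: "arr f X Y" "c = ic f" using Q_homD c o by blast
  obtain g where g: "arr g X Y" "d = ic g" using Q_homD c o by blast
  show "ind (Plus Q c d) = Plus V (ind c) (ind d)"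
    unfolding f(2) g(2) Q_plus[OF o f(1) g(1)] ind_ic[OF o f(1)] ind_ic[OF o g(1)]
      ind_ic[OF o add_arr[OF f(1) g(1)]] loc_add[OF f(1) g(1)] ..
qed

section \<open>The shift and the triangles of the ideal quotient\<close>

lemma ex_approx_triangle:
  assumes "X \<in> ZZ"
  shows "\<exists>\<delta>. approx_triangle C PP X \<delta>"
proof -
  obtain P N i p d where P: "P \<in> PP" "(X, P, N, i, p, d) \<in> Tri C"
    "\<forall>Y\<in>YY. \<forall>g. arr g X Y \<longrightarrow> (\<exists>\<phi>. arr \<phi> P Y \<and> g = \<phi> \<cdot> i)"
    using ex_approx[OF assms] by blast
  have "\<exists>\<phi>\<in>Hom C P P'. g = \<phi> \<cdot> i" if "P' \<in> PP" "g \<in> Hom C X P'" for P' g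
    using that P(3) PP_YY PP_obj hom_arr ZZ_obj assms arr_hom by meson
  then have "left_approx C PP X P i"
    unfolding left_approx_def using P(1) arr_hom[OF tri_arr(1)[OF P(2)]] by blast
  then have "approx_triangle C PP X (P, N, i, p, d)" unfolding approx_triangle_def using P(2) by simp
  then show ?thesis by blast
qed

end

locale approx_choice = silting_reduction C S XX YY
  for C :: "('o, 'm, 'x) tcat_scheme" (structure) and S XX YY +
  fixes \<Delta> :: "('o, 'm) choice"
  assumes choice: "X \<in> ZZ \<Longrightarrow> approx_triangle C PP X (\<Delta> X)"
begin

section \<open>The chosen triangles, and lifts of morphisms to X<1>\<close>

definition "aP X = fst (\<Delta> X)"
definition "ai X = fst (snd (snd (\<Delta> X)))"
definition "ap X = fst (snd (snd (snd (\<Delta> X))))"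
definition "ad X = snd (snd (snd (snd (\<Delta> X))))"
abbreviation "aN \<equiv> ang_obj \<Delta>"
abbreviation "lifts \<equiv> ang_lifts C \<Delta>"
abbreviation "am \<equiv> ang_mor C ZZ PP \<Delta>"

lemma tri_of_eq: "tri_of \<Delta> X = (X, aP X, aN X, ai X, ap X, ad X)"
  unfolding tri_of_def ang_obj_def aP_def ai_def ap_def ad_def by (simp split: prod.split)

lemma
  assumes "X \<in> ZZ"
  shows chosen_approx: "left_approx C PP X (aP X) (ai X)"
    and chosen_tri: "(X, aP X, aN X, ai X, ap X, ad X) \<in> Tri C"
  using choice[OF assms]
  unfolding approx_triangle_def ang_obj_def aP_def ai_def ap_def ad_def
  by (cases "\<Delta> X" rule: prod_cases5, simp)+

lemma aP_PP: "X \<in> ZZ \<Longrightarrow> aP X \<in> PP"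
  using chosen_approx left_approxD(1) ZZ_obj by blast

lemma aN_ZZ: "X \<in> ZZ \<Longrightarrow> aN X \<in> ZZ"
  using cone_ZZ[OF chosen_tri _ PP_ZZ[OF aP_PP]] left_approx_YY[OF _ chosen_approx] by blast

text \<open>After two rotations the cone of \<open>ad X\<close> is P[1], which lies in
  \<open>S\<close>.\<close>

lemma ad_den: "X \<in> ZZ \<Longrightarrow> ad X \<in> den (aN X) (Sh X)"
proof -
  assume X: "X \<in> ZZ"
  have "Sh (aP X) \<in> S" using S_shift PP_S PP_obj aP_PP[OF X] by blast
  then show "ad X \<in> den (aN X) (Sh X)" using denI[OF tri_rotated[OF tri_rotated[OF chosen_tri[OF X]]]] by blast
qed

lemma liftD:
  assumes "f' \<in> lifts X Y f" "X \<in> ZZ" "Y \<in> ZZ"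
  shows "arr f X Y" "arr f' (aN X) (aN Y)" "Sm f \<cdot> ad X = ad Y \<cdot> f'"
proof -
  obtain e where "tri_hom C (tri_of \<Delta> X) (tri_of \<Delta> Y) f e f'"
    using assms unfolding ang_lifts_def by blast
  then have *: "f \<in> Hom C X Y" "f' \<in> Hom C (aN X) (aN Y)" "Sm f \<cdot> ad X = ad Y \<cdot> f'"
    unfolding tri_of_eq tri_hom.simps by blast+
  show "Sm f \<cdot> ad X = ad Y \<cdot> f'" using * by blast
  show "arr f X Y" "arr f' (aN X) (aN Y)" using * hom_arr ZZ_obj aN_ZZ assms(2,3) by blast+
qed

lemma liftI:
  assumes "arr f X Y" "arr e (aP X) (aP Y)" "arr f' (aN X) (aN Y)"
    "e \<cdot> ai X = ai Y \<cdot> f" "f' \<cdot> ap X = ap Y \<cdot> e" "Sm f \<cdot> ad X = ad Y \<cdot> f'"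
  shows "f' \<in> lifts X Y f"
  unfolding ang_lifts_def tri_of_eq using tri_homI[OF assms] by blast

lemma ex_lift:
  assumes X: "X \<in> ZZ" and Y: "Y \<in> ZZ" and f: "arr f X Y"
  shows "\<exists>f'. f' \<in> lifts X Y f"
proof -
  note tX = chosen_tri[OF X] and tY = chosen_tri[OF Y]
  have "arr (ai Y \<cdot> f) X (aP Y)" using f tri_arr(1)[OF tY] by simp
  then obtain e where e: "arr e (aP X) (aP Y)" "ai Y \<cdot> f = e \<cdot> ai X"
    using left_approxD(3)[OF chosen_approx[OF X] ZZ_obj[OF X] aP_PP[OF Y]] by blast
  obtain f' where "arr f' (aN X) (aN Y)" "f' \<cdot> ap X = ap Y \<cdot> e" "Sm f \<cdot> ad X = ad Y \<cdot> f'"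
    using tri_complete_arr[OF tX tY f e(1) e(2)[symmetric]] by blast
  then show ?thesis using liftI[OF f e(1) _ e(2)[symmetric]] by blast
qed

text \<open>Since the connecting morphisms \<open>ad\<close> become invertible in \<open>T/S\<close>, this equation determines the
  image of a lift there.\<close>

lemma lift_loc:
  assumes l: "f' \<in> lifts X Y f" and o: "X \<in> ZZ" "Y \<in> ZZ"
  shows "Cmp V (loc (ad Y)) (loc f') = Cmp V (ShiftM V (loc f)) (loc (ad X))"
proof -
  note f = liftD[OF l o] and dX = tri_arr(3)[OF chosen_tri[OF o(1)]] and dY = tri_arr(3)[OF chosen_tri[OF o(2)]]
  have "Cmp V (loc (ad Y)) (loc f') = loc (ad Y \<cdot> f')" using f(2) dY by simp
  also have "\<dots> = loc (Sm f \<cdot> ad X)" using f(3) by simp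
  also have "\<dots> = Cmp V (loc (Sm f)) (loc (ad X))" using f(1) dX by simp
  finally show ?thesis using shift_loc[OF f(1)] by simp
qed

lemma loc_ad_cancel:
  assumes "Y \<in> ZZ" "V.arr a W (aN Y)" "V.arr b W (aN Y)"
    "Cmp V (loc (ad Y)) a = Cmp V (loc (ad Y)) b"
  shows "a = b"
  using V.iso_cancel_left[OF loc_den_iso[OF ad_den[OF assms(1)]] _ _ assms(2-4)]
    ZZ_obj[OF aN_ZZ[OF assms(1)]] ZZ_obj[OF assms(1)] by simp

lemma lift_unique:
  assumes l: "f' \<in> lifts X Y f" and l2: "f2' \<in> lifts X Y f2" and o: "X \<in> ZZ" "Y \<in> ZZ"
    and eq: "loc f = loc f2"
  shows "loc f' = loc f2'"
  using loc_ad_cancel[OF o(2) loc_arr[OF liftD(2)[OF l o]] loc_arr[OF liftD(2)[OF l2 o]]]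
    lift_loc[OF l o] lift_loc[OF l2 o] eq by simp

text \<open>\<open>ang_mor\<close> ranges over all representatives and all lifts;
  \<open>lift_unique\<close> shows that every choice gives the same class.\<close>

lemma am_ic:
  assumes o: "X \<in> ZZ" "Y \<in> ZZ" and l: "f' \<in> lifts X Y f"
  shows "am (ic f) = ic f'"
proof -
  note f = liftD[OF l o]
  have "k \<in> ic f'" if k: "k \<in> am (ic f)" for k
  proof -
    obtain X2 Y2 f2 f2' where f2: "X2 \<in> ZZ" "Y2 \<in> ZZ" "f2 \<in> ic f" "f2 \<in> Hom C X2 Y2"
      "f2' \<in> lifts X2 Y2 f2" "k \<in> ic f2'"
      using k unfolding ang_mor_def by blast
    have f2a: "arr f2 X Y" "loc f2 = loc f" using f2(3) ic_eq[OF o f(1)] by blast+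
    have "arr f2 X2 Y2" using f2 hom_arr ZZ_obj by blast
    then have eq: "X2 = X" "Y2 = Y" using arr_unique[OF f2a(1)] by simp_all
    note l2 = f2(5)[unfolded eq]
    have "ic f2' = ic f'"
      using ic_eq_iff[OF aN_ZZ[OF o(1)] aN_ZZ[OF o(2)] liftD(2)[OF l2 o] f(2)]
        lift_unique[OF l2 l o f2a(2)] by simp
    then show ?thesis using f2(6) by simp
  qed
  moreover have "k \<in> am (ic f)" if "k \<in> ic f'" for k
    unfolding ang_mor_def using that o ic_self[OF o f(1)] arr_hom[OF f(1)] l by blast
  ultimately show ?thesis by blast
qed

text \<open>Naturality of the comparison between <1> and [1]; functoriality of <1> and the third
  square of each isomorphism of triangles are derived from it.\<close>

lemma am_natural:
  assumes o: "X \<in> ZZ" "Y \<in> ZZ" and c: "Q.arr c X Y"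
  shows "Q.arr (am c) (aN X) (aN Y)"
    "Cmp V (loc (ad Y)) (ind (am c)) = Cmp V (ShiftM V (ind c)) (loc (ad X))"
proof -
  obtain f where f: "arr f X Y" "c = ic f" using Q_arrD c by blast
  obtain f' where l: "f' \<in> lifts X Y f" using ex_lift[OF o f(1)] by blast
  note f' = liftD(2)[OF l o]
  show "Q.arr (am c) (aN X) (aN Y)"
    unfolding f(2) am_ic[OF o l] by (rule Q_arrI[OF aN_ZZ[OF o(1)] aN_ZZ[OF o(2)] f'])
  show "Cmp V (loc (ad Y)) (ind (am c)) = Cmp V (ShiftM V (ind c)) (loc (ad X))"
    unfolding f(2) am_ic[OF o l] ind_ic[OF o f(1)] ind_ic[OF aN_ZZ[OF o(1)] aN_ZZ[OF o(2)] f']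
    by (rule lift_loc[OF l o])
qed

text \<open>\<open>loc (ad Y)\<close> is invertible and \<open>ind\<close> is faithful, so morphisms
  into Y<1> may be compared in \<open>V\<close> after composing with
  \<open>loc (ad Y)\<close>.\<close>

lemma ind_ad_cancel:
  assumes o: "W \<in> ZZ" "Y \<in> ZZ" and a: "Q.arr a W (aN Y)" "Q.arr b W (aN Y)"
    and eq: "Cmp V (loc (ad Y)) (ind a) = Cmp V (loc (ad Y)) (ind b)"
  shows "a = b"
proof -
  have "V.arr (ind a) W (aN Y)" "V.arr (ind b) W (aN Y)"
    using ind.map_arr[OF a(1)] ind.map_arr[OF a(2)] by simp_all
  then have "ind a = ind b" using loc_ad_cancel[OF o(2)] eq by blast
  then show ?thesis using ind_faithful a unfolding ind.faithful_def by blast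
qed

lemma ad_loc_arr: "X \<in> ZZ \<Longrightarrow> V.arr (loc (ad X)) (aN X) (Sh X)"
  using loc_arr[OF tri_arr(3)[OF chosen_tri]] .

lemma am_functor: "is_functor Q Q aN am"
proof (rule is_functorI)
  fix X assume "X \<in> Obj Q"
  then have X: "X \<in> ZZ" by simp
  have N: "aN X \<in> ZZ" using aN_ZZ[OF X] .
  have i: "Q.arr (Ident Q X) X X" using Q.ident_arr X by simp
  show "aN X \<in> Obj Q" using N by simp
  show "am (Ident Q X) = Ident Q (aN X)"
  proof (rule ind_ad_cancel[OF N X])
    show "Q.arr (am (Ident Q X)) (aN X) (aN X)" using am_natural(1)[OF X X i] .
    show "Q.arr (Ident Q (aN X)) (aN X) (aN X)" using Q.ident_arr N by simp
    show "Cmp V (loc (ad X)) (ind (am (Ident Q X))) = Cmp V (loc (ad X)) (ind (Ident Q (aN X)))"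
      unfolding am_natural(2)[OF X X i] using X N ad_loc_arr[OF X] ZZ_obj[OF X] by simp
  qed
next
  fix X Y c assume "X \<in> Obj Q" "Y \<in> Obj Q" "c \<in> Hom Q X Y"
  then show "am c \<in> Hom Q (aN X) (aN Y)"
    using am_natural(1)[of X Y c] unfolding Q.arr_def Q_obj by blast
next
  fix X Y Z c d assume "X \<in> Obj Q" "Y \<in> Obj Q" "Z \<in> Obj Q" "c \<in> Hom Q X Y" "d \<in> Hom Q Y Z"
  then have o: "X \<in> ZZ" "Y \<in> ZZ" "Z \<in> ZZ" and c: "Q.arr c X Y" and d: "Q.arr d Y Z"
    unfolding Q.arr_def Q_obj by blast+
  have cd: "Q.arr (Cmp Q d c) X Z" using c d by simp
  note n = am_natural[OF o(1,2) c] am_natural[OF o(2,3) d] am_natural[OF o(1,3) cd]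
  note t = ad_loc_arr[OF o(1)] ad_loc_arr[OF o(2)] ad_loc_arr[OF o(3)] ind.map_arr[OF c] ind.map_arr[OF d]
    ind.map_arr[OF n(1)] ind.map_arr[OF n(3)]
  show "am (Cmp Q d c) = Cmp Q (am d) (am c)"
  proof (rule ind_ad_cancel[OF aN_ZZ[OF o(1)] o(3) n(5)])
    show "Q.arr (Cmp Q (am d) (am c)) (aN X) (aN Z)" using n(1,3) by simp
    have "Cmp V (loc (ad Z)) (ind (am (Cmp Q d c)))
        = Cmp V (ShiftM V (Cmp V (ind d) (ind c))) (loc (ad X))"
      unfolding n(6) using c d by simp
    also have "\<dots> = Cmp V (ShiftM V (ind d)) (Cmp V (ShiftM V (ind c)) (loc (ad X)))"
      using t by simp
    also have "\<dots> = Cmp V (Cmp V (ShiftM V (ind d)) (loc (ad Y))) (ind (am c))"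
      unfolding n(2)[symmetric] using t by simp
    also have "\<dots> = Cmp V (loc (ad Z)) (Cmp V (ind (am d)) (ind (am c)))"
      unfolding n(4)[symmetric] using t by simp
    also have "Cmp V (ind (am d)) (ind (am c)) = ind (Cmp Q (am d) (am c))" using n(1,3) by simp
    finally show "Cmp V (loc (ad Z)) (ind (am (Cmp Q d c))) = Cmp V (loc (ad Z)) (ind (Cmp Q (am d) (am c)))" .
  qed
qed

section \<open>The shift of Z/[P] is an additive auto-equivalence\<close>

sublocale ang: functor_pair Q Q aN am
  by unfold_locales (rule am_functor)

text \<open>For f' : X<1> -> Y<1> the composite from the approximating object of X to Y[1] vanishes
  by \<open>shifted_XX_no_hom\<close>. Hence f' fits into a morphism of the chosen triangles, whose
  first component is the preimage.\<close>

lemma am_full: "ang.full"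
  unfolding ang.full_def
proof (intro ballI allI impI)
  fix X Y c assume "X \<in> Obj Q" "Y \<in> Obj Q" and c: "Q.arr c (aN X) (aN Y)"
  then have o: "X \<in> ZZ" "Y \<in> ZZ" by simp_all
  note tX = chosen_tri[OF o(1)] and tY = chosen_tri[OF o(2)]
  obtain f' where f': "arr f' (aN X) (aN Y)" "c = ic f'" using Q_arrD c by blast
  have "arr (ad Y \<cdot> (f' \<cdot> ap X)) (aP X) (Sh Y)" using f'(1) tri_arr[OF tX] tri_arr[OF tY] by simp
  then have "ad Y \<cdot> (f' \<cdot> ap X) = zero (aP X) (Sh Y)"
    using no_homD shifted_XX_no_hom PP_shifted aP_PP o ZZ_iff by blast
  then obtain e where e: "arr e (aP X) (aP Y)" "f' \<cdot> ap X = ap Y \<cdot> e"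
    using exact_right[OF tY cmp_arr[OF tri_arr(2)[OF tX] f'(1)]] by blast
  obtain f where f: "arr f X Y" "e \<cdot> ai X = ai Y \<cdot> f" "Sm f \<cdot> ad X = ad Y \<cdot> f'"
    using tri_complete_left[OF tX tY e(1) f'(1) e(2)] by blast
  have "f' \<in> lifts X Y f" using liftI[OF f(1) e(1) f'(1) f(2) e(2) f(3)] .
  then have "am (ic f) = c" using am_ic[OF o] f'(2) by simp
  then show "\<exists>f. Q.arr f X Y \<and> am f = c" using Q_arrI[OF o f(1)] by blast
qed

lemma loc_shift_dif:
  assumes f: "arr f X Y" "arr g X Y" and d: "arr d N (Sh X)" and eq: "loc (Sm f \<cdot> d) = loc (Sm g \<cdot> d)"
  shows "loc (Sm (dif f g) \<cdot> d) = loc (zero N (Sh Y))"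
proof -
  have "Sm (dif f g) \<cdot> d = dif (Sm f \<cdot> d) (Sm g \<cdot> d)" unfolding dif_def using f d by simp
  moreover have "arr (Sm f \<cdot> d) N (Sh Y)" "arr (Sm g \<cdot> d) N (Sh Y)" using f d by simp_all
  ultimately show ?thesis using loc_eq_dif eq by metis
qed

text \<open>If f and g have the same image, a lift \<open>k\<close> of f - g becomes zero in
  \<open>V\<close>, so it factors through \<open>PP\<close>. Objects of \<open>PP\<close> have no
  maps to Y[1], hence \<open>ad Y \<cdot> k\<close> vanishes in \<open>C\<close> itself; then f - g
  extends along \<open>ai X\<close>, that is, it factors through \<open>PP\<close>.\<close>

lemma am_faithful: "ang.faithful"
  unfolding ang.faithful_def
proof (intro allI impI)
  fix X Y c c2 assume c: "Q.arr c X Y" "Q.arr c2 X Y" and eq: "am c = am c2"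
  have o: "X \<in> ZZ" "Y \<in> ZZ" using c(1) by simp_all
  note tX = chosen_tri[OF o(1)] and tY = chosen_tri[OF o(2)]
  note dX = tri_arr(3)[OF tX] and dY = tri_arr(3)[OF tY]
  obtain f where f: "arr f X Y" "c = ic f" using Q_arrD c by blast
  obtain g where g: "arr g X Y" "c2 = ic g" using Q_arrD c by blast
  have h: "arr (dif f g) X Y" using f g by simp
  obtain k where l: "k \<in> lifts X Y (dif f g)" using ex_lift[OF o h] by blast
  note k = liftD(2,3)[OF l o]
  have "Cmp V (ShiftM V (ind c)) (loc (ad X)) = Cmp V (ShiftM V (ind c2)) (loc (ad X))"
    using am_natural(2)[OF o c(1)] am_natural(2)[OF o c(2)] eq by simp
  then have "Cmp V (loc (Sm f)) (loc (ad X)) = Cmp V (loc (Sm g)) (loc (ad X))"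
    unfolding f(2) g(2) ind_ic[OF o f(1)] ind_ic[OF o g(1)] shift_loc[OF f(1)] shift_loc[OF g(1)] .
  then have fg: "loc (Sm f \<cdot> ad X) = loc (Sm g \<cdot> ad X)" using f(1) g(1) dX by simp
  have z: "arr (zero (aN X) (aN Y)) (aN X) (aN Y)" using dX dY by simp
  have "loc (ad Y \<cdot> k) = loc (zero (aN X) (Sh Y))"
    using loc_shift_dif[OF f(1) g(1) dX fg] k(2) by simp
  also have "\<dots> = loc (ad Y \<cdot> zero (aN X) (aN Y))" using dX dY by simp
  finally have "Cmp V (loc (ad Y)) (loc k) = Cmp V (loc (ad Y)) (loc (zero (aN X) (aN Y)))"
    using loc_cmp[OF k(1) dY] loc_cmp[OF z dY] by metis
  moreover have "V.arr (loc (zero (aN X) (aN Y))) (aN X) (aN Y)" using dX dY by simp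
  ultimately have "loc k = loc (zero (aN X) (aN Y))"
    using loc_ad_cancel[OF o(2) loc_arr[OF k(1)]] by blast
  then have "k \<in> factoring C PP (aN X) (aN Y)" using loc_kernel[OF aN_ZZ[OF o(1)] aN_ZZ[OF o(2)] k(1)] by blast
  then obtain P a b where P: "P \<in> PP" "arr a (aN X) P" "arr b P (aN Y)" "k = b \<cdot> a"
    using factoring_iff ZZ_obj aN_ZZ o by blast
  have "ad Y \<cdot> b = zero P (Sh Y)"
    using no_homD[OF shifted_XX_no_hom[OF PP_shifted[OF P(1)]]] cmp_arr[OF P(3) dY] o(2) ZZ_iff by blast
  then have "Sm (dif f g) \<cdot> ad X = zero (aN X) (Sh Y)"
    unfolding k(2) P(4) using cmp_pre[of "ad Y" b "zero P (Sh Y)" a] P(2,3) dY by simp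
  then obtain m where m: "arr m (aP X) Y" "dif f g = m \<cdot> ai X" using coexact_left[OF tX h] by blast
  have "loc (dif f g) = loc (zero X Y)"
    unfolding m(2) by (rule loc_zero_S[OF tri_arr(1)[OF tX] m(1) PP_S[OF aP_PP[OF o(1)]]])
  then have "loc f = loc g" using loc_eq_dif[OF f(1) g(1)] by blast
  then show "c = c2" unfolding f(2) g(2) using ic_eq_iff[OF o f(1) g(1)] by blast
qed

lemma am_dense: "ang.dense"
  unfolding ang.dense_def
proof
  fix Y assume "Y \<in> Obj Q"
  then have Y: "Y \<in> ZZ" by simp
  \<comment> \<open>Y is isomorphic to some W[1], and W to some M of \<open>ZZ\<close> in the
    quotient; then M<1>, M[1], W[1] and Y are isomorphic there.\<close>
  obtain W e where W: "W \<in> Obj C" "is_iso C (Sh W) Y e" using shift_dense ZZ_obj[OF Y] by blast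
  obtain M c where M: "M \<in> ZZ" "is_iso V M W c" using loc_dense[OF W(1)] by blast
  have o: "M \<in> Obj V" "W \<in> Obj V" "Y \<in> Obj V" "Sh M \<in> Obj V" "Sh W \<in> Obj V" "aN M \<in> Obj V"
    using ZZ_obj M(1) W(1) Y aN_ZZ[OF M(1)] by simp_all
  have "is_iso V (Sh W) Y (loc e)" using loc.map_iso[OF W(2)] o by simp
  from V.iso_cmp[OF Vshift.map_iso[OF M(2) o(1,2)] this o(4,5,3)]
  obtain c1 where "is_iso V (Sh M) Y c1" by blast
  from V.iso_cmp[OF loc_den_iso[OF ad_den[OF M(1)]] this o(6,4,3)]
  obtain k where k: "is_iso V (aN M) Y k" by blast
  have "V.arr k (aN M) Y" using V.is_isoD[OF k o(6,3)] by blast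
  then obtain m where m: "Q.arr m (aN M) Y" "ind m = k"
    using ind_full Y aN_ZZ[OF M(1)] unfolding ind.full_def by simp metis
  have "is_iso Q (aN M) Y m" using ind.reflect_iso[OF ind_faithful ind_full m(1)] k m(2) by simp
  then show "\<exists>X\<in>Obj Q. \<exists>h. is_iso Q (aN X) Y h" using M(1) by auto
qed

theorem am_additive_equivalence: "additive_equivalence Q Q aN am"
  unfolding additive_equivalence_def
proof (intro conjI ballI)
  show "is_equivalence Q Q aN am" using ang.equivalence_if am_faithful am_full am_dense by blast
  fix X Y c c2 assume "X \<in> Obj Q" "Y \<in> Obj Q" and c: "c \<in> Hom Q X Y" "c2 \<in> Hom Q X Y"
  then have o: "X \<in> ZZ" "Y \<in> ZZ" by simp_all
  note N = aN_ZZ[OF o(1)] aN_ZZ[OF o(2)]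
  note dX = tri_arr(3)[OF chosen_tri[OF o(1)]] and dY = tri_arr(3)[OF chosen_tri[OF o(2)]]
  obtain f where f: "arr f X Y" "c = ic f" using Q_homD c o by blast
  obtain g where g: "arr g X Y" "c2 = ic g" using Q_homD c o by blast
  note fg = add_arr[OF f(1) g(1)]
  obtain f' where f': "f' \<in> lifts X Y f" using ex_lift[OF o f(1)] by blast
  obtain g' where g': "g' \<in> lifts X Y g" using ex_lift[OF o g(1)] by blast
  obtain h' where h': "h' \<in> lifts X Y (add f g)" using ex_lift[OF o fg] by blast
  note lf = liftD(2,3)[OF f' o] and lg = liftD(2,3)[OF g' o] and lh = liftD(2,3)[OF h' o]
  \<comment> \<open>Compatibility with the connecting maps is enough: \<open>h'\<close> and the sum
    of lifts agree after composing with \<open>ad Y\<close>, which can be cancelled in the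
    quotient.\<close>
  have "ad Y \<cdot> h' = add (Sm f) (Sm g) \<cdot> ad X" using lh(2) f(1) g(1) by simp
  also have "\<dots> = add (ad Y \<cdot> f') (ad Y \<cdot> g')" using lf(2) lg(2) f(1) g(1) dX by simp
  also have "\<dots> = ad Y \<cdot> add f' g'" using lf(1) lg(1) dY by simp
  finally have "loc (ad Y \<cdot> h') = loc (ad Y \<cdot> add f' g')" by simp
  then have "Cmp V (loc (ad Y)) (loc h') = Cmp V (loc (ad Y)) (loc (add f' g'))"
    using loc_cmp[OF lh(1) dY] loc_cmp[OF add_arr[OF lf(1) lg(1)] dY] by metis
  then have "loc h' = loc (add f' g')"
    using loc_ad_cancel[OF o(2) loc_arr[OF lh(1)] loc_arr[OF add_arr[OF lf(1) lg(1)]]] by blast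
  then have "ic h' = ic (add f' g')" using ic_eq_iff[OF N lh(1) add_arr[OF lf(1) lg(1)]] by blast
  then show "am (Plus Q c c2) = Plus Q (am c) (am c2)"
    unfolding f(2) g(2) Q_plus[OF o f(1) g(1)] am_ic[OF o f'] am_ic[OF o g'] am_ic[OF o h']
      Q_plus[OF N lf(1) lg(1)] .
qed

text \<open>\<open>ai X\<close> extends along \<open>f\<close> once it vanishes on the fibre W of
  \<open>f\<close>. As W[1] is isomorphic to Z, the obstruction lies in Hom(Z, P[1]), which is zero
  for Z in \<open>ZZ\<close> and P in \<open>YY\<close>.\<close>

lemma ex_ang_data:
  assumes o: "X \<in> ZZ" "Y \<in> ZZ" "Z \<in> ZZ" and t: "(X, Y, Z, f, g, h) \<in> Tri C"
  shows "\<exists>a. ang_data C ZZ \<Delta> (X, Y, Z, f, g, h) a"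
proof -
  note tX = chosen_tri[OF o(1)] and ta = tri_arr[OF t] and Z = ZZ_obj[OF o(3)]
  obtain W e where W: "W \<in> Obj C" "is_iso C (Sh W) Z e" "\<exists>u v. (W, X, Y, u, f, v) \<in> Tri C"
    using fibre[OF t] by blast
  then obtain u v where uv: "(W, X, Y, u, f, v) \<in> Tri C" by blast
  note tu = tri_arr[OF uv] and iX = tri_arr(1)[OF tX]
  obtain d where d: "is_iso C Z (Sh W) d" using iso_inverse[OF W(2)] W(1) Z shift.obj_map by blast
  have "no_hom (Sh W) (Sh (aP X))"
    using no_hom_iso_left[OF d Z shift.obj_map[OF W(1)]] o(3) PP_YY[OF aP_PP[OF o(1)]]
    unfolding ZZ_iff perp_Y1_def by blast
  then have "no_hom W (aP X)" using no_hom_shift[OF W(1) PP_obj[OF aP_PP[OF o(1)]]] by blast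
  then have "ai X \<cdot> u = zero W (aP X)" using no_homD cmp_arr[OF tu(1) iX] by blast
  then obtain b where b: "arr b Y (aP X)" "ai X = b \<cdot> f" using coexact_mid[OF uv iX] by blast
  have bf: "b \<cdot> f = ai X \<cdot> Ident C X" using b(2) iX by simp
  obtain a where a: "arr a Z (aN X)" "a \<cdot> g = ap X \<cdot> b" "Sm (Ident C X) \<cdot> h = ad X \<cdot> a"
    using tri_complete_arr[OF t tX ident_arr[OF ZZ_obj[OF o(1)]] b(1) bf] by blast
  have "tri_hom C (X, Y, Z, f, g, h) (tri_of \<Delta> X) (Ident C X) b a"
    unfolding tri_of_eq by (rule tri_homI[OF ident_arr[OF ZZ_obj[OF o(1)]] b(1) a(1) bf a(2,3)])
  then show ?thesis unfolding ang_data_def using o t by blast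
qed

text \<open>The relation \<open>h = ad X \<cdot> a\<close> is what the comparison with the quotient
  uses: it says that the connecting map is \<open>a\<close> followed by the identification of X<1>
  with X[1].\<close>

lemma ang_dataD:
  assumes "ang_data C ZZ \<Delta> (X, Y, Z, f, g, h) a"
  shows "X \<in> ZZ" "Y \<in> ZZ" "Z \<in> ZZ" "(X, Y, Z, f, g, h) \<in> Tri C" "arr a Z (aN X)" "h = ad X \<cdot> a"
proof -
  show o: "X \<in> ZZ" "Y \<in> ZZ" "Z \<in> ZZ" and t: "(X, Y, Z, f, g, h) \<in> Tri C"
    using assms unfolding ang_data_def by simp_all
  obtain b where "tri_hom C (X, Y, Z, f, g, h) (tri_of \<Delta> X) (Ident C X) b a"
    using assms unfolding ang_data_def by auto
  then have a: "a \<in> Hom C Z (aN X)" "Sm (Ident C X) \<cdot> h = ad X \<cdot> a"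
    unfolding tri_of_eq tri_hom.simps by blast+
  show "arr a Z (aN X)" using a(1) hom_arr ZZ_obj o aN_ZZ by blast
  show "h = ad X \<cdot> a" using a(2) tri_arr(1,3)[OF t] by simp
qed

section \<open>Comparison of the triangles of Z/[P] with those of the quotient\<close>

abbreviation "A \<equiv> ang C ZZ PP \<Delta>"

lemma ang_fields [simp]:
  "Obj A = ZZ" "Hom A = Hom Q" "Ident A = Ident Q" "Cmp A = Cmp Q" "Plus A = Plus Q"
  "Shift A = aN" "ShiftM A = am"
  "Obj (ang_pre C ZZ PP \<Delta>) = ZZ" "Hom (ang_pre C ZZ PP \<Delta>) = Hom Q"
  "Ident (ang_pre C ZZ PP \<Delta>) = Ident Q" "Cmp (ang_pre C ZZ PP \<Delta>) = Cmp Q"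
  "Shift (ang_pre C ZZ PP \<Delta>) = aN" "ShiftM (ang_pre C ZZ PP \<Delta>) = am"
  by (simp_all add: ang_def ang_pre_def)

lemma ang_is_iso [simp]: "is_iso A = is_iso Q" "is_iso (ang_pre C ZZ PP \<Delta>) = is_iso Q"
  by (simp_all add: is_iso_def fun_eq_iff)

lemma pre_is_iso [simp]: "is_iso (verdier_pre C S) = is_iso V"
  by (simp add: is_iso_def fun_eq_iff)

lemma ang_diagrams:
  "(X, Y, Z, u, v, w) \<in> diagrams A \<longleftrightarrow> Q.arr u X Y \<and> Q.arr v Y Z \<and> Q.arr w Z (aN X)"
  "diagrams (ang_pre C ZZ PP \<Delta>) = diagrams A"
  unfolding diagrams_def Q.arr_def using aN_ZZ by auto

text \<open>Isomorphism of diagrams ignores the field \<open>Tri\<close>, so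
  \<open>verdier_pre\<close> may be replaced by \<open>V\<close> in the definition.\<close>

lemma verdier_tri_iff:
  "(X, Y, Z, u, v, w) \<in> Tri V \<longleftrightarrow> V.arr u X Y \<and> V.arr v Y Z \<and> V.arr w Z (Sh X) \<and>
    (\<exists>X' Y' Z' f g h. (X', Y', Z', f, g, h) \<in> Tri C \<and>
       tri_iso V (X', Y', Z', loc f, loc g, loc h) (X, Y, Z, u, v, w))"
proof -
  have "tri_iso (verdier_pre C S) = tri_iso V"
    by (simp add: fun_eq_iff)
  moreover have "(X, Y, Z, u, v, w) \<in> diagrams (verdier_pre C S) \<longleftrightarrow>
      V.arr u X Y \<and> V.arr v Y Z \<and> V.arr w Z (Sh X)"
    unfolding diagrams_def V.arr_def by auto
  moreover have "Tri V = {D \<in> diagrams (verdier_pre C S). \<exists>X Y Z f g h. (X, Y, Z, f, g, h) \<in> Tri C \<and>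
      tri_iso (verdier_pre C S) (X, Y, Z, loc f, loc g, loc h) D}"
    by (simp add: verdier_def)
  ultimately show ?thesis by (simp only: mem_Collect_eq conj_assoc)
qed

lemma ang_tri_iff:
  "(X, Y, Z, u, v, w) \<in> Tri A \<longleftrightarrow> Q.arr u X Y \<and> Q.arr v Y Z \<and> Q.arr w Z (aN X) \<and>
    (\<exists>X' Y' Z' f g h a. ang_data C ZZ \<Delta> (X', Y', Z', f, g, h) a \<and>
       tri_iso A (X', Y', Z', ic f, ic g, ic a) (X, Y, Z, u, v, w))"
proof -
  have "tri_iso (ang_pre C ZZ PP \<Delta>) = tri_iso A" by (simp add: fun_eq_iff)
  moreover have "Tri A = {D \<in> diagrams (ang_pre C ZZ PP \<Delta>). \<exists>X Y Z f g h a.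
      ang_data C ZZ \<Delta> (X, Y, Z, f, g, h) a \<and>
      tri_iso (ang_pre C ZZ PP \<Delta>) (X, Y, Z, ic f, ic g, ic a) D}"
    by (simp add: ang_def)
  ultimately show ?thesis by (simp only: ang_diagrams mem_Collect_eq conj_assoc)
qed

lemma ang_tri_verdier:
  assumes D: "(X, Y, Z, u, v, w) \<in> Tri A"
  shows "(X, Y, Z, ind u, ind v, Cmp V (loc (ad X)) (ind w)) \<in> Tri V"
proof -
  have uvw: "Q.arr u X Y" "Q.arr v Y Z" "Q.arr w Z (aN X)" using D unfolding ang_tri_iff by blast+
  obtain X' Y' Z' f g h a where dat: "ang_data C ZZ \<Delta> (X', Y', Z', f, g, h) a"
    and i: "tri_iso A (X', Y', Z', ic f, ic g, ic a) (X, Y, Z, u, v, w)"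
    using D unfolding ang_tri_iff by blast
  note d = ang_dataD[OF dat] and t = tri_arr[OF ang_dataD(4)[OF dat]]
  have o: "X \<in> ZZ" "Y \<in> ZZ" "Z \<in> ZZ" using uvw by simp_all
  obtain \<alpha> \<beta> \<gamma> where iso: "is_iso Q X' X \<alpha>" "is_iso Q Y' Y \<beta>" "is_iso Q Z' Z \<gamma>"
    and sq: "Cmp Q \<beta> (ic f) = Cmp Q u \<alpha>" "Cmp Q \<gamma> (ic g) = Cmp Q v \<beta>"
      "Cmp Q (am \<alpha>) (ic a) = Cmp Q w \<gamma>"
    using i unfolding tri_iso.simps tri_hom.simps by auto
  have \<alpha>: "Q.arr \<alpha> X' X" and \<beta>: "Q.arr \<beta> Y' Y" and \<gamma>: "Q.arr \<gamma> Z' Z"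
    using Q.is_isoD iso o d(1-3) Q_obj by metis+
  note F = ind.map_cmp
  have ta: "Q.arr (ic f) X' Y'" "Q.arr (ic g) Y' Z'" "Q.arr (ic a) Z' (aN X')"
    using Q_arrI d(1-3,5) t aN_ZZ by blast+
  have il: "ind (ic f) = loc f" "ind (ic g) = loc g" "ind (ic a) = loc a"
    using ind_ic d(1-3,5) t aN_ZZ by blast+
  note n = am_natural[OF d(1) o(1) \<alpha>]
  note ty = ind.map_arr[OF \<alpha>] ind.map_arr[OF \<beta>] ind.map_arr[OF \<gamma>] ind.map_arr[OF uvw(1)]
    ind.map_arr[OF uvw(2)] ind.map_arr[OF uvw(3)] ad_loc_arr[OF o(1)] ad_loc_arr[OF d(1)]
    ind.map_arr[OF n(1)] loc_arr[OF d(5)]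
  have s1: "Cmp V (ind \<beta>) (loc f) = Cmp V (ind u) (ind \<alpha>)"
    using F[of "ic f" \<beta>] F[of \<alpha> u] sq(1) ta(1) \<alpha> \<beta> uvw(1) il(1) by simp
  have s2: "Cmp V (ind \<gamma>) (loc g) = Cmp V (ind v) (ind \<beta>)"
    using F[of "ic g" \<gamma>] F[of \<beta> v] sq(2) ta(2) \<gamma> \<beta> uvw(2) il(2) by simp
  have s3': "Cmp V (ind (am \<alpha>)) (loc a) = Cmp V (ind w) (ind \<gamma>)"
    using F[of "ic a" "am \<alpha>"] F[of \<gamma> w] sq(3) ta(3) \<gamma> n(1) uvw(3) il(3) by simp
  \<comment> \<open>\<open>loc h\<close> splits as \<open>loc (ad X')\<close> after
    \<open>loc a\<close>; naturality moves the connecting isomorphism from X' to X.\<close>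
  have "Cmp V (ShiftM V (ind \<alpha>)) (loc h) = Cmp V (Cmp V (ShiftM V (ind \<alpha>)) (loc (ad X'))) (loc a)"
    unfolding d(6) loc_cmp[OF d(5) tri_arr(3)[OF chosen_tri[OF d(1)]]] using ty by simp
  also have "\<dots> = Cmp V (loc (ad X)) (Cmp V (ind (am \<alpha>)) (loc a))"
    unfolding n(2)[symmetric] using ty by simp
  also have "\<dots> = Cmp V (Cmp V (loc (ad X)) (ind w)) (ind \<gamma>)"
    unfolding s3' using ty by simp
  finally have s3: "Cmp V (ShiftM V (ind \<alpha>)) (loc h) = Cmp V (Cmp V (loc (ad X)) (ind w)) (ind \<gamma>)" .
  have "is_iso V X' X (ind \<alpha>)" "is_iso V Y' Y (ind \<beta>)" "is_iso V Z' Z (ind \<gamma>)"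
    using ind.map_iso[OF iso(1)] ind.map_iso[OF iso(2)] ind.map_iso[OF iso(3)] o d(1-3) by simp_all
  then have "tri_iso V (X', Y', Z', loc f, loc g, loc h)
      (X, Y, Z, ind u, ind v, Cmp V (loc (ad X)) (ind w))"
    unfolding tri_iso.simps tri_hom.simps using s1 s2 s3 is_iso_def by metis
  moreover have "V.arr (ind u) X Y" "V.arr (ind v) Y Z" "V.arr (Cmp V (loc (ad X)) (ind w)) Z (Sh X)"
    using ty by simp_all
  ultimately show ?thesis unfolding verdier_tri_iff using d(4) by blast
qed

text \<open>The triangle is replaced by one with all terms in \<open>ZZ\<close>. The isomorphism
  with it lifts along the full and faithful \<open>ind\<close>, and its squares are verified in the
  quotient.\<close>

lemma verdier_tri_ang:
  assumes uvw: "Q.arr u X Y" "Q.arr v Y Z" "Q.arr w Z (aN X)"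
    and D: "(X, Y, Z, ind u, ind v, Cmp V (loc (ad X)) (ind w)) \<in> Tri V"
  shows "(X, Y, Z, u, v, w) \<in> Tri A"
proof -
  have o: "X \<in> ZZ" "Y \<in> ZZ" "Z \<in> ZZ" using uvw by simp_all
  let ?w = "Cmp V (loc (ad X)) (ind w)"
  have Dv: "V.arr (ind u) X Y" "V.arr (ind v) Y Z" "V.arr ?w Z (Sh X)"
    using D unfolding verdier_tri_iff by blast+
  obtain X0 Y0 Z0 f0 g0 h0 where t0: "(X0, Y0, Z0, f0, g0, h0) \<in> Tri C"
    and i0: "tri_iso V (X0, Y0, Z0, loc f0, loc g0, loc h0) (X, Y, Z, ind u, ind v, ?w)"
    using D unfolding verdier_tri_iff by blast
  obtain X' Y' Z' f g h where o': "X' \<in> ZZ" "Y' \<in> ZZ" "Z' \<in> ZZ" and t': "(X', Y', Z', f, g, h) \<in> Tri C"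
    and i': "tri_iso V (X', Y', Z', loc f, loc g, loc h) (X0, Y0, Z0, loc f0, loc g0, loc h0)"
    using ZZ_model[OF t0] by blast
  have "tri_iso V (X', Y', Z', loc f, loc g, loc h) (X, Y, Z, ind u, ind v, ?w)"
    by (rule tri_iso_trans[OF i' i0 loc_tri_arr[OF t'] loc_tri_arr[OF t0] Dv])
  then obtain a1 b1 c1 where iso1: "is_iso V X' X a1" "is_iso V Y' Y b1" "is_iso V Z' Z c1"
    and sq: "Cmp V b1 (loc f) = Cmp V (ind u) a1" "Cmp V c1 (loc g) = Cmp V (ind v) b1"
      "Cmp V (ShiftM V a1) (loc h) = Cmp V ?w c1"
    unfolding tri_iso.simps tri_hom.simps by blast
  have lift: "\<exists>\<alpha>. Q.arr \<alpha> W W' \<and> ind \<alpha> = c \<and> is_iso Q W W' \<alpha>"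
    if W: "is_iso V W W' c" "W \<in> ZZ" "W' \<in> ZZ" for W W' c
  proof -
    have "V.arr c W W'" using V.is_isoD[OF W(1)] W(2,3) ZZ_obj verdier_fields(1) by metis
    then have "V.arr c (id W) (id W')" by simp
    then obtain \<alpha> where "Q.arr \<alpha> W W'" "ind \<alpha> = c"
      using ind_full W(2,3) unfolding ind.full_def Q_obj by blast
    then show ?thesis using ind.reflect_iso[OF ind_faithful ind_full, of \<alpha> W W'] W(1) by auto
  qed
  obtain \<alpha> where \<alpha>: "Q.arr \<alpha> X' X" "ind \<alpha> = a1" "is_iso Q X' X \<alpha>" using lift[OF iso1(1) o'(1) o(1)] by blast
  obtain \<beta> where \<beta>: "Q.arr \<beta> Y' Y" "ind \<beta> = b1" "is_iso Q Y' Y \<beta>" using lift[OF iso1(2) o'(2) o(2)] by blast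
  obtain \<gamma> where \<gamma>: "Q.arr \<gamma> Z' Z" "ind \<gamma> = c1" "is_iso Q Z' Z \<gamma>" using lift[OF iso1(3) o'(3) o(3)] by blast
  \<comment> \<open>The third map of the model must end in X'<1>; its connecting map
    \<open>h\<close> factors as \<open>ad X' \<cdot> a\<close>.\<close>
  obtain a where dat: "ang_data C ZZ \<Delta> (X', Y', Z', f, g, h) a" using ex_ang_data[OF o' t'] by blast
  note d = ang_dataD[OF dat] and t = tri_arr[OF t'] and F = ind.map_cmp
  have ta: "Q.arr (ic f) X' Y'" "Q.arr (ic g) Y' Z'" "Q.arr (ic a) Z' (aN X')"
    using Q_arrI o' d(5) t aN_ZZ by blast+
  have il: "ind (ic f) = loc f" "ind (ic g) = loc g" "ind (ic a) = loc a"
    using ind_ic o' d(5) t aN_ZZ by blast+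
  have eq: "c = c'" if "Q.arr c W W'" "Q.arr c' W W'" "ind c = ind c'" for c c' W W'
    using ind_faithful that unfolding ind.faithful_def by blast
  note n = am_natural[OF o'(1) o(1) \<alpha>(1)]
  note ty = ind.map_arr[OF \<alpha>(1)] ind.map_arr[OF \<beta>(1)] ind.map_arr[OF \<gamma>(1)] ind.map_arr[OF uvw(1)]
    ind.map_arr[OF uvw(2)] ind.map_arr[OF uvw(3)] ad_loc_arr[OF o(1)] ad_loc_arr[OF o'(1)]
    ind.map_arr[OF n(1)] loc_arr[OF d(5)]
  have s1: "Cmp Q \<beta> (ic f) = Cmp Q u \<alpha>"
  proof (rule eq)
    show "Q.arr (Cmp Q \<beta> (ic f)) X' Y" "Q.arr (Cmp Q u \<alpha>) X' Y" using \<alpha>(1) \<beta>(1) ta uvw by simp_all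
    show "ind (Cmp Q \<beta> (ic f)) = ind (Cmp Q u \<alpha>)"
      using F[of "ic f" \<beta>] F[of \<alpha> u] sq(1) ta(1) \<alpha>(1,2) \<beta>(1,2) uvw(1) il(1) by simp
  qed
  have s2: "Cmp Q \<gamma> (ic g) = Cmp Q v \<beta>"
  proof (rule eq)
    show "Q.arr (Cmp Q \<gamma> (ic g)) Y' Z" "Q.arr (Cmp Q v \<beta>) Y' Z" using \<gamma>(1) \<beta>(1) ta uvw by simp_all
    show "ind (Cmp Q \<gamma> (ic g)) = ind (Cmp Q v \<beta>)"
      using F[of "ic g" \<gamma>] F[of \<beta> v] sq(2) ta(2) \<gamma>(1,2) \<beta>(1,2) uvw(2) il(2) by simp
  qed
  have s3: "Cmp Q (am \<alpha>) (ic a) = Cmp Q w \<gamma>"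
  proof (rule ind_ad_cancel[OF o'(3) o(1)])
    show "Q.arr (Cmp Q (am \<alpha>) (ic a)) Z' (aN X)" "Q.arr (Cmp Q w \<gamma>) Z' (aN X)"
      using n(1) \<gamma>(1) ta uvw by simp_all
    have "Cmp V (loc (ad X)) (ind (Cmp Q (am \<alpha>) (ic a)))
        = Cmp V (Cmp V (loc (ad X)) (ind (am \<alpha>))) (loc a)"
      using F[of "ic a" "am \<alpha>"] n(1) ta(3) il(3) ty by simp
    also have "\<dots> = Cmp V (ShiftM V a1) (loc h)"
      unfolding n(2) \<alpha>(2) d(6) loc_cmp[OF d(5) tri_arr(3)[OF chosen_tri[OF o'(1)]]]
      using ty \<alpha>(2) by simp
    also have "\<dots> = Cmp V (loc (ad X)) (Cmp V (ind w) (ind \<gamma>))" unfolding sq(3) \<gamma>(2)[symmetric] using ty by simp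
    also have "Cmp V (ind w) (ind \<gamma>) = ind (Cmp Q w \<gamma>)" using F[of \<gamma> w] \<gamma>(1) uvw(3) by simp
    finally show "Cmp V (loc (ad X)) (ind (Cmp Q (am \<alpha>) (ic a))) = Cmp V (loc (ad X)) (ind (Cmp Q w \<gamma>))" .
  qed
  have "tri_iso A (X', Y', Z', ic f, ic g, ic a) (X, Y, Z, u, v, w)"
    unfolding tri_iso.simps tri_hom.simps ang_fields ang_is_iso
    using s1 s2 s3 \<alpha>(1,3) \<beta>(1,3) \<gamma>(1,3) Q.arr_hom by blast
  then show ?thesis unfolding ang_tri_iff using uvw dat by blast
qed

text \<open>The required natural isomorphism is the localised connecting morphism X<1> -> X[1] of
  the chosen triangle.\<close>

theorem ang_transported: "transported_structure A V id ind"
  unfolding transported_structure_def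
proof (intro conjI exI[of _ "\<lambda>X. loc (ad X)"] allI impI)
  show "additive_equivalence A V id ind"
    using ind_additive_equivalence
    by (simp add: additive_equivalence_def is_equivalence_def is_functor_def natural_iso_def)
  show "is_functor A A (Shift A) (ShiftM A)"
    using am_functor by (simp add: is_functor_def)
  show "Tri A \<subseteq> diagrams A"
    using ang_diagrams(1) ang_tri_iff by (intro subsetI) (metis prod_cases6)
  show "natural_iso A V (id \<circ> Shift A) (ind \<circ> ShiftM A) (Shift V \<circ> id) (ShiftM V \<circ> ind) (\<lambda>X. loc (ad X))"
    unfolding natural_iso_def comp_def id_def ang_fields verdier_fields
  proof (intro conjI ballI)
    fix X assume "X \<in> ZZ"
    then show "is_iso V (aN X) (Sh X) (loc (ad X))" using loc_den_iso ad_den by blast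
  next
    fix X Y c assume o: "X \<in> ZZ" "Y \<in> ZZ" and "c \<in> Hom Q X Y"
    then have "Q.arr c X Y" unfolding Q.arr_def by simp
    then show "Cmp V (loc (ad Y)) (ind (am c)) = Cmp V (ShiftM V (ind c)) (loc (ad X))"
      using am_natural(2)[OF o] by blast
  qed
  fix X Y Z u v w assume "(X, Y, Z, u, v, w) \<in> diagrams A"
  then have "Q.arr u X Y" "Q.arr v Y Z" "Q.arr w Z (aN X)" using ang_diagrams by blast+
  then show "((X, Y, Z, u, v, w) \<in> Tri A) =
      ((id X, id Y, id Z, ind u, ind v, Cmp V (loc (ad X)) (ind w)) \<in> Tri V)"
    unfolding id_def using ang_tri_verdier verdier_tri_ang by blast
qed

end

theorem theorem1p2:
  fixes T :: "('o, 'm) tcat"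
    and S XX YY ZZ PP :: "'o set"
    and U :: "('o, ('m \<times> 'm) set) tcat"
  assumes "triangulated_category T"
    and "thick T S"
    and "U = verdier T S"
    and "co_t_structure (full_sub T S) XX YY"
    and "torsion_pair T XX (right_perp T XX)"
    and "torsion_pair T (left_perp T YY) YY"
    and "ZZ = right_perp T XX \<inter> left_perp T (shifted T YY)"
    and "PP = shifted T XX \<inter> YY"
  shows
    \<comment> \<open>the equivalence \<open>\<Z>/[\<P>] \<simeq> \<U>\<close> along which the structure is transported\<close>
    "additive_equivalence (ideal_quotient T ZZ PP) U id (induced_mor T S) \<and>
     \<comment> \<open>(a)\<close>
     (\<forall>X\<in>ZZ. \<exists>\<delta>. approx_triangle T PP X \<delta>) \<and>
     (\<forall>\<Delta>. (\<forall>X\<in>ZZ. approx_triangle T PP X (\<Delta> X)) \<longrightarrow>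
        (\<forall>X\<in>ZZ. ang_obj \<Delta> X \<in> ZZ) \<and>
        (\<forall>X\<in>ZZ. \<forall>Y\<in>ZZ. \<forall>f\<in>Hom T X Y. ang_lifts T \<Delta> X Y f \<noteq> {}) \<and>
        (\<forall>X\<in>ZZ. \<forall>Y\<in>ZZ. \<forall>f1\<in>Hom T X Y. \<forall>f2\<in>Hom T X Y.
           ideal_class T ZZ PP f1 = ideal_class T ZZ PP f2 \<longrightarrow>
           (\<forall>f1'\<in>ang_lifts T \<Delta> X Y f1. \<forall>f2'\<in>ang_lifts T \<Delta> X Y f2.
              ideal_class T ZZ PP f1' = ideal_class T ZZ PP f2')) \<and>
        additive_equivalence (ideal_quotient T ZZ PP) (ideal_quotient T ZZ PP)
          (ang_obj \<Delta>) (ang_mor T ZZ PP \<Delta>) \<and>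
        (\<forall>X\<in>ZZ. \<forall>Y\<in>ZZ. \<forall>Z\<in>ZZ. \<forall>f g h. (X, Y, Z, f, g, h) \<in> Tri T \<longrightarrow>
           (\<exists>a. ang_data T ZZ \<Delta> (X, Y, Z, f, g, h) a)) \<and>
        transported_structure (ang T ZZ PP \<Delta>) U id (induced_mor T S)) \<and>
     \<comment> \<open>(b)\<close>
     perp_decomposition T [XX, ZZ, shifted T YY]"
proof -
  interpret silting_reduction T S XX YY
    using assms(1,2,4-6)
    by (intro silting_reduction.intro thick_subcategory.intro thick_subcategory_axioms.intro
      silting_reduction_axioms.intro)
  have U: "U = V" and Z: "ZZ = silting_reduction.ZZ T XX YY" and P: "PP = silting_reduction.PP T XX YY"
    using assms(3,7,8) unfolding ZZ_def PP_def by simp_all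
  let ?Z = "silting_reduction.ZZ T XX YY" and ?P = "silting_reduction.PP T XX YY"
  show ?thesis
    unfolding U Z P
  proof (intro conjI allI impI)
    show "additive_equivalence Q V id ind" by (rule ind_additive_equivalence)
    show "perp_decomposition T [XX, ?Z, shifted T YY]"
      by (rule perp_decomposition_XZY)
    show "\<forall>X\<in>?Z. \<exists>\<delta>. approx_triangle T (?P) X \<delta>"
      using ex_approx_triangle by blast
  next
    fix \<Delta> :: "('o, 'm) choice"
    assume "\<forall>X\<in>?Z. approx_triangle T (?P) X (\<Delta> X)"
    then interpret approx_choice T S XX YY \<Delta>
      by unfold_locales blast
    show "\<forall>X\<in>?Z. ang_obj \<Delta> X \<in> ?Z"
      using aN_ZZ by blast
    show "\<forall>X\<in>?Z. \<forall>Y\<in>?Z. \<forall>f\<in>Hom T X Y.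
        ang_lifts T \<Delta> X Y f \<noteq> {}"
      using ex_lift hom_arr ZZ_obj by blast
    show "\<forall>X\<in>?Z. \<forall>Y\<in>?Z.
        \<forall>f1\<in>Hom T X Y. \<forall>f2\<in>Hom T X Y. ic f1 = ic f2 \<longrightarrow>
          (\<forall>f1'\<in>ang_lifts T \<Delta> X Y f1. \<forall>f2'\<in>ang_lifts T \<Delta> X Y f2. ic f1' = ic f2')"
    proof (intro ballI impI)
      fix X Y f1 f2 f1' f2'
      assume o: "X \<in> ?Z" "Y \<in> ?Z"
        and eq: "ic f1 = ic f2" and l: "f1' \<in> ang_lifts T \<Delta> X Y f1" "f2' \<in> ang_lifts T \<Delta> X Y f2"
      show "ic f1' = ic f2'" using am_ic[OF o l(1)] am_ic[OF o l(2)] eq by simp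
    qed
    show "additive_equivalence Q Q (ang_obj \<Delta>) am" by (rule am_additive_equivalence)
    show "\<forall>X\<in>?Z. \<forall>Y\<in>?Z.
        \<forall>Z\<in>?Z. \<forall>f g h. (X, Y, Z, f, g, h) \<in> Tri T \<longrightarrow>
          (\<exists>a. ang_data T (?Z) \<Delta> (X, Y, Z, f, g, h) a)"
      using ex_ang_data by blast
    show "transported_structure A V id ind" by (rule ang_transported)
  qed
qed

end
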